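(* Let $R$ be an $F$-finite ring, $f\in R$ a non-zero divisor, $j:\operatorname{Spec}R_f\to\operatorname{Spec}R$ the open immersion, and $(M,\kappa)$ a coherent Cartier module on $R_f$. Let $N,N'\subseteq j_*M$ be coherent Cartier submodules (over $R$) for which the inclusions into $j_*M$ are local nil-isomorphisms. Then $\tau(N,f^t)=\tau(N',f^t)$ as submodules of $j_*M$ for all $t\in\mathbb{Q}_{\ge0}$. If additionally $(M,\kappa)$ is $F$-regular, then $f$ is a test element for $N$ and for $N'$ (with respect to the Cartier algebra $\mathcal{C}$ attached to $f^t$, for every $t\in\mathbb{Q}_{\ge 0}$).
   Context: Rings are noetherian of characteristic $p>0$; $R$ is $F$-finite if the Frobenius $F:R\to F_*R$ is finite. A Cartier module $(M,\kappa)$ over $R$ is an $R$-module with an $R$-linear map $\kappa:F_*M\to M$; it is coherent if $M$ is finitely generated. If $(M,\kappa)$ is a Cartier module on $R_f$, $j_*M$ is $M$ viewed as an $R$-module with the same $\kappa$. A Cartier module is nilpotent if $\kappa^eM=0$ for some $e$, locally nilpotent if it is a union of nilpotent Cartier submodules; a morphism is a (local) nil-isomorphism if kernel and cokernel are (locally) nilpotent. More generally let $\mathcal{C}$ be a graded algebra of such operators acting on a coherent module $M$ ($\mathcal{C}_0$ is the image of $R$, elements of $\mathcal{C}_e$ act as $R$-linear maps $F^e_*M\to M$), $\mathcal{C}_+=\bigoplus_{e\ge1}\mathcal{C}_e$. Put $\underline{M}_{\mathcal{C}}=(\mathcal{C}_+)^hM$ for $h\gg0$ (this stabilizes). $(M,\mathcal{C})$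 is $F$-pure if $\underline{M}_{\mathcal{C}}=M$; it is $F$-regular if it is $F$-pure and any $\mathcal{C}$-submodule $N$ with $N_\eta=M_\eta$ for all generic points $\eta$ of $\operatorname{Supp}M$ equals $M$. $(M,\kappa)$ is called $F$-regular if it is so for the algebra $\langle\kappa\rangle$ generated by $\kappa$. An element $x\in R$ is a test element for $(M,\mathcal{C})$ if $D(x)\cap\operatorname{Supp}\underline{M}_{\mathcal{C}}$ is dense in $\operatorname{Supp}\underline{M}_{\mathcal{C}}$ and the localization $(\underline{M}_{\mathcal{C}})_x$ is $F$-regular (with respect to the induced algebra). The test module $\tau(M,\mathcal{C})$ is the smallest $\mathcal{C}$-submodule of $M$ that agrees with $\underline{M}_{\mathcal{C}}$ at all generic points of $\operatorname{Supp}\underline{M}_{\mathcal{C}}$ (it exists if there is a test element). For $f\in R$, $t\in\mathbb{Q}_{\ge0}$, the Cartier algebra attached to $f^t$ has $\mathcal{C}_0=R$ and $\mathcal{C}_e=\kappa^ef^{\lceil tp^e\rceil}R$ for $e\ge1$, and $\tau(M,f^t)=\tau(M,\mathcal{C})$. The equality of test modules is understood as: one exists if and only if the other does, and then they agree. *)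

theory Defs
  imports
    "HOL-Algebra.Module"
    "HOL-Algebra.AbelCoset"
    "HOL-Algebra.Ring_Divisibility"
    "HOL-Computational_Algebra.Primes"
    "HOL-Analysis.Abstract_Topology"
begin

text \<open>
  Modules are records in the sense of \<^locale>\<open>module\<close>; their ring fields \<open>mult\<close> and \<open>one\<close> carry
  no information.  A submodule \<open>N\<close> of \<open>M\<close>, regarded as a module, is \<open>M\<lparr>carrier := N\<rparr>\<close>.
\<close>

section \<open>Modules over a commutative ring\<close>

definition lin_maps ::
  "('a, 'r) ring_scheme \<Rightarrow> ('a, 'm, 'c) module_scheme \<Rightarrow> ('a, 'n, 'd) module_scheme \<Rightarrow> ('m \<Rightarrow> 'n) set"
  where "lin_maps R M N = {h \<in> carrier M \<rightarrow> carrier N.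
    (\<forall>x\<in>carrier M. \<forall>y\<in>carrier M. h (x \<oplus>\<^bsub>M\<^esub> y) = h x \<oplus>\<^bsub>N\<^esub> h y) \<and>
    (\<forall>r\<in>carrier R. \<forall>x\<in>carrier M. h (r \<odot>\<^bsub>M\<^esub> x) = r \<odot>\<^bsub>N\<^esub> h x)}"

definition mod_span ::
  "('a, 'r) ring_scheme \<Rightarrow> ('a, 'm, 'c) module_scheme \<Rightarrow> 'm set \<Rightarrow> 'm set"
  where "mod_span R M A = \<Inter>{H. submodule H R M \<and> A \<subseteq> H}"

definition fin_gen :: "('a, 'r) ring_scheme \<Rightarrow> ('a, 'm, 'c) module_scheme \<Rightarrow> bool"
  where "fin_gen R M \<longleftrightarrow> (\<exists>A \<subseteq> carrier M. finite A \<and> mod_span R M A = carrier M)"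

definition regular_module :: "('a, 'r) ring_scheme \<Rightarrow> ('a, 'a) module"
  where "regular_module R =
    \<lparr>carrier = carrier R, mult = mult R, one = one R, zero = zero R, add = add R, smult = mult R\<rparr>"

text \<open>The cosets are those of the additive group; scalars act as \<open>r (x + N) = r x + N\<close>.\<close>

definition quot_module :: "('a, 'm, 'c) module_scheme \<Rightarrow> 'm set \<Rightarrow> ('a, 'm set) module"
  where "quot_module M N =
    \<lparr>carrier = a_rcosets\<^bsub>M\<^esub> N, mult = undefined, one = undefined,
     zero = N, add = (\<lambda>X Y. X <+>\<^bsub>M\<^esub> Y),
     smult = (\<lambda>r X. \<Union>x\<in>X. N +>\<^bsub>M\<^esub> (r \<odot>\<^bsub>M\<^esub> x))\<rparr>"

section \<open>Localization at a multiplicative set\<close>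

text \<open>The fraction \<open>m / s\<close>, as an equivalence class of pairs in \<open>M \<times> S\<close>.\<close>

definition fraction ::
  "('a, 'r) ring_scheme \<Rightarrow> 'a set \<Rightarrow> ('a, 'm, 'c) module_scheme \<Rightarrow> 'm \<Rightarrow> 'a \<Rightarrow> ('m \<times> 'a) set"
  where "fraction R S M m s =
    {(n, t) \<in> carrier M \<times> S. \<exists>u\<in>S. u \<odot>\<^bsub>M\<^esub> (t \<odot>\<^bsub>M\<^esub> m) = u \<odot>\<^bsub>M\<^esub> (s \<odot>\<^bsub>M\<^esub> n)}"

text \<open>
  Operations on fractions are taken as the union of the results over all representatives; these
  results coincide, so that the union is again a single fraction.
\<close>

definition loc_module ::
  "('a, 'r) ring_scheme \<Rightarrow> 'a set \<Rightarrow> ('a, 'm, 'c) module_scheme \<Rightarrow> (('a \<times> 'a) set, ('m \<times> 'a) set) module"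
  where "loc_module R S M =
    \<lparr>carrier = {fraction R S M m s | m s. m \<in> carrier M \<and> s \<in> S},
     mult = undefined, one = undefined,
     zero = fraction R S M \<zero>\<^bsub>M\<^esub> \<one>\<^bsub>R\<^esub>,
     add = (\<lambda>X Y. \<Union>(m, s)\<in>X. \<Union>(n, t)\<in>Y. fraction R S M (t \<odot>\<^bsub>M\<^esub> m \<oplus>\<^bsub>M\<^esub> s \<odot>\<^bsub>M\<^esub> n) (s \<otimes>\<^bsub>R\<^esub> t)),
     smult = (\<lambda>A X. \<Union>(r, s)\<in>A. \<Union>(m, t)\<in>X. fraction R S M (r \<odot>\<^bsub>M\<^esub> m) (s \<otimes>\<^bsub>R\<^esub> t))\<rparr>"

text \<open>The localized ring is the localization of \<open>R\<close> as a module over itself, where now the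
  scalar multiplication is multiplication.\<close>

definition loc_ring :: "('a, 'r) ring_scheme \<Rightarrow> 'a set \<Rightarrow> ('a \<times> 'a) set ring"
  where "loc_ring R S = (let L = loc_module R S (regular_module R) in
    \<lparr>carrier = carrier L, mult = smult L,
     one = fraction R S (regular_module R) \<one>\<^bsub>R\<^esub> \<one>\<^bsub>R\<^esub>, zero = zero L, add = add L\<rparr>)"

text \<open>The image in \<open>S\<^sup>-\<^sup>1M\<close> of the localization of a submodule \<open>N \<subseteq> M\<close>.\<close>

definition loc_sub ::
  "('a, 'r) ring_scheme \<Rightarrow> 'a set \<Rightarrow> ('a, 'm, 'c) module_scheme \<Rightarrow> 'm set \<Rightarrow> ('m \<times> 'a) set set"
  where "loc_sub R S M N = {fraction R S M n s | n s. n \<in> N \<and> s \<in> S}"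

text \<open>\<open>{1, x, x\<^sup>2, \<dots>}\<close>, so that \<open>loc_ring R (powers R x)\<close> is \<open>R\<^sub>x\<close>.\<close>

definition powers :: "('a, 'r) ring_scheme \<Rightarrow> 'a \<Rightarrow> 'a set"
  where "powers R x = {x [^]\<^bsub>R\<^esub> (n::nat) | n. True}"

text \<open>\<open>j\<^sub>*M\<close> for a module \<open>M\<close> over \<open>S\<^sup>-\<^sup>1R\<close>: restriction of scalars along \<open>r \<mapsto> r / 1\<close>.\<close>

definition push_loc ::
  "('a, 'r) ring_scheme \<Rightarrow> 'a set \<Rightarrow> (('a \<times> 'a) set, 'm, 'c) module_scheme \<Rightarrow> ('a, 'm) module"
  where "push_loc R S M =
    \<lparr>carrier = carrier M, mult = mult M, one = one M, zero = zero M, add = add M,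
     smult = (\<lambda>r m. fraction R S (regular_module R) r \<one>\<^bsub>R\<^esub> \<odot>\<^bsub>M\<^esub> m)\<rparr>"

section \<open>Spectrum and support\<close>

definition basic_open :: "('a, 'r) ring_scheme \<Rightarrow> 'a \<Rightarrow> 'a set set"
  where "basic_open R x = {P. primeideal P R \<and> x \<notin> P}"

definition zariski :: "('a, 'r) ring_scheme \<Rightarrow> 'a set topology"
  where "zariski R = topology_generated_by (basic_open R ` carrier R)"

definition Supp :: "('a, 'r) ring_scheme \<Rightarrow> ('a, 'm, 'c) module_scheme \<Rightarrow> 'a set set"
  where "Supp R M = {P. primeideal P R \<and>
    carrier (loc_module R (carrier R - P) M) \<noteq> {\<zero>\<^bsub>loc_module R (carrier R - P) M\<^esub>}}"

text \<open>Generic points of (the irreducible components of) the support are its minimal primes.\<close>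

definition generic_points :: "('a, 'r) ring_scheme \<Rightarrow> ('a, 'm, 'c) module_scheme \<Rightarrow> 'a set set"
  where "generic_points R M = {P \<in> Supp R M. \<forall>Q\<in>Supp R M. Q \<subseteq> P \<longrightarrow> Q = P}"

definition agree_generically ::
  "('a, 'r) ring_scheme \<Rightarrow> ('a, 'm, 'c) module_scheme \<Rightarrow> 'a set set \<Rightarrow> 'm set \<Rightarrow> 'm set \<Rightarrow> bool"
  where "agree_generically R M Z N N' \<longleftrightarrow>
    (\<forall>P\<in>Z. loc_sub R (carrier R - P) M N = loc_sub R (carrier R - P) M N')"

section \<open>Frobenius and Cartier modules\<close>

text \<open>\<open>F\<^sup>e\<^sub>*M\<close>\<close>

definition frob_push ::
  "('a, 'r) ring_scheme \<Rightarrow> nat \<Rightarrow> nat \<Rightarrow> ('a, 'm, 'c) module_scheme \<Rightarrow> ('a, 'm, 'c) module_scheme"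
  where "frob_push R p e M = M\<lparr>smult := (\<lambda>r m. (r [^]\<^bsub>R\<^esub> (p ^ e)) \<odot>\<^bsub>M\<^esub> m)\<rparr>"

definition F_finite :: "('a, 'r) ring_scheme \<Rightarrow> nat \<Rightarrow> bool"
  where "F_finite R p \<longleftrightarrow> fin_gen R (frob_push R p 1 (regular_module R))"

definition cartier_module ::
  "('a, 'r) ring_scheme \<Rightarrow> nat \<Rightarrow> ('a, 'm, 'c) module_scheme \<Rightarrow> ('m \<Rightarrow> 'm) \<Rightarrow> bool"
  where "cartier_module R p M \<kappa> \<longleftrightarrow> module R M \<and> \<kappa> \<in> lin_maps R (frob_push R p 1 M) M"

definition cartier_submodule ::
  "('a, 'r) ring_scheme \<Rightarrow> ('a, 'm, 'c) module_scheme \<Rightarrow> ('m \<Rightarrow> 'm) \<Rightarrow> 'm set \<Rightarrow> bool"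
  where "cartier_submodule R M \<kappa> N \<longleftrightarrow> submodule N R M \<and> \<kappa> ` N \<subseteq> N"

definition nilpotent_cartier :: "('a, 'm, 'c) module_scheme \<Rightarrow> ('m \<Rightarrow> 'm) \<Rightarrow> bool"
  where "nilpotent_cartier M \<kappa> \<longleftrightarrow> (\<exists>e::nat. \<forall>m\<in>carrier M. (\<kappa> ^^ e) m = \<zero>\<^bsub>M\<^esub>)"

definition locally_nilpotent_cartier ::
  "('a, 'r) ring_scheme \<Rightarrow> ('a, 'm, 'c) module_scheme \<Rightarrow> ('m \<Rightarrow> 'm) \<Rightarrow> bool"
  where "locally_nilpotent_cartier R M \<kappa> \<longleftrightarrow>
    carrier M = \<Union>{L. cartier_submodule R M \<kappa> L \<and> nilpotent_cartier (M\<lparr>carrier := L\<rparr>) \<kappa>}"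

text \<open>The map \<open>x + N \<mapsto> \<kappa> x + N\<close> induced on a quotient.\<close>

definition quot_map ::
  "('a, 'm, 'c) module_scheme \<Rightarrow> 'm set \<Rightarrow> ('m \<Rightarrow> 'm) \<Rightarrow> 'm set \<Rightarrow> 'm set"
  where "quot_map M N \<kappa> = (\<lambda>X. \<Union>x\<in>X. N +>\<^bsub>M\<^esub> \<kappa> x)"

definition local_nil_isomorphism ::
  "('a, 'r) ring_scheme \<Rightarrow> ('a, 'm, 'c) module_scheme \<Rightarrow> ('m \<Rightarrow> 'm) \<Rightarrow>
   ('a, 'n, 'd) module_scheme \<Rightarrow> ('n \<Rightarrow> 'n) \<Rightarrow> ('m \<Rightarrow> 'n) \<Rightarrow> bool"
  where "local_nil_isomorphism R M \<kappa> M' \<kappa>' h \<longleftrightarrow>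
    h \<in> lin_maps R M M' \<and> (\<forall>m\<in>carrier M. h (\<kappa> m) = \<kappa>' (h m)) \<and>
    locally_nilpotent_cartier R (M\<lparr>carrier := {m \<in> carrier M. h m = \<zero>\<^bsub>M'\<^esub>}\<rparr>) \<kappa> \<and>
    locally_nilpotent_cartier R (quot_module M' (h ` carrier M)) (quot_map M' (h ` carrier M) \<kappa>')"

section \<open>Algebras of Cartier operators\<close>

text \<open>
  A graded algebra acting on \<open>M\<close> is given by the family \<open>C\<close> of its sets of operators: \<open>C e\<close>
  consists of the maps \<open>M \<rightarrow> M\<close> by which the degree \<open>e\<close> part acts.  Only the values of these
  functions on the carrier matter.  None of the definitions below requires \<open>C\<close> to be closed under
  sums and products, but the algebras they are applied to are.
\<close>

text \<open>The operators of the algebra generated by \<open>\<kappa>\<close> over the image of \<open>R\<close>.\<close>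

inductive generated_operator ::
  "('a, 'r) ring_scheme \<Rightarrow> ('a, 'm, 'c) module_scheme \<Rightarrow> ('m \<Rightarrow> 'm) \<Rightarrow> nat \<Rightarrow> ('m \<Rightarrow> 'm) \<Rightarrow> bool"
  for R M \<kappa> where
  scalar: "r \<in> carrier R \<Longrightarrow> generated_operator R M \<kappa> 0 (\<lambda>m. r \<odot>\<^bsub>M\<^esub> m)"
| generator: "generated_operator R M \<kappa> 1 \<kappa>"
| sum: "generated_operator R M \<kappa> e \<phi> \<Longrightarrow> generated_operator R M \<kappa> e \<psi> \<Longrightarrow>
    generated_operator R M \<kappa> e (\<lambda>m. \<phi> m \<oplus>\<^bsub>M\<^esub> \<psi> m)"
| product: "generated_operator R M \<kappa> d \<phi> \<Longrightarrow> generated_operator R M \<kappa> e \<psi> \<Longrightarrow>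
    generated_operator R M \<kappa> (d + e) (\<phi> \<circ> \<psi>)"

definition generated_algebra ::
  "('a, 'r) ring_scheme \<Rightarrow> ('a, 'm, 'c) module_scheme \<Rightarrow> ('m \<Rightarrow> 'm) \<Rightarrow> nat \<Rightarrow> ('m \<Rightarrow> 'm) set"
  where "generated_algebra R M \<kappa> e = {\<phi>. generated_operator R M \<kappa> e \<phi>}"

text \<open>The algebra attached to \<open>f\<^sup>t\<close>; \<open>\<kappa>\<^sup>e f\<^sup>n r\<close> is the operator \<open>m \<mapsto> \<kappa>\<^sup>e (f\<^sup>n r m)\<close>.\<close>

definition power_algebra ::
  "('a, 'r) ring_scheme \<Rightarrow> nat \<Rightarrow> ('a, 'm, 'c) module_scheme \<Rightarrow> ('m \<Rightarrow> 'm) \<Rightarrow> 'a \<Rightarrow> rat \<Rightarrow>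
   nat \<Rightarrow> ('m \<Rightarrow> 'm) set"
  where "power_algebra R p M \<kappa> f t e =
    (if e = 0 then {(\<lambda>m. r \<odot>\<^bsub>M\<^esub> m) | r. r \<in> carrier R}
     else {(\<lambda>m. (\<kappa> ^^ e) ((f [^]\<^bsub>R\<^esub> nat \<lceil>t * of_nat (p ^ e)\<rceil> \<otimes>\<^bsub>R\<^esub> r) \<odot>\<^bsub>M\<^esub> m)) | r. r \<in> carrier R})"

text \<open>
  An operator \<open>\<phi>\<close> of degree \<open>e\<close> extends to \<open>S\<^sup>-\<^sup>1M\<close> by \<open>\<phi> (m / s) = \<phi> (s\<^sup>q\<^sup>-\<^sup>1 m) / s\<close>
  with \<open>q = p\<^sup>e\<close>.  The degree \<open>e\<close> part of the induced algebra over \<open>S\<^sup>-\<^sup>1R\<close> consists of the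
  products \<open>\<phi> (1 / t)\<close>, that is, \<open>m / s \<mapsto> \<phi> (m / (s t))\<close>; by taking common
  denominators these are all elements of \<open>C\<^sub>e S\<^sup>-\<^sup>1R\<close>.
\<close>

definition loc_operator ::
  "('a, 'r) ring_scheme \<Rightarrow> nat \<Rightarrow> 'a set \<Rightarrow> ('a, 'm, 'c) module_scheme \<Rightarrow> nat \<Rightarrow> ('m \<Rightarrow> 'm) \<Rightarrow> 'a \<Rightarrow>
   ('m \<times> 'a) set \<Rightarrow> ('m \<times> 'a) set"
  where "loc_operator R p S M e \<phi> t = (\<lambda>X. \<Union>(m, s)\<in>X.
    fraction R S M (\<phi> (((s \<otimes>\<^bsub>R\<^esub> t) [^]\<^bsub>R\<^esub> (p ^ e - 1)) \<odot>\<^bsub>M\<^esub> m)) (s \<otimes>\<^bsub>R\<^esub> t))"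

definition loc_algebra ::
  "('a, 'r) ring_scheme \<Rightarrow> nat \<Rightarrow> 'a set \<Rightarrow> ('a, 'm, 'c) module_scheme \<Rightarrow> (nat \<Rightarrow> ('m \<Rightarrow> 'm) set) \<Rightarrow>
   nat \<Rightarrow> (('m \<times> 'a) set \<Rightarrow> ('m \<times> 'a) set) set"
  where "loc_algebra R p S M C e = {loc_operator R p S M e \<phi> t | \<phi> t. \<phi> \<in> C e \<and> t \<in> S}"

definition alg_submodule ::
  "('a, 'r) ring_scheme \<Rightarrow> ('a, 'm, 'c) module_scheme \<Rightarrow> (nat \<Rightarrow> ('m \<Rightarrow> 'm) set) \<Rightarrow> 'm set \<Rightarrow> bool"
  where "alg_submodule R M C N \<longleftrightarrow> submodule N R M \<and> (\<forall>e. \<forall>\<phi>\<in>C e. \<phi> ` N \<subseteq> N)"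

text \<open>\<open>C\<^sub>+ N\<close>; iterating it \<open>h\<close> times gives \<open>(C\<^sub>+)\<^sup>h N\<close>.\<close>

definition plus_image ::
  "('a, 'r) ring_scheme \<Rightarrow> ('a, 'm, 'c) module_scheme \<Rightarrow> (nat \<Rightarrow> ('m \<Rightarrow> 'm) set) \<Rightarrow> 'm set \<Rightarrow> 'm set"
  where "plus_image R M C N = mod_span R M (\<Union>e\<in>{1..}. \<Union>\<phi>\<in>C e. \<phi> ` N)"

definition is_stable_image ::
  "('a, 'r) ring_scheme \<Rightarrow> ('a, 'm, 'c) module_scheme \<Rightarrow> (nat \<Rightarrow> ('m \<Rightarrow> 'm) set) \<Rightarrow> 'm set \<Rightarrow> bool"
  where "is_stable_image R M C U \<longleftrightarrow>
    (\<forall>\<^sub>F h in sequentially. (plus_image R M C ^^ h) (carrier M) = U)"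

definition stable_image ::
  "('a, 'r) ring_scheme \<Rightarrow> ('a, 'm, 'c) module_scheme \<Rightarrow> (nat \<Rightarrow> ('m \<Rightarrow> 'm) set) \<Rightarrow> 'm set"
  where "stable_image R M C = (THE U. is_stable_image R M C U)"

definition F_pure ::
  "('a, 'r) ring_scheme \<Rightarrow> ('a, 'm, 'c) module_scheme \<Rightarrow> (nat \<Rightarrow> ('m \<Rightarrow> 'm) set) \<Rightarrow> bool"
  where "F_pure R M C \<longleftrightarrow> is_stable_image R M C (carrier M)"

definition F_regular ::
  "('a, 'r) ring_scheme \<Rightarrow> ('a, 'm, 'c) module_scheme \<Rightarrow> (nat \<Rightarrow> ('m \<Rightarrow> 'm) set) \<Rightarrow> bool"
  where "F_regular R M C \<longleftrightarrow> F_pure R M C \<and>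
    (\<forall>N. alg_submodule R M C N \<and> agree_generically R M (generic_points R M) N (carrier M)
      \<longrightarrow> N = carrier M)"

definition test_element ::
  "('a, 'r) ring_scheme \<Rightarrow> nat \<Rightarrow> ('a, 'm, 'c) module_scheme \<Rightarrow> (nat \<Rightarrow> ('m \<Rightarrow> 'm) set) \<Rightarrow> 'a \<Rightarrow> bool"
  where "test_element R p M C x \<longleftrightarrow> x \<in> carrier R \<and>
    (let U = M\<lparr>carrier := stable_image R M C\<rparr>; S = powers R x in
      Supp R U \<subseteq> zariski R closure_of (basic_open R x \<inter> Supp R U) \<and>
      F_regular (loc_ring R S) (loc_module R S U) (loc_algebra R p S U C))"

text \<open>\<open>T = \<tau>(M, C)\<close>, including the assertion that the test module exists.\<close>

definition is_test_module ::
  "('a, 'r) ring_scheme \<Rightarrow> ('a, 'm, 'c) module_scheme \<Rightarrow> (nat \<Rightarrow> ('m \<Rightarrow> 'm) set) \<Rightarrow> 'm set \<Rightarrow> bool"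
  where "is_test_module R M C T \<longleftrightarrow>
    (let U = stable_image R M C;
         agrees = (\<lambda>N. alg_submodule R M C N \<and>
           agree_generically R M (generic_points R (M\<lparr>carrier := U\<rparr>)) N U)
     in agrees T \<and> (\<forall>N. agrees N \<longrightarrow> T \<subseteq> N))"

end

theory Submission
  imports Defs
begin

text \<open>
  Write \<open>V = j\<^sub>*M\<close>, \<open>S = {1, f, f\<^sup>2, \<dots>}\<close> and \<open>C\<close> for the algebra attached to \<open>f\<^sup>t\<close>.  Multiplication by \<open>f\<close> is
  bijective on \<open>V\<close>, and that \<open>N \<subseteq> V\<close> is a local nil-isomorphism means that every element of \<open>V\<close>
  is carried into \<open>N\<close>, together with all its multiples, by a power of \<open>\<kappa>\<close>.

  \<^emph>\<open>Test modules.\<close> As \<open>N'\<close> is finitely generated, one power \<open>\<kappa>\<^sup>k\<close> carries all of it into \<open>N\<close>.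
  An operator of \<open>(C\<^sub>+)\<^sup>k\<close> applies \<open>\<kappa>\<close> at least \<open>k\<close> times, so \<open>(C\<^sub>+)\<^sup>k N' \<subseteq> N\<close>, and likewise with the
  roles exchanged.  Hence \<open>N\<close> and \<open>N'\<close> have the same stable image \<open>U\<close>, contained in both
  (\<open>stable_image_subset\<close>).  Intersecting a competitor with \<open>U\<close> shows that the test module may be
  computed inside \<open>U\<close>, without reference to \<open>N\<close> (\<open>is_test_module_iff\<close>).

  The argument needs the sequence \<open>(C\<^sub>+)\<^sup>h N\<close> to stabilize.  For this let \<open>I\<close> be the eventual value of
  the increasing annihilators of the successive quotients.  For \<open>x \<in> I\<close> the rule
  \<open>x \<phi>(y) = \<phi>(x\<^sup>q y)\<close> with \<open>q \<ge> 2\<close> shows that \<open>x\<^sup>2\<close> maps a term of the sequence into all later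
  ones, so that the whole descent happens in a module killed by the squares of the elements of \<open>I\<close>.
  At a minimal prime of \<open>I\<close> this module has finite length, so the sequence is stationary there, which
  contradicts the choice of \<open>I\<close> unless \<open>I\<close> is the unit ideal.  The proof of
  \<open>iterated_image_stabilizes\<close> performs this with elements: a maximal multiplicative set disjoint from
  \<open>I\<close> takes the place of the minimal prime, and adding one element after the other, each with prime
  annihilator modulo the previous ones, takes the place of a composition series.

  \<^emph>\<open>Test elements.\<close> The open set \<open>D(f)\<close> is dense in the support of \<open>U\<close> because \<open>f\<close> is injective on
  \<open>U\<close> (\<open>Supp_dense\<close>).  If \<open>M\<close> is \<open>F\<close>-regular, then \<open>\<kappa>\<close> is surjective on \<open>M\<close>.  A power of \<open>\<kappa>\<close> sends
  \<open>M\<close> into \<open>N\<^sub>f\<close>, so that \<open>N\<^sub>f = M\<close>; since \<open>f\<close> is a unit, \<open>C\<^sub>+\<close> does not shrink the localization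
  either, and therefore \<open>U\<^sub>f = M\<close>.  Under this identification the algebra induced by \<open>C\<close> contains
  \<open>\<kappa>\<close>: it is the operator \<open>\<kappa> f\<^sup>a\<close> multiplied by the denominator \<open>f\<^sup>a\<close>.  So the submodules of \<open>U\<^sub>f\<close>
  that are stable under the induced algebra are among those stable under \<open>\<langle>\<kappa>\<rangle>\<close>, and
  \<open>F\<close>-regularity passes from \<open>M\<close> to \<open>U\<^sub>f\<close> (\<open>F_regular_L\<close>).
\<close>

section \<open>Submodules and noetherian modules\<close>

context module
begin

lemma smult_comm:
  "r \<in> carrier R \<Longrightarrow> s \<in> carrier R \<Longrightarrow> x \<in> carrier M \<Longrightarrow>
    r \<odot>\<^bsub>M\<^esub> (s \<odot>\<^bsub>M\<^esub> x) = s \<odot>\<^bsub>M\<^esub> (r \<odot>\<^bsub>M\<^esub> x)"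
  by (simp add: smult_assoc1[symmetric] R.m_comm)

lemma submodule_iff:
  "submodule H R M \<longleftrightarrow> H \<subseteq> carrier M \<and> \<zero>\<^bsub>M\<^esub> \<in> H \<and> (\<forall>a\<in>H. \<forall>b\<in>H. a \<oplus>\<^bsub>M\<^esub> b \<in> H) \<and>
    (\<forall>r\<in>carrier R. \<forall>a\<in>H. r \<odot>\<^bsub>M\<^esub> a \<in> H)" (is "_ \<longleftrightarrow> ?P")
proof
  assume H: "submodule H R M"
  then show ?P
    using submoduleE[OF H] subgroup.one_closed[OF submodule.axioms(1)[OF H]] by auto
next
  assume P: ?P
  have "\<ominus>\<^bsub>M\<^esub> a \<in> H" if "a \<in> H" for a
  proof -
    have "\<ominus>\<^bsub>M\<^esub> a = (\<ominus>\<^bsub>R\<^esub> \<one>\<^bsub>R\<^esub>) \<odot>\<^bsub>M\<^esub> a"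
      using P that smult_l_minus[of "\<one>\<^bsub>R\<^esub>" a] by auto
    then show ?thesis using P that by auto
  qed
  then show "submodule H R M"
    using P by (intro submoduleI) auto
qed

lemma submodule_minus_closed:
  "submodule H R M \<Longrightarrow> a \<in> H \<Longrightarrow> b \<in> H \<Longrightarrow> a \<ominus>\<^bsub>M\<^esub> b \<in> H"
  using submoduleE(3,5) by (auto simp: a_minus_def)

text \<open>
  The definitions treat a submodule as a module in its own right; this brings all submodules in
  play back into one ambient module, where they can be compared.
\<close>

lemma submodule_restrict_iff:
  assumes "submodule N R M"
  shows "submodule H R (M\<lparr>carrier := N\<rparr>) \<longleftrightarrow> submodule H R M \<and> H \<subseteq> N"
proof -
  interpret N: module R "M\<lparr>carrier := N\<rparr>"
    using submodule.submodule_is_module[OF assms module_axioms] .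
  show ?thesis
    using assms by (auto simp: N.submodule_iff submodule_iff)
qed

lemma submodule_Int:
  "submodule H R M \<Longrightarrow> submodule K R M \<Longrightarrow> submodule (H \<inter> K) R M"
  by (auto simp: submodule_iff)

lemma submodule_preimage_smult:
  assumes "submodule H R M" "x \<in> carrier R"
  shows "submodule {v \<in> carrier M. x \<odot>\<^bsub>M\<^esub> v \<in> H} R M"
  using assms by (auto simp: submodule_iff smult_r_distr smult_comm[of x])

lemma mod_span_least: "submodule H R M \<Longrightarrow> A \<subseteq> H \<Longrightarrow> mod_span R M A \<subseteq> H"
  unfolding mod_span_def by blast

lemma mod_span_incl: "A \<subseteq> mod_span R M A"
  unfolding mod_span_def by blast

lemma mod_span_mono: "A \<subseteq> B \<Longrightarrow> mod_span R M A \<subseteq> mod_span R M B"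
  unfolding mod_span_def by blast

lemma submodule_mod_span:
  assumes "A \<subseteq> carrier M"
  shows "submodule (mod_span R M A) R M"
proof -
  have "carrier M \<in> {H. submodule H R M \<and> A \<subseteq> H}"
    using assms carrier_is_submodule by auto
  then show ?thesis
    unfolding mod_span_def by (auto simp: submodule_iff)
qed

lemma mod_span_restrict:
  assumes N: "submodule N R M" and A: "A \<subseteq> N"
  shows "mod_span R (M\<lparr>carrier := N\<rparr>) A = mod_span R M A"
proof
  interpret N: module R "M\<lparr>carrier := N\<rparr>"
    using submodule.submodule_is_module[OF N module_axioms] .
  have AM: "A \<subseteq> carrier M" using N A by (auto simp: submodule_iff)
  have "submodule (mod_span R M A) R (M\<lparr>carrier := N\<rparr>)"
    using submodule_restrict_iff[OF N] submodule_mod_span[OF AM] mod_span_least[OF N A] by auto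
  then show "mod_span R (M\<lparr>carrier := N\<rparr>) A \<subseteq> mod_span R M A"
    using N.mod_span_least mod_span_incl by blast
  have "submodule (mod_span R (M\<lparr>carrier := N\<rparr>) A) R (M\<lparr>carrier := N\<rparr>)"
    using N.submodule_mod_span A by auto
  then show "mod_span R M A \<subseteq> mod_span R (M\<lparr>carrier := N\<rparr>) A"
    using submodule_restrict_iff[OF N] mod_span_least N.mod_span_incl by blast
qed

lemma submodule_add_multiples:
  assumes Y: "submodule Y R M" and a: "a \<in> carrier M"
  shows "submodule {r \<odot>\<^bsub>M\<^esub> a \<oplus>\<^bsub>M\<^esub> y | r y. r \<in> carrier R \<and> y \<in> Y} R M" (is "submodule ?H R M")
proof -
  have YM: "y \<in> carrier M" if "y \<in> Y" for y using Y that by (auto simp: submodule_iff)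
  show ?thesis unfolding submodule_iff
  proof (intro conjI ballI)
    show "?H \<subseteq> carrier M" using a YM by auto
    have "\<zero>\<^bsub>M\<^esub> = \<zero>\<^bsub>R\<^esub> \<odot>\<^bsub>M\<^esub> a \<oplus>\<^bsub>M\<^esub> \<zero>\<^bsub>M\<^esub>" using a by simp
    then show "\<zero>\<^bsub>M\<^esub> \<in> ?H" using Y R.zero_closed unfolding submodule_iff by blast
  next
    fix u v assume "u \<in> ?H" "v \<in> ?H"
    then obtain r y r' y' where *: "r \<in> carrier R" "y \<in> Y" "r' \<in> carrier R" "y' \<in> Y"
      "u = r \<odot>\<^bsub>M\<^esub> a \<oplus>\<^bsub>M\<^esub> y" "v = r' \<odot>\<^bsub>M\<^esub> a \<oplus>\<^bsub>M\<^esub> y'" by blast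
    have "u \<oplus>\<^bsub>M\<^esub> v = (r \<oplus>\<^bsub>R\<^esub> r') \<odot>\<^bsub>M\<^esub> a \<oplus>\<^bsub>M\<^esub> (y \<oplus>\<^bsub>M\<^esub> y')"
      using * a YM by (simp add: smult_l_distr M.a_ac)
    moreover have "y \<oplus>\<^bsub>M\<^esub> y' \<in> Y" using Y * by (auto simp: submodule_iff)
    ultimately show "u \<oplus>\<^bsub>M\<^esub> v \<in> ?H" using * by blast
  next
    fix s u assume s: "s \<in> carrier R" and "u \<in> ?H"
    then obtain r y where *: "r \<in> carrier R" "y \<in> Y" "u = r \<odot>\<^bsub>M\<^esub> a \<oplus>\<^bsub>M\<^esub> y" by blast
    have "s \<odot>\<^bsub>M\<^esub> u = (s \<otimes>\<^bsub>R\<^esub> r) \<odot>\<^bsub>M\<^esub> a \<oplus>\<^bsub>M\<^esub> s \<odot>\<^bsub>M\<^esub> y"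
      using * s a YM by (simp add: smult_r_distr smult_assoc1)
    moreover have "s \<odot>\<^bsub>M\<^esub> y \<in> Y" using Y * s by (auto simp: submodule_iff)
    ultimately show "s \<odot>\<^bsub>M\<^esub> u \<in> ?H" using * s by blast
  qed
qed

lemma add_multiples_incl:
  assumes Y: "submodule Y R M" and a: "a \<in> carrier M"
  shows "insert a Y \<subseteq> {r \<odot>\<^bsub>M\<^esub> a \<oplus>\<^bsub>M\<^esub> y | r y. r \<in> carrier R \<and> y \<in> Y}"
proof -
  have "a = \<one>\<^bsub>R\<^esub> \<odot>\<^bsub>M\<^esub> a \<oplus>\<^bsub>M\<^esub> \<zero>\<^bsub>M\<^esub>" "\<zero>\<^bsub>M\<^esub> \<in> Y" using a Y by (auto simp: submodule_iff)
  moreover have "y = \<zero>\<^bsub>R\<^esub> \<odot>\<^bsub>M\<^esub> a \<oplus>\<^bsub>M\<^esub> y" if "y \<in> Y" for y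
    using Y a that by (auto simp: submodule_iff)
  ultimately show ?thesis by blast
qed

lemma mod_span_insertE:
  assumes "A \<subseteq> carrier M" "a \<in> carrier M" "x \<in> mod_span R M (insert a A)"
  obtains r y where "r \<in> carrier R" "y \<in> mod_span R M A" "x = r \<odot>\<^bsub>M\<^esub> a \<oplus>\<^bsub>M\<^esub> y"
proof -
  have "insert a A \<subseteq> {r \<odot>\<^bsub>M\<^esub> a \<oplus>\<^bsub>M\<^esub> y | r y. r \<in> carrier R \<and> y \<in> mod_span R M A}"
    using add_multiples_incl[OF submodule_mod_span[OF assms(1)] assms(2)] mod_span_incl[of A] by blast
  then have "x \<in> {r \<odot>\<^bsub>M\<^esub> a \<oplus>\<^bsub>M\<^esub> y | r y. r \<in> carrier R \<and> y \<in> mod_span R M A}"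
    using mod_span_least[OF submodule_add_multiples[OF submodule_mod_span[OF assms(1)] assms(2)]]
      assms(3) by blast
  then show ?thesis using that by blast
qed

lemma idealI_cring:
  assumes "I \<subseteq> carrier R" "\<zero> \<in> I" "\<And>a b. a \<in> I \<Longrightarrow> b \<in> I \<Longrightarrow> a \<oplus> b \<in> I"
    "\<And>r a. r \<in> carrier R \<Longrightarrow> a \<in> I \<Longrightarrow> r \<otimes> a \<in> I"
  shows "ideal I R"
proof (rule idealI)
  show "ring R" by (rule R.ring_axioms)
  show "subgroup I (add_monoid R)"
  proof (rule subgroup.intro)
    fix a assume a: "a \<in> I"
    then have "\<ominus> a = (\<ominus> \<one>) \<otimes> a" using assms(1) by (auto simp: R.l_minus)
    then have "\<ominus> a \<in> I" using assms(4)[OF _ a, of "\<ominus> \<one>"] by auto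
    then show "inv\<^bsub>add_monoid R\<^esub> a \<in> I" by (simp add: a_inv_def)
  qed (use assms in auto)
  show "\<And>a x. a \<in> I \<Longrightarrow> x \<in> carrier R \<Longrightarrow> a \<otimes> x \<in> I"
    using assms by (metis R.m_comm subsetD)
qed (use assms in auto)

lemma ideal_colon:
  assumes "submodule Y R M" "X \<subseteq> carrier M"
  shows "ideal {r \<in> carrier R. \<forall>x\<in>X. r \<odot>\<^bsub>M\<^esub> x \<in> Y} R"
  using assms by (intro idealI_cring) (auto simp: submodule_iff smult_l_distr smult_assoc1 subset_iff)

end

text \<open>
  If no member of \<open>\<S>\<close> were maximal, dependent choice would give a strictly increasing sequence.
\<close>

lemma acc_imp_maximal:
  fixes \<S> :: "'x set set"
  assumes acc: "\<And>H :: nat \<Rightarrow> 'x set. (\<And>n. H n \<in> \<S>) \<Longrightarrow> (\<And>n. H n \<subseteq> H (Suc n)) \<Longrightarrow> \<exists>n. H (Suc n) = H n"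
    and ne: "\<S> \<noteq> {}"
  shows "\<exists>Y\<in>\<S>. \<forall>Z\<in>\<S>. Y \<subseteq> Z \<longrightarrow> Z = Y"
proof (rule ccontr)
  assume "\<not> ?thesis"
  then have *: "\<exists>Z. Z \<in> \<S> \<and> Y \<subset> Z" if "Y \<in> \<S>" for Y
    using that by blast
  obtain H where "\<And>n. H n \<in> \<S>" "\<And>n. H n \<subset> H (Suc n)"
    using dependent_nat_choice[of "\<lambda>_ Y. Y \<in> \<S>" "\<lambda>_ Y Z. Y \<subset> Z"] * ne by (metis ex_in_conv)
  then show False using acc[of H] by (metis psubset_eq)
qed

lemma (in noetherian_ring) ideal_acc:
  assumes I: "\<And>n :: nat. ideal (I n) R" and mono: "\<And>n. I n \<subseteq> I (Suc n)"
  obtains k where "\<And>n. n \<ge> k \<Longrightarrow> I n = I k"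
proof -
  have m: "I i \<subseteq> I j" if "i \<le> j" for i j using lift_Suc_mono_le[of I, OF mono that] .
  have "X \<subset> Y \<or> X = Y \<or> Y \<subset> X" if XY: "X \<in> range I" "Y \<in> range I" for X Y
  proof -
    obtain i j where "X = I i" "Y = I j" using XY by blast
    then show ?thesis using m[of i j] m[of j i] linear[of i j] by blast
  qed
  then have "subset.chain {I. ideal I R} (range I)"
    using I unfolding pred_on.chain_def by blast
  then have "\<Union>(range I) \<in> range I" by (intro ideal_chain_is_trivial) auto
  then obtain k where k: "\<Union>(range I) = I k" by (rule rangeE)
  show ?thesis
  proof (rule that)
    fix n assume "k \<le> n"
    then show "I n = I k" using m[of k n] k by blast
  qed
qed

context module
begin

text \<open>
  Induction on the number of generators.  With the last generator \<open>a\<close> removed, a submodule \<open>H\<close> is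
  determined, among the submodules containing it, by its intersection with the span of the others and
  by the ideal of the coefficients with which \<open>a\<close> occurs in \<open>H\<close>; both become stationary.
\<close>

lemma submodule_acc_span:
  assumes noeth: "noetherian_ring R" and "finite A" "A \<subseteq> carrier M"
    and "\<And>n::nat. submodule (H n) R M" "\<And>n. H n \<subseteq> H (Suc n)" "\<And>n. H n \<subseteq> mod_span R M A"
  shows "\<exists>k. \<forall>n\<ge>k. H n = H k"
  using assms(2-)
proof (induction A arbitrary: H rule: finite_induct)
  case empty
  have "submodule {\<zero>\<^bsub>M\<^esub>} R M" by (auto simp: submodule_iff)
  then have "mod_span R M {} \<subseteq> {\<zero>\<^bsub>M\<^esub>}" by (intro mod_span_least) auto
  then have "H n = {\<zero>\<^bsub>M\<^esub>}" for n using empty(2,4)[of n] by (fastforce simp: submodule_iff)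
  then show ?case by simp
next
  case (insert a A)
  interpret noetherian_ring R by fact
  let ?A = "mod_span R M A"
  have aM: "a \<in> carrier M" and AM: "A \<subseteq> carrier M" using insert by auto
  have sA: "submodule ?A R M" by (rule submodule_mod_span[OF AM])
  have mono: "H i \<subseteq> H j" if "i \<le> j" for i j using lift_Suc_mono_le[of H, OF insert(6) that] .
  have "\<exists>k. \<forall>n\<ge>k. H n \<inter> ?A = H k \<inter> ?A"
  proof (rule insert.IH)
    show "H n \<inter> ?A \<subseteq> H (Suc n) \<inter> ?A" for n using insert(6)[of n] by blast
  qed (use insert(5) sA AM submodule_Int in auto)
  then obtain k1 where k1: "\<And>n. n \<ge> k1 \<Longrightarrow> H n \<inter> ?A = H k1 \<inter> ?A" by blast
  define J where "J n = {r \<in> carrier R. \<exists>y\<in>?A. r \<odot>\<^bsub>M\<^esub> a \<oplus>\<^bsub>M\<^esub> y \<in> H n}" for n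
  have AM': "y \<in> carrier M" if "y \<in> ?A" for y using sA that by (auto simp: submodule_iff)
  have "ideal (J n) R" for n
  proof (rule idealI_cring)
    show "J n \<subseteq> carrier R" by (auto simp: J_def)
    have "\<zero>\<^bsub>R\<^esub> \<odot>\<^bsub>M\<^esub> a \<oplus>\<^bsub>M\<^esub> \<zero>\<^bsub>M\<^esub> \<in> H n" using insert(5)[of n] aM by (simp add: submodule_iff)
    then show "\<zero> \<in> J n" using sA unfolding J_def by (auto simp: submodule_iff)
  next
    fix r s assume "r \<in> J n" "s \<in> J n"
    then obtain y z where *: "r \<in> carrier R" "s \<in> carrier R" "y \<in> ?A" "z \<in> ?A"
      "r \<odot>\<^bsub>M\<^esub> a \<oplus>\<^bsub>M\<^esub> y \<in> H n" "s \<odot>\<^bsub>M\<^esub> a \<oplus>\<^bsub>M\<^esub> z \<in> H n" by (auto simp: J_def)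
    have "(r \<oplus> s) \<odot>\<^bsub>M\<^esub> a \<oplus>\<^bsub>M\<^esub> (y \<oplus>\<^bsub>M\<^esub> z) = (r \<odot>\<^bsub>M\<^esub> a \<oplus>\<^bsub>M\<^esub> y) \<oplus>\<^bsub>M\<^esub> (s \<odot>\<^bsub>M\<^esub> a \<oplus>\<^bsub>M\<^esub> z)"
      using * aM AM' by (simp add: smult_l_distr M.a_ac)
    moreover have "y \<oplus>\<^bsub>M\<^esub> z \<in> ?A" using * sA by (auto simp: submodule_iff)
    moreover have "(r \<odot>\<^bsub>M\<^esub> a \<oplus>\<^bsub>M\<^esub> y) \<oplus>\<^bsub>M\<^esub> (s \<odot>\<^bsub>M\<^esub> a \<oplus>\<^bsub>M\<^esub> z) \<in> H n"
      using * submoduleE(5)[OF insert(5)[of n]] by blast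
    ultimately show "r \<oplus> s \<in> J n" using *(1,2) unfolding J_def by (metis (mono_tags, lifting) R.a_closed mem_Collect_eq)
  next
    fix r s assume r: "r \<in> carrier R" and "s \<in> J n"
    then obtain z where *: "s \<in> carrier R" "z \<in> ?A" "s \<odot>\<^bsub>M\<^esub> a \<oplus>\<^bsub>M\<^esub> z \<in> H n" by (auto simp: J_def)
    have "(r \<otimes> s) \<odot>\<^bsub>M\<^esub> a \<oplus>\<^bsub>M\<^esub> r \<odot>\<^bsub>M\<^esub> z = r \<odot>\<^bsub>M\<^esub> (s \<odot>\<^bsub>M\<^esub> a \<oplus>\<^bsub>M\<^esub> z)"
      using * r aM AM' by (simp add: smult_r_distr smult_assoc1)
    moreover have "r \<odot>\<^bsub>M\<^esub> z \<in> ?A" using * r sA by (auto simp: submodule_iff)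
    moreover have "r \<odot>\<^bsub>M\<^esub> (s \<odot>\<^bsub>M\<^esub> a \<oplus>\<^bsub>M\<^esub> z) \<in> H n"
      using * r submoduleE(4)[OF insert(5)[of n]] by blast
    ultimately show "r \<otimes> s \<in> J n" using r *(1) unfolding J_def by (metis (mono_tags, lifting) R.m_closed mem_Collect_eq)
  qed
  moreover have "J n \<subseteq> J (Suc n)" for n using insert(6) unfolding J_def by blast
  ultimately obtain k2 where k2: "\<And>n. n \<ge> k2 \<Longrightarrow> J n = J k2" using ideal_acc[of J] by blast
  let ?k = "max k1 k2"
  have "H n \<subseteq> H ?k" if n: "n \<ge> ?k" for n
  proof
    fix h assume h: "h \<in> H n"
    then obtain r y where r: "r \<in> carrier R" "y \<in> ?A" "h = r \<odot>\<^bsub>M\<^esub> a \<oplus>\<^bsub>M\<^esub> y"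
      using mod_span_insertE[OF AM aM] insert(7)[of n] by blast
    then have "r \<in> J n" using h by (auto simp: J_def)
    also have "J n = J ?k" using k2[of n] k2[of ?k] n by simp
    finally obtain y' where y': "y' \<in> ?A" "r \<odot>\<^bsub>M\<^esub> a \<oplus>\<^bsub>M\<^esub> y' \<in> H ?k" by (auto simp: J_def)
    let ?h = "r \<odot>\<^bsub>M\<^esub> a \<oplus>\<^bsub>M\<^esub> y'"
    have hM: "h \<in> carrier M" "?h \<in> carrier M" using r y' aM AM' by auto
    have "h \<ominus>\<^bsub>M\<^esub> ?h = y \<ominus>\<^bsub>M\<^esub> y'"
      using r(1,2) y'(1) aM AM'[OF r(2)] AM'[OF y'(1)]
      by (simp add: r(3) a_minus_def M.minus_add M.a_ac M.r_neg1 M.r_neg)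
    then have "h \<ominus>\<^bsub>M\<^esub> ?h \<in> ?A" using r y' submodule_minus_closed[OF sA] by simp
    moreover have "?h \<in> H n" using y' mono[OF n] by auto
    ultimately have "h \<ominus>\<^bsub>M\<^esub> ?h \<in> H n \<inter> ?A" using h submodule_minus_closed[OF insert(5)] by blast
    then have "h \<ominus>\<^bsub>M\<^esub> ?h \<in> H ?k" using k1[of n] k1[of ?k] n by auto
    then have "(h \<ominus>\<^bsub>M\<^esub> ?h) \<oplus>\<^bsub>M\<^esub> ?h \<in> H ?k" using y' insert(5)[of ?k] by (simp add: submodule_iff)
    moreover have "(h \<ominus>\<^bsub>M\<^esub> ?h) \<oplus>\<^bsub>M\<^esub> ?h = h"
      using hM by (simp add: a_minus_def M.a_assoc M.l_neg)
    ultimately show "h \<in> H ?k" by simp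
  qed
  then show ?case using mono by (intro exI[of _ ?k]) blast
qed

lemma submodule_acc:
  assumes "noetherian_ring R" "fin_gen R M"
    and "\<And>n::nat. submodule (H n) R M" "\<And>n. H n \<subseteq> H (Suc n)"
  obtains k where "\<And>n. n \<ge> k \<Longrightarrow> H n = H k"
proof -
  obtain A where A: "A \<subseteq> carrier M" "finite A" "mod_span R M A = carrier M"
    using assms(2) by (auto simp: fin_gen_def)
  then have "\<exists>k. \<forall>n\<ge>k. H n = H k"
    using assms submoduleE(1)[OF assms(3)] by (intro submodule_acc_span[of A H]) auto
  then show ?thesis using that by blast
qed

lemma maximal_submodule:
  assumes "noetherian_ring R" "fin_gen R M" "\<S> \<noteq> {}" "\<And>Y. Y \<in> \<S> \<Longrightarrow> submodule Y R M"
  obtains Y where "Y \<in> \<S>" "\<And>Z. Z \<in> \<S> \<Longrightarrow> Y \<subseteq> Z \<Longrightarrow> Z = Y"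
proof -
  have "\<exists>n. H (Suc n) = H n" if "\<And>n. H n \<in> \<S>" "\<And>n. H n \<subseteq> H (Suc n)" for H :: "nat \<Rightarrow> _"
    using submodule_acc[OF assms(1,2), of H] that assms(4) by (metis le_SucI order_refl)
  then show ?thesis using acc_imp_maximal[of \<S>] assms(3) that by blast
qed

text \<open>
  An associated prime of \<open>X / (X \<inter> Y)\<close>, with an element that it annihilates: an annihilator that is
  maximal among those of nonzero elements is prime.
\<close>

lemma associated_prime:
  assumes noeth: "noetherian_ring R"
    and Y: "submodule Y R M" and X: "submodule X R M" and XY: "\<not> X \<subseteq> Y"
  obtains x where "x \<in> X" "x \<notin> Y" "primeideal {r \<in> carrier R. r \<odot>\<^bsub>M\<^esub> x \<in> Y} R"
proof -
  interpret noetherian_ring R by fact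
  let ?c = "\<lambda>x. {r \<in> carrier R. r \<odot>\<^bsub>M\<^esub> x \<in> Y}"
  let ?S = "?c ` (X - Y)"
  have XM: "x \<in> carrier M" if "x \<in> X" for x using X that by (auto simp: submodule_iff)
  have id: "ideal (?c x) R" if "x \<in> X" for x
    using ideal_colon[OF Y, of "{x}"] XM[OF that] by simp
  have "\<exists>n. H (Suc n) = H n" if "\<And>n. H n \<in> ?S" "\<And>n. H n \<subseteq> H (Suc n)" for H :: "nat \<Rightarrow> _"
  proof -
    have "ideal (H n) R" for n using that(1)[of n] id by auto
    then show ?thesis using ideal_acc[of H] that(2) by (metis le_SucI order_refl)
  qed
  moreover have "?S \<noteq> {}" using XY by auto
  ultimately have "\<exists>P\<in>?S. \<forall>Z\<in>?S. P \<subseteq> Z \<longrightarrow> Z = P"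
    by (rule acc_imp_maximal)
  then obtain x where xXY: "x \<in> X - Y"
    and "\<forall>z\<in>X - Y. ?c x \<subseteq> ?c z \<longrightarrow> ?c z = ?c x"
    unfolding bex_simps ball_simps by (rule bexE)
  then have x: "x \<in> X" "x \<notin> Y"
    and max: "\<And>z. z \<in> X - Y \<Longrightarrow> ?c x \<subseteq> ?c z \<Longrightarrow> ?c z = ?c x"
    by simp_all
  have "primeideal (?c x) R"
  proof (rule primeidealI)
    show "ideal (?c x) R" by (rule id[OF x(1)])
    show "cring R" by (rule R.is_cring)
    have "\<one> \<notin> ?c x" using x XM by auto
    then show "carrier R \<noteq> ?c x" by blast
  next
    fix a b assume ab: "a \<in> carrier R" "b \<in> carrier R" "a \<otimes> b \<in> ?c x"
    show "a \<in> ?c x \<or> b \<in> ?c x"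
    proof (rule disjCI)
      assume b: "b \<notin> ?c x"
      have bx: "b \<odot>\<^bsub>M\<^esub> x \<in> X - Y" using b ab x X by (auto simp: submodule_iff)
      have "?c x \<subseteq> ?c (b \<odot>\<^bsub>M\<^esub> x)"
      proof safe
        fix r assume r: "r \<in> carrier R" "r \<odot>\<^bsub>M\<^esub> x \<in> Y"
        have "r \<odot>\<^bsub>M\<^esub> (b \<odot>\<^bsub>M\<^esub> x) = b \<odot>\<^bsub>M\<^esub> (r \<odot>\<^bsub>M\<^esub> x)"
          using r ab XM[OF x(1)] by (intro smult_comm)
        then show "r \<odot>\<^bsub>M\<^esub> (b \<odot>\<^bsub>M\<^esub> x) \<in> Y" using r ab Y by (auto simp: submodule_iff)
      qed
      then have "?c (b \<odot>\<^bsub>M\<^esub> x) = ?c x" using max[OF bx] by blast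
      moreover have "a \<in> ?c (b \<odot>\<^bsub>M\<^esub> x)" using ab XM[OF x(1)] by (simp add: smult_assoc1)
      ultimately show "a \<in> ?c x" by simp
    qed
  qed
  with x show ?thesis using that by blast
qed

end

section \<open>Stabilization of iterated images\<close>

context module
begin

text \<open>
  After \<open>S\<close> is inverted, the part of the sequence \<open>C\<close> inside \<open>Y\<close> is eventually contained in the next
  term of the sequence.  The denominator \<open>s\<close> has to be the same for all elements of \<open>C n \<inter> Y\<close>:
  in the application it must annihilate a whole quotient.
\<close>

definition locally_stationary :: "'a set \<Rightarrow> (nat \<Rightarrow> 'c set) \<Rightarrow> 'c set \<Rightarrow> bool"
  where "locally_stationary S C Y \<longleftrightarrow>
    (\<forall>\<^sub>F n in sequentially. \<exists>s\<in>S. \<forall>m\<in>C n \<inter> Y. s \<odot>\<^bsub>M\<^esub> m \<in> C (Suc n))"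

text \<open>
  The step from \<open>Y\<close> to \<open>Y + R x\<close>.  Let \<open>Q\<close> be the annihilator of \<open>x\<close> modulo \<open>Y\<close>.  If \<open>S\<close> meets \<open>Q\<close>, then
  nothing changes after \<open>S\<close> is inverted.  If \<open>S\<close> is the complement of \<open>Q\<close>, then the image of
  \<open>C n\<close> in \<open>(Y + R x) / Y\<close>, which is \<open>R / Q\<close>, becomes either zero or everything after \<open>S\<close> is inverted, so
  that it is stationary.
\<close>

lemma locally_stationary_extend:
  assumes S: "S \<subseteq> carrier R" "\<And>s t. s \<in> S \<Longrightarrow> t \<in> S \<Longrightarrow> s \<otimes> t \<in> S"
    and C: "\<And>n. submodule (C n) R M" "\<And>n. C (Suc n) \<subseteq> C n"
    and Y: "submodule Y R M" and close: "locally_stationary S C Y" and x: "x \<in> carrier M"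
    and cases: "(\<exists>s\<in>S. s \<odot>\<^bsub>M\<^esub> x \<in> Y) \<or> (\<forall>r\<in>carrier R. r \<odot>\<^bsub>M\<^esub> x \<notin> Y \<longrightarrow> r \<in> S)"
  shows "locally_stationary S C {r \<odot>\<^bsub>M\<^esub> x \<oplus>\<^bsub>M\<^esub> y | r y. r \<in> carrier R \<and> y \<in> Y}"
    (is "locally_stationary S C ?Y'")
proof -
  have CM: "m \<in> carrier M" if "m \<in> C n" for m n using C(1)[of n] that by (auto simp: submodule_iff)
  have YM: "m \<in> carrier M" if "m \<in> Y" for m using Y that by (auto simp: submodule_iff)
  have SR: "s \<in> carrier R" if "s \<in> S" for s using S that by blast
  have anti: "C j \<subseteq> C i" if "i \<le> j" for i j using lift_Suc_antimono_le[of C, OF C(2) that] .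
  obtain k where k: "\<And>n. n \<ge> k \<Longrightarrow> \<exists>s\<in>S. \<forall>m\<in>C n \<inter> Y. s \<odot>\<^bsub>M\<^esub> m \<in> C (Suc n)"
    using close unfolding locally_stationary_def eventually_sequentially by blast
  consider (kills) "\<exists>s\<in>S. s \<odot>\<^bsub>M\<^esub> x \<in> Y"
    | (small) "\<forall>r\<in>carrier R. r \<odot>\<^bsub>M\<^esub> x \<notin> Y \<longrightarrow> r \<in> S"
        "\<exists>l. \<forall>r\<in>carrier R. \<forall>y\<in>Y. r \<odot>\<^bsub>M\<^esub> x \<oplus>\<^bsub>M\<^esub> y \<in> C l \<longrightarrow> r \<odot>\<^bsub>M\<^esub> x \<in> Y"
    | (large) "\<forall>r\<in>carrier R. r \<odot>\<^bsub>M\<^esub> x \<notin> Y \<longrightarrow> r \<in> S"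
        "\<forall>l. \<exists>r\<in>carrier R. \<exists>y\<in>Y. r \<odot>\<^bsub>M\<^esub> x \<oplus>\<^bsub>M\<^esub> y \<in> C l \<and> r \<odot>\<^bsub>M\<^esub> x \<notin> Y"
    using cases by blast
  then show ?thesis
  proof cases
    case kills
    then obtain t where t: "t \<in> S" "t \<odot>\<^bsub>M\<^esub> x \<in> Y" by blast
    have "\<exists>s\<in>S. \<forall>m\<in>C n \<inter> ?Y'. s \<odot>\<^bsub>M\<^esub> m \<in> C (Suc n)" if "n \<ge> k" for n
    proof -
      obtain s where s: "s \<in> S" "\<And>m. m \<in> C n \<Longrightarrow> m \<in> Y \<Longrightarrow> s \<odot>\<^bsub>M\<^esub> m \<in> C (Suc n)"
        using k[OF \<open>n \<ge> k\<close>] by blast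
      have "(s \<otimes> t) \<odot>\<^bsub>M\<^esub> w \<in> C (Suc n)" if w: "w \<in> C n" "w \<in> ?Y'" for w
      proof -
        obtain r y where r: "r \<in> carrier R" "y \<in> Y" "w = r \<odot>\<^bsub>M\<^esub> x \<oplus>\<^bsub>M\<^esub> y" using w(2) by blast
        have "t \<odot>\<^bsub>M\<^esub> w = r \<odot>\<^bsub>M\<^esub> (t \<odot>\<^bsub>M\<^esub> x) \<oplus>\<^bsub>M\<^esub> t \<odot>\<^bsub>M\<^esub> y"
          using r(1,2) t(1) x YM[OF r(2)] SR smult_comm[of r t x] by (simp add: r(3) smult_r_distr)
        then have "t \<odot>\<^bsub>M\<^esub> w \<in> Y" using Y r(1,2) t SR by (simp add: submodule_iff)
        moreover have "t \<odot>\<^bsub>M\<^esub> w \<in> C n" using C(1)[of n] w(1) t(1) SR by (simp add: submodule_iff)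
        ultimately have "s \<odot>\<^bsub>M\<^esub> (t \<odot>\<^bsub>M\<^esub> w) \<in> C (Suc n)" using s(2) by blast
        then show ?thesis using s t SR CM[OF w(1)] by (simp add: smult_assoc1)
      qed
      then show ?thesis using S(2) s(1) t(1) by blast
    qed
    then show ?thesis unfolding locally_stationary_def eventually_sequentially by blast
  next
    case small
    then obtain l where l: "\<And>r y. r \<in> carrier R \<Longrightarrow> y \<in> Y \<Longrightarrow> r \<odot>\<^bsub>M\<^esub> x \<oplus>\<^bsub>M\<^esub> y \<in> C l \<Longrightarrow> r \<odot>\<^bsub>M\<^esub> x \<in> Y"
      by blast
    have "C n \<inter> ?Y' \<subseteq> C n \<inter> Y" if "n \<ge> l" for n
    proof
      fix w assume w: "w \<in> C n \<inter> ?Y'"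
      then obtain r y where r: "r \<in> carrier R" "y \<in> Y" "w = r \<odot>\<^bsub>M\<^esub> x \<oplus>\<^bsub>M\<^esub> y" by blast
      then have "r \<odot>\<^bsub>M\<^esub> x \<in> Y" using l w anti[OF that] by blast
      then show "w \<in> C n \<inter> Y" using w r Y by (auto simp: submodule_iff)
    qed
    then have "\<exists>s\<in>S. \<forall>m\<in>C n \<inter> ?Y'. s \<odot>\<^bsub>M\<^esub> m \<in> C (Suc n)" if "n \<ge> max k l" for n
      using k[of n] that by (meson max.bounded_iff subsetD)
    then show ?thesis unfolding locally_stationary_def eventually_sequentially by blast
  next
    case large
    have "\<exists>s\<in>S. \<forall>m\<in>C n \<inter> ?Y'. s \<odot>\<^bsub>M\<^esub> m \<in> C (Suc n)" if "n \<ge> k" for n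
    proof -
      obtain s where s: "s \<in> S" "\<And>m. m \<in> C n \<Longrightarrow> m \<in> Y \<Longrightarrow> s \<odot>\<^bsub>M\<^esub> m \<in> C (Suc n)"
        using k[OF \<open>n \<ge> k\<close>] by blast
      obtain t y0 where t: "t \<in> S" "y0 \<in> Y" "t \<odot>\<^bsub>M\<^esub> x \<oplus>\<^bsub>M\<^esub> y0 \<in> C (Suc n)"
        using large by blast
      let ?m = "t \<odot>\<^bsub>M\<^esub> x \<oplus>\<^bsub>M\<^esub> y0"
      have "(s \<otimes> t) \<odot>\<^bsub>M\<^esub> w \<in> C (Suc n)" if w: "w \<in> C n" "w \<in> ?Y'" for w
      proof -
        obtain r y where r: "r \<in> carrier R" "y \<in> Y" "w = r \<odot>\<^bsub>M\<^esub> x \<oplus>\<^bsub>M\<^esub> y" using w(2) by blast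
        note inM = x YM[OF r(2)] YM[OF t(2)] CM[OF w(1)] CM[OF t(3)] r(1) SR[OF s(1)] SR[OF t(1)]
        \<comment> \<open>\<open>t w\<close> and \<open>r m\<close> have the same component \<open>t r x\<close> along \<open>x\<close>, so that their difference is in \<open>Y\<close>.\<close>
        let ?d = "t \<odot>\<^bsub>M\<^esub> w \<ominus>\<^bsub>M\<^esub> r \<odot>\<^bsub>M\<^esub> ?m"
        have "?d = t \<odot>\<^bsub>M\<^esub> y \<ominus>\<^bsub>M\<^esub> r \<odot>\<^bsub>M\<^esub> y0"
          using inM smult_comm[of r t x]
          by (simp add: r(3) smult_r_distr a_minus_def M.minus_add M.a_ac M.r_neg1 M.r_neg)
        then have dY: "?d \<in> Y"
          using submodule_minus_closed[OF Y] submoduleE(4)[OF Y] r(1,2) t(2) inM(8) by simp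
        have "?d \<in> C n"
          using submodule_minus_closed[OF C(1)[of n]] submoduleE(4)[OF C(1)[of n]] inM(6,8) w(1)
            subsetD[OF C(2)[of n] t(3)] by simp
        then have "s \<odot>\<^bsub>M\<^esub> ?d \<in> C (Suc n)" using s dY by blast
        then have "s \<odot>\<^bsub>M\<^esub> ?d \<oplus>\<^bsub>M\<^esub> s \<odot>\<^bsub>M\<^esub> (r \<odot>\<^bsub>M\<^esub> ?m) \<in> C (Suc n)"
          using submoduleE(4,5)[OF C(1)[of "Suc n"]] inM(6,7) t(3) by simp
        also have "s \<odot>\<^bsub>M\<^esub> ?d \<oplus>\<^bsub>M\<^esub> s \<odot>\<^bsub>M\<^esub> (r \<odot>\<^bsub>M\<^esub> ?m) = s \<odot>\<^bsub>M\<^esub> (?d \<oplus>\<^bsub>M\<^esub> r \<odot>\<^bsub>M\<^esub> ?m)"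
          using inM by (simp add: smult_r_distr[symmetric] del: M.add.m_closed)
        also have "?d \<oplus>\<^bsub>M\<^esub> r \<odot>\<^bsub>M\<^esub> ?m = t \<odot>\<^bsub>M\<^esub> w"
          using inM(4-8) smult_closed[OF inM(6,5)] smult_closed[OF inM(8,4)]
          by (simp only: a_minus_def M.a_assoc M.a_inv_closed M.l_neg M.r_zero)
        also have "s \<odot>\<^bsub>M\<^esub> (t \<odot>\<^bsub>M\<^esub> w) = (s \<otimes> t) \<odot>\<^bsub>M\<^esub> w" using inM by (simp add: smult_assoc1)
        finally show ?thesis .
      qed
      then show ?thesis using S(2) s(1) t(1) by blast
    qed
    then show ?thesis unfolding locally_stationary_def eventually_sequentially by blast
  qed
qed

text \<open>
  If \<open>I\<close> is an ideal, the complement of such a set is a minimal prime over \<open>I\<close>.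
\<close>

lemma maximal_multiplicative_set:
  assumes "I \<subseteq> carrier R" "\<one> \<notin> I"
  obtains S where "S \<subseteq> carrier R - I" "\<one> \<in> S" "\<And>s t. s \<in> S \<Longrightarrow> t \<in> S \<Longrightarrow> s \<otimes> t \<in> S"
    "\<And>T. T \<subseteq> carrier R - I \<Longrightarrow> S \<subseteq> T \<Longrightarrow> (\<And>s t. s \<in> T \<Longrightarrow> t \<in> T \<Longrightarrow> s \<otimes> t \<in> T) \<Longrightarrow> T = S"
proof -
  let ?P = "{S. S \<subseteq> carrier R - I \<and> \<one> \<in> S \<and> (\<forall>s\<in>S. \<forall>t\<in>S. s \<otimes> t \<in> S)}"
  have "\<exists>S\<in>?P. \<forall>T\<in>?P. S \<subseteq> T \<longrightarrow> T = S"
  proof (rule subset_Zorn_nonempty)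
    show "?P \<noteq> {}" using assms by (auto intro!: exI[of _ "{\<one>}"])
  next
    fix \<C> assume ne: "\<C> \<noteq> {}" and ch: "subset.chain ?P \<C>"
    have P: "S \<subseteq> carrier R - I" "\<one> \<in> S" "\<And>s t. s \<in> S \<Longrightarrow> t \<in> S \<Longrightarrow> s \<otimes> t \<in> S" if "S \<in> \<C>" for S
      using ch that unfolding pred_on.chain_def by blast+
    have "s \<otimes> t \<in> \<Union>\<C>" if st: "s \<in> \<Union>\<C>" "t \<in> \<Union>\<C>" for s t
    proof -
      obtain A B where AB: "A \<in> \<C>" "B \<in> \<C>" "s \<in> A" "t \<in> B" using st by blast
      then have "A \<subseteq> B \<or> B \<subseteq> A" using ch unfolding pred_on.chain_def by blast
      then show ?thesis using P(3)[OF AB(1)] P(3)[OF AB(2)] AB by blast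
    qed
    then show "\<Union>\<C> \<in> ?P" using P(1,2) ne by blast
  qed
  then obtain S where S: "S \<in> ?P" and max: "\<forall>T\<in>?P. S \<subseteq> T \<longrightarrow> T = S" by (rule bexE)
  have "T = S" if "T \<subseteq> carrier R - I" "S \<subseteq> T" "\<And>s t. s \<in> T \<Longrightarrow> t \<in> T \<Longrightarrow> s \<otimes> t \<in> T" for T
  proof -
    have "T \<in> ?P" using that S by blast
    then show ?thesis using max that(2) by blast
  qed
  moreover have "S \<subseteq> carrier R - I" "\<one> \<in> S" "\<And>s t. s \<in> S \<Longrightarrow> t \<in> S \<Longrightarrow> s \<otimes> t \<in> S"
    using S by blast+
  ultimately show thesis by (rule that[rotated -1])
qed

text \<open>
  The assumption \<open>sq\<close> abstracts \<open>x \<phi>(y) = \<phi>(x\<^sup>q y)\<close> with \<open>q \<ge> 2\<close>.  It also makes \<open>D\<close> monotone, by the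
  case \<open>x = 1\<close>.
\<close>

lemma iterated_image_stabilizes:
  assumes noeth: "noetherian_ring R" and fg: "fin_gen R M"
    and sub: "\<And>Y. submodule Y R M \<Longrightarrow> submodule (D Y) R M"
    and sq: "\<And>x Y Z d. x \<in> carrier R \<Longrightarrow> submodule Y R M \<Longrightarrow> submodule Z R M \<Longrightarrow>
      (\<And>y. y \<in> Y \<Longrightarrow> x \<odot>\<^bsub>M\<^esub> (x \<odot>\<^bsub>M\<^esub> y) \<in> Z) \<Longrightarrow> d \<in> D Y \<Longrightarrow> x \<odot>\<^bsub>M\<^esub> d \<in> D Z"
  obtains k where "\<And>n. n \<ge> k \<Longrightarrow> (D ^^ n) (carrier M) = (D ^^ k) (carrier M)"
proof -
  interpret N: noetherian_ring R by fact
  define C where "C n = (D ^^ n) (carrier M)" for n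
  have C_Suc: "C (Suc n) = D (C n)" for n by (simp add: C_def)
  have subC: "submodule (C n) R M" for n
    by (induction n) (simp_all add: C_Suc sub, simp add: C_def carrier_is_submodule)
  have CM: "m \<in> carrier M" if "m \<in> C n" for m n using subC[of n] that by (auto simp: submodule_iff)
  have mono: "D Y \<subseteq> D Z" if YZ: "submodule Y R M" "submodule Z R M" "Y \<subseteq> Z" for Y Z
  proof
    fix d assume d: "d \<in> D Y"
    have YM: "y \<in> carrier M" if "y \<in> Y" for y using YZ(1) that by (auto simp: submodule_iff)
    have "\<one> \<odot>\<^bsub>M\<^esub> d \<in> D Z" using sq[OF _ YZ(1,2) _ d, of \<one>] YZ(3) YM by auto
    then show "d \<in> D Z" using d sub[OF YZ(1)] by (auto simp: submodule_iff)
  qed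
  have decC: "C (Suc n) \<subseteq> C n" for n
  proof (induction n)
    case 0 then show ?case using subC[of 1] by (auto simp: C_def submodule_iff)
  next
    case (Suc n) then show ?case using mono[OF subC subC] by (simp add: C_Suc[symmetric])
  qed
  have anti: "C j \<subseteq> C i" if "i \<le> j" for i j using lift_Suc_antimono_le[of C, OF decC that] .
  define I where "I n = {r \<in> carrier R. \<forall>m\<in>C n. r \<odot>\<^bsub>M\<^esub> m \<in> C (Suc n)}" for n
  have idI: "ideal (I n) R" for n
    unfolding I_def using ideal_colon[OF subC] CM by blast
  have "I n \<subseteq> I (Suc n)" for n
  proof
    fix x assume x: "x \<in> I n"
    then have xR: "x \<in> carrier R" by (simp add: I_def)
    have "x \<odot>\<^bsub>M\<^esub> (x \<odot>\<^bsub>M\<^esub> y) \<in> C (Suc n)" if "y \<in> C n" for y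
      using x that decC[of n] by (auto simp: I_def)
    then have "x \<odot>\<^bsub>M\<^esub> d \<in> D (C (Suc n))" if "d \<in> D (C n)" for d
      using sq[OF xR subC[of n] subC[of "Suc n"] _ that] by blast
    then show "x \<in> I (Suc n)" using xR by (simp add: I_def C_Suc)
  qed
  then obtain k where k: "\<And>n. n \<ge> k \<Longrightarrow> I n = I k" using N.ideal_acc[of I] idI by blast
  have sqI: "x \<odot>\<^bsub>M\<^esub> (x \<odot>\<^bsub>M\<^esub> m) \<in> C n" if x: "x \<in> I k" and "n \<ge> k" and m: "m \<in> C k" for x n m
    using \<open>n \<ge> k\<close> m
  proof (induction n arbitrary: m rule: dec_induct)
    case base
    then show ?case using x submoduleE(4)[OF subC[of k]] by (simp add: I_def)
  next
    case (step n)
    have "x \<odot>\<^bsub>M\<^esub> m \<in> D (C k)" using x step.prems by (simp add: I_def C_Suc)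
    then have "x \<odot>\<^bsub>M\<^esub> (x \<odot>\<^bsub>M\<^esub> m) \<in> D (C n)"
      using sq[OF _ subC[of k] subC[of n]] step.IH x by (simp add: I_def)
    then show ?case by (simp add: C_Suc)
  qed
  have "\<one> \<in> I k"
  proof (rule ccontr)
    assume "\<one> \<notin> I k"
    then obtain S where S: "S \<subseteq> carrier R - I k" "\<one> \<in> S" "\<And>s t. s \<in> S \<Longrightarrow> t \<in> S \<Longrightarrow> s \<otimes> t \<in> S"
      and Smax: "\<And>T. T \<subseteq> carrier R - I k \<Longrightarrow> S \<subseteq> T \<Longrightarrow>
        (\<And>s t. s \<in> T \<Longrightarrow> t \<in> T \<Longrightarrow> s \<otimes> t \<in> T) \<Longrightarrow> T = S"
      using maximal_multiplicative_set[of "I k"] ideal.Icarr[OF idI] by (metis subsetI)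
    let ?good = "{Y. submodule Y R M \<and> locally_stationary S C Y \<and>
      (\<forall>x\<in>I k. \<forall>m\<in>C k. x \<odot>\<^bsub>M\<^esub> (x \<odot>\<^bsub>M\<^esub> m) \<in> Y)}"
    \<comment> \<open>The intersection of the sequence contains \<open>x\<^sup>2 (C k)\<close> for \<open>x \<in> I k\<close>.\<close>
    have "(\<Inter>n. C n) \<in> ?good"
    proof (intro CollectI conjI ballI)
      show "submodule (\<Inter>n. C n) R M"
        unfolding submodule_iff
      proof (intro conjI ballI)
        show "(\<Inter>n. C n) \<subseteq> carrier M" using submoduleE(1)[OF subC[of 0]] by blast
        show "\<zero>\<^bsub>M\<^esub> \<in> (\<Inter>n. C n)" using subC by (simp add: submodule_iff)
      qed (simp_all add: submoduleE(4,5)[OF subC])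
      have "\<one> \<odot>\<^bsub>M\<^esub> m \<in> C (Suc n)" if "m \<in> (\<Inter>n. C n)" for m n
      proof -
        have "m \<in> C (Suc n)" using that by blast
        then show ?thesis using CM[of m "Suc n"] by simp
      qed
      then show "locally_stationary S C (\<Inter>n. C n)" using S(2)
        unfolding locally_stationary_def by (intro always_eventually) blast
      show "x \<odot>\<^bsub>M\<^esub> (x \<odot>\<^bsub>M\<^esub> m) \<in> (\<Inter>n. C n)" if "x \<in> I k" "m \<in> C k" for x m
      proof
        fix n
        have "x \<odot>\<^bsub>M\<^esub> (x \<odot>\<^bsub>M\<^esub> m) \<in> C (max k n)" using sqI[OF that(1) _ that(2)] by simp
        then show "x \<odot>\<^bsub>M\<^esub> (x \<odot>\<^bsub>M\<^esub> m) \<in> C n" using anti[of n "max k n"] by auto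
      qed
    qed
    then have ne: "?good \<noteq> {}" by blast
    obtain Y where Ygood: "Y \<in> ?good" and Ymax: "\<And>Z. Z \<in> ?good \<Longrightarrow> Y \<subseteq> Z \<Longrightarrow> Z = Y"
      using maximal_submodule[OF noeth fg ne] by blast
    then have Y: "submodule Y R M" "locally_stationary S C Y"
      "\<And>x m. x \<in> I k \<Longrightarrow> m \<in> C k \<Longrightarrow> x \<odot>\<^bsub>M\<^esub> (x \<odot>\<^bsub>M\<^esub> m) \<in> Y" by blast+
    have "C k \<subseteq> Y"
    proof (rule ccontr)
      assume "\<not> C k \<subseteq> Y"
      then obtain x where x: "x \<in> C k" "x \<notin> Y"
        and prime: "primeideal {r \<in> carrier R. r \<odot>\<^bsub>M\<^esub> x \<in> Y} R" (is "primeideal ?Q R")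
        using associated_prime[OF noeth Y(1) subC] by blast
      note Q_prime = primeideal.I_prime[OF prime]
      have xM: "x \<in> carrier M" using CM x by blast
      have IQ: "I k \<subseteq> ?Q"
      proof
        fix z assume z: "z \<in> I k"
        then have zR: "z \<in> carrier R" by (simp add: I_def)
        then have "z \<otimes> z \<in> ?Q" using Y(3)[OF z x(1)] xM by (simp add: smult_assoc1)
        then show "z \<in> ?Q" using Q_prime[OF zR zR] by simp
      qed
      have "(\<exists>s\<in>S. s \<odot>\<^bsub>M\<^esub> x \<in> Y) \<or> (\<forall>r\<in>carrier R. r \<odot>\<^bsub>M\<^esub> x \<notin> Y \<longrightarrow> r \<in> S)"
      proof (rule disjCI)
        assume "\<not> (\<forall>r\<in>carrier R. r \<odot>\<^bsub>M\<^esub> x \<notin> Y \<longrightarrow> r \<in> S)"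
        moreover have "carrier R - ?Q = S" if "\<not> (\<exists>s\<in>S. s \<odot>\<^bsub>M\<^esub> x \<in> Y)"
        proof (rule Smax)
          show "carrier R - ?Q \<subseteq> carrier R - I k" using IQ by blast
          show "S \<subseteq> carrier R - ?Q" using that S(1) by blast
          show "s \<otimes> t \<in> carrier R - ?Q" if "s \<in> carrier R - ?Q" "t \<in> carrier R - ?Q" for s t
            using that Q_prime[of s t] by (metis (no_types, lifting) DiffD1 DiffD2 DiffI R.m_closed)
        qed
        ultimately show "\<exists>s\<in>S. s \<odot>\<^bsub>M\<^esub> x \<in> Y" by blast
      qed
      then have cl: "locally_stationary S C {r \<odot>\<^bsub>M\<^esub> x \<oplus>\<^bsub>M\<^esub> y | r y. r \<in> carrier R \<and> y \<in> Y}"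
        (is "locally_stationary S C ?Y'")
        using S decC subC Y(1,2) xM by (intro locally_stationary_extend) (assumption | blast)+
      have incl: "insert x Y \<subseteq> ?Y'" by (rule add_multiples_incl[OF Y(1) xM])
      then have "?Y' \<in> ?good" using cl submodule_add_multiples[OF Y(1) xM] Y(3) by blast
      then have "?Y' = Y" using Ymax incl by blast
      then show False using incl x by blast
    qed
    obtain l where l: "\<And>n. n \<ge> l \<Longrightarrow> \<exists>s\<in>S. \<forall>m\<in>C n \<inter> Y. s \<odot>\<^bsub>M\<^esub> m \<in> C (Suc n)"
      using Y(2) unfolding locally_stationary_def eventually_sequentially by blast
    let ?n = "max k l"
    obtain s where s: "s \<in> S" "\<And>m. m \<in> C ?n \<Longrightarrow> m \<in> Y \<Longrightarrow> s \<odot>\<^bsub>M\<^esub> m \<in> C (Suc ?n)"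
      using l[of ?n] by auto
    \<comment> \<open>So \<open>s\<close> annihilates a successive quotient, although \<open>S\<close> is disjoint from \<open>I k\<close>.\<close>
    moreover have "C ?n \<subseteq> Y" using anti[of k ?n] \<open>C k \<subseteq> Y\<close> by auto
    ultimately have "s \<in> I ?n" using S(1) unfolding I_def by blast
    then show False using k[of ?n] s(1) S(1) by auto
  qed
  then have I1: "\<one> \<in> I n" if "n \<ge> k" for n using k that by blast
  have CC: "C n \<subseteq> C (Suc n)" if "n \<ge> k" for n
    using I1[OF that] CM[of _ n] by (auto simp: I_def)
  show ?thesis
  proof (rule that[of k])
    fix n assume "k \<le> n"
    then have "C n = C k"
    proof (induction n rule: dec_induct)
      case (step n)
      then show ?case using CC[of n] decC[of n] by auto
    qed simp
    then show "(D ^^ n) (carrier M) = (D ^^ k) (carrier M)" by (simp add: C_def)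
  qed
qed

end

section \<open>Fractions\<close>

text \<open>
  Operations on fractions are unions over all representatives of the operands; such a union is
  evaluated by showing that its members coincide.
\<close>

lemma UNION_pairs_eq_const:
  assumes "(a, b) \<in> A" "(c, d) \<in> B"
    and eq: "\<And>r s m t. (r, s) \<in> A \<Longrightarrow> (m, t) \<in> B \<Longrightarrow> F r s m t = C"
  shows "(\<Union>(r, s)\<in>A. \<Union>(m, t)\<in>B. F r s m t) = C"
proof -
  have "(\<Union>(m, t)\<in>B. F r s m t) = C" if "(r, s) \<in> A" for r s
    using eq[OF that] assms(2) by (intro SUP_eq_const) auto
  then have "(case x of (r, s) \<Rightarrow> \<Union>(m, t)\<in>B. F r s m t) = C" if "x \<in> A" for x
    using that by (cases x) (simp only: prod.case)
  then show ?thesis using assms(1) by (intro SUP_eq_const) blast+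
qed

locale multiplicative_subset = cring R for R (structure) +
  fixes S :: "'a set"
  assumes S_subset: "S \<subseteq> carrier R" and one_S: "\<one> \<in> S"
    and mult_S: "s \<in> S \<Longrightarrow> t \<in> S \<Longrightarrow> s \<otimes> t \<in> S"
begin

abbreviation ring_frac :: "'a \<Rightarrow> 'a \<Rightarrow> ('a \<times> 'a) set"
  where "ring_frac \<equiv> fraction R S (regular_module R)"

lemma S_carrier [simp, intro]: "s \<in> S \<Longrightarrow> s \<in> carrier R"
  using S_subset by blast

end

locale localization = module + multiplicative_subset
begin

abbreviation mod_frac :: "'c \<Rightarrow> 'a \<Rightarrow> ('c \<times> 'a) set"
  where "mod_frac \<equiv> fraction R S M"

lemma frac_self: "m \<in> carrier M \<Longrightarrow> s \<in> S \<Longrightarrow> (m, s) \<in> mod_frac m s"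
  using one_S by (auto simp: fraction_def)

lemma frac_eqI:
  assumes "m \<in> carrier M" "n \<in> carrier M" "s \<in> S" "t \<in> S" "u \<in> S"
    and eq: "u \<odot>\<^bsub>M\<^esub> (t \<odot>\<^bsub>M\<^esub> m) = u \<odot>\<^bsub>M\<^esub> (s \<odot>\<^bsub>M\<^esub> n)"
  shows "mod_frac m s = mod_frac n t"
proof -
  have incl: "mod_frac m s \<subseteq> mod_frac n t"
    if "m \<in> carrier M" "n \<in> carrier M" "s \<in> S" "t \<in> S"
      and eq: "u \<odot>\<^bsub>M\<^esub> (t \<odot>\<^bsub>M\<^esub> m) = u \<odot>\<^bsub>M\<^esub> (s \<odot>\<^bsub>M\<^esub> n)" for m n s t
  proof (clarsimp simp: fraction_def)
    fix l r v assume l: "l \<in> carrier M" "r \<in> S" "v \<in> S"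
      and eq': "v \<odot>\<^bsub>M\<^esub> (r \<odot>\<^bsub>M\<^esub> m) = v \<odot>\<^bsub>M\<^esub> (s \<odot>\<^bsub>M\<^esub> l)"
    note in_carrier = that(1-4) l \<open>u \<in> S\<close> S_carrier
    have "(u \<otimes> v \<otimes> s) \<odot>\<^bsub>M\<^esub> (r \<odot>\<^bsub>M\<^esub> n) = (v \<otimes> r) \<odot>\<^bsub>M\<^esub> (u \<odot>\<^bsub>M\<^esub> (s \<odot>\<^bsub>M\<^esub> n))"
      using in_carrier by (simp add: smult_assoc1[symmetric] R.m_ac)
    also have "\<dots> = (u \<otimes> t) \<odot>\<^bsub>M\<^esub> (v \<odot>\<^bsub>M\<^esub> (r \<odot>\<^bsub>M\<^esub> m))"
      unfolding eq[symmetric] using in_carrier by (simp add: smult_assoc1[symmetric] R.m_ac)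
    also have "\<dots> = (u \<otimes> v \<otimes> s) \<odot>\<^bsub>M\<^esub> (t \<odot>\<^bsub>M\<^esub> l)"
      unfolding eq' using in_carrier by (simp add: smult_assoc1[symmetric] R.m_ac)
    finally show "\<exists>u\<in>S. u \<odot>\<^bsub>M\<^esub> (r \<odot>\<^bsub>M\<^esub> n) = u \<odot>\<^bsub>M\<^esub> (t \<odot>\<^bsub>M\<^esub> l)"
      using in_carrier mult_S by blast
  qed
  show ?thesis
    using incl[OF assms(1-4) eq] incl[OF assms(2,1,4,3) eq[symmetric]] by blast
qed

lemma frac_eq_iff:
  assumes "m \<in> carrier M" "n \<in> carrier M" "s \<in> S" "t \<in> S"
  shows "mod_frac m s = mod_frac n t \<longleftrightarrow> (\<exists>u\<in>S. u \<odot>\<^bsub>M\<^esub> (t \<odot>\<^bsub>M\<^esub> m) = u \<odot>\<^bsub>M\<^esub> (s \<odot>\<^bsub>M\<^esub> n))"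
proof
  assume "mod_frac m s = mod_frac n t"
  then have "(n, t) \<in> mod_frac m s" using frac_self[OF assms(2,4)] by simp
  then show "\<exists>u\<in>S. u \<odot>\<^bsub>M\<^esub> (t \<odot>\<^bsub>M\<^esub> m) = u \<odot>\<^bsub>M\<^esub> (s \<odot>\<^bsub>M\<^esub> n)" by (auto simp: fraction_def)
qed (use frac_eqI assms in blast)

lemma frac_cancel:
  "m \<in> carrier M \<Longrightarrow> s \<in> S \<Longrightarrow> t \<in> S \<Longrightarrow> mod_frac (t \<odot>\<^bsub>M\<^esub> m) (s \<otimes> t) = mod_frac m s"
  using one_S mult_S by (intro frac_eqI[of _ _ _ _ \<one>]) (simp_all add: smult_assoc1)

lemma smult_frac:
  assumes "r \<in> carrier R" "s \<in> S" "m \<in> carrier M" "t \<in> S"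
  shows "ring_frac r s \<odot>\<^bsub>loc_module R S M\<^esub> mod_frac m t = mod_frac (r \<odot>\<^bsub>M\<^esub> m) (s \<otimes> t)"
proof -
  have eq: "mod_frac (r' \<odot>\<^bsub>M\<^esub> m') (s' \<otimes> t') = mod_frac (r \<odot>\<^bsub>M\<^esub> m) (s \<otimes> t)"
    if "(r', s') \<in> ring_frac r s" "(m', t') \<in> mod_frac m t" for r' s' m' t'
  proof -
    obtain u v where u: "r' \<in> carrier R" "s' \<in> S" "u \<in> S" "u \<otimes> (s' \<otimes> r) = u \<otimes> (s \<otimes> r')"
      and v: "m' \<in> carrier M" "t' \<in> S" "v \<in> S" "v \<odot>\<^bsub>M\<^esub> (t' \<odot>\<^bsub>M\<^esub> m) = v \<odot>\<^bsub>M\<^esub> (t \<odot>\<^bsub>M\<^esub> m')"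
      using \<open>(r', s') \<in> _\<close> \<open>(m', t') \<in> _\<close> by (auto simp: fraction_def regular_module_def)
    note in_carrier = assms u(1-3) v(1-3) S_carrier mult_S
    have "(u \<otimes> v) \<odot>\<^bsub>M\<^esub> ((s \<otimes> t) \<odot>\<^bsub>M\<^esub> (r' \<odot>\<^bsub>M\<^esub> m')) = (u \<otimes> (s \<otimes> r')) \<odot>\<^bsub>M\<^esub> (v \<odot>\<^bsub>M\<^esub> (t \<odot>\<^bsub>M\<^esub> m'))"
      using in_carrier by (simp add: smult_assoc1[symmetric] R.m_ac)
    also have "\<dots> = (u \<otimes> v) \<odot>\<^bsub>M\<^esub> ((s' \<otimes> t') \<odot>\<^bsub>M\<^esub> (r \<odot>\<^bsub>M\<^esub> m))"
      unfolding u(4)[symmetric] v(4)[symmetric] using in_carrier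
      by (simp add: smult_assoc1[symmetric] R.m_ac)
    finally show ?thesis
      using in_carrier by (intro frac_eqI[of _ _ _ _ "u \<otimes> v"]) auto
  qed
  have ne: "(r, s) \<in> ring_frac r s"
    using assms one_S by (auto simp: fraction_def regular_module_def)
  show ?thesis
    unfolding loc_module_def module.simps
    by (rule UNION_pairs_eq_const[OF ne frac_self[OF assms(3,4)] eq])
qed

lemma add_frac:
  assumes "m \<in> carrier M" "s \<in> S" "n \<in> carrier M" "t \<in> S"
  shows "mod_frac m s \<oplus>\<^bsub>loc_module R S M\<^esub> mod_frac n t = mod_frac (t \<odot>\<^bsub>M\<^esub> m \<oplus>\<^bsub>M\<^esub> s \<odot>\<^bsub>M\<^esub> n) (s \<otimes> t)"
proof -
  have eq: "mod_frac (t' \<odot>\<^bsub>M\<^esub> m' \<oplus>\<^bsub>M\<^esub> s' \<odot>\<^bsub>M\<^esub> n') (s' \<otimes> t') = mod_frac (t \<odot>\<^bsub>M\<^esub> m \<oplus>\<^bsub>M\<^esub> s \<odot>\<^bsub>M\<^esub> n) (s \<otimes> t)"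
    if "(m', s') \<in> mod_frac m s" "(n', t') \<in> mod_frac n t" for m' s' n' t'
  proof -
    obtain u v where u: "m' \<in> carrier M" "s' \<in> S" "u \<in> S" "u \<odot>\<^bsub>M\<^esub> (s' \<odot>\<^bsub>M\<^esub> m) = u \<odot>\<^bsub>M\<^esub> (s \<odot>\<^bsub>M\<^esub> m')"
      and v: "n' \<in> carrier M" "t' \<in> S" "v \<in> S" "v \<odot>\<^bsub>M\<^esub> (t' \<odot>\<^bsub>M\<^esub> n) = v \<odot>\<^bsub>M\<^esub> (t \<odot>\<^bsub>M\<^esub> n')"
      using \<open>(m', s') \<in> _\<close> \<open>(n', t') \<in> _\<close> by (auto simp: fraction_def)
    note in_carrier = assms u(1-3) v(1-3) S_carrier mult_S
    have "(u \<otimes> v) \<odot>\<^bsub>M\<^esub> ((s \<otimes> t) \<odot>\<^bsub>M\<^esub> (t' \<odot>\<^bsub>M\<^esub> m' \<oplus>\<^bsub>M\<^esub> s' \<odot>\<^bsub>M\<^esub> n')) =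
        (v \<otimes> (t \<otimes> t')) \<odot>\<^bsub>M\<^esub> (u \<odot>\<^bsub>M\<^esub> (s \<odot>\<^bsub>M\<^esub> m')) \<oplus>\<^bsub>M\<^esub> (u \<otimes> (s \<otimes> s')) \<odot>\<^bsub>M\<^esub> (v \<odot>\<^bsub>M\<^esub> (t \<odot>\<^bsub>M\<^esub> n'))"
      using in_carrier by (simp add: smult_r_distr smult_assoc1[symmetric] R.m_ac)
    also have "\<dots> = (u \<otimes> v) \<odot>\<^bsub>M\<^esub> ((s' \<otimes> t') \<odot>\<^bsub>M\<^esub> (t \<odot>\<^bsub>M\<^esub> m \<oplus>\<^bsub>M\<^esub> s \<odot>\<^bsub>M\<^esub> n))"
      unfolding u(4)[symmetric] v(4)[symmetric] using in_carrier
      by (simp add: smult_r_distr smult_assoc1[symmetric] R.m_ac)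
    finally show ?thesis
      using in_carrier by (intro frac_eqI[of _ _ _ _ "u \<otimes> v"]) auto
  qed
  show ?thesis
    unfolding loc_module_def ring.simps
    by (rule UNION_pairs_eq_const[OF frac_self[OF assms(1,2)] frac_self[OF assms(3,4)] eq])
qed

text \<open>
  A submodule has different localizations, as sets of fractions, in different ambient modules.  The
  elementwise form of agreement is the same in all of them.
\<close>

lemma loc_sub_eq_iff:
  assumes "A \<subseteq> carrier M" "B \<subseteq> carrier M"
    and B: "\<And>r b. r \<in> carrier R \<Longrightarrow> b \<in> B \<Longrightarrow> r \<odot>\<^bsub>M\<^esub> b \<in> B"
    and A: "\<And>r a. r \<in> carrier R \<Longrightarrow> a \<in> A \<Longrightarrow> r \<odot>\<^bsub>M\<^esub> a \<in> A"
  shows "loc_sub R S M A = loc_sub R S M B \<longleftrightarrow>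
    (\<forall>a\<in>A. \<exists>s\<in>S. s \<odot>\<^bsub>M\<^esub> a \<in> B) \<and> (\<forall>b\<in>B. \<exists>s\<in>S. s \<odot>\<^bsub>M\<^esub> b \<in> A)"
proof -
  have "loc_sub R S M A \<subseteq> loc_sub R S M B \<longleftrightarrow> (\<forall>a\<in>A. \<exists>s\<in>S. s \<odot>\<^bsub>M\<^esub> a \<in> B)"
    if sub: "A \<subseteq> carrier M" "B \<subseteq> carrier M"
      and B: "\<And>r b. r \<in> carrier R \<Longrightarrow> b \<in> B \<Longrightarrow> r \<odot>\<^bsub>M\<^esub> b \<in> B" for A B
  proof (intro iffI ballI subsetI)
    fix a assume "loc_sub R S M A \<subseteq> loc_sub R S M B" and a: "a \<in> A"
    then have "mod_frac a \<one> \<in> loc_sub R S M B" using one_S by (auto simp: loc_sub_def)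
    then obtain b s where b: "b \<in> B" "s \<in> S" "mod_frac a \<one> = mod_frac b s" by (auto simp: loc_sub_def)
    then obtain u where u: "u \<in> S" "u \<odot>\<^bsub>M\<^esub> (s \<odot>\<^bsub>M\<^esub> a) = u \<odot>\<^bsub>M\<^esub> (\<one> \<odot>\<^bsub>M\<^esub> b)"
      using frac_eq_iff[of a b \<one> s] sub a one_S by (metis subsetD)
    then have "(u \<otimes> s) \<odot>\<^bsub>M\<^esub> a = u \<odot>\<^bsub>M\<^esub> b"
      using b(2) subsetD[OF sub(1) a] subsetD[OF sub(2) b(1)] by (simp add: smult_assoc1)
    then have "(u \<otimes> s) \<odot>\<^bsub>M\<^esub> a \<in> B" using B b u by auto
    then show "\<exists>s\<in>S. s \<odot>\<^bsub>M\<^esub> a \<in> B" using u b mult_S by blast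
  next
    fix x assume *: "\<forall>a\<in>A. \<exists>s\<in>S. s \<odot>\<^bsub>M\<^esub> a \<in> B" and "x \<in> loc_sub R S M A"
    then obtain a s where a: "a \<in> A" "s \<in> S" "x = mod_frac a s" by (auto simp: loc_sub_def)
    then obtain t where t: "t \<in> S" "t \<odot>\<^bsub>M\<^esub> a \<in> B" using * by blast
    then have "x = mod_frac (t \<odot>\<^bsub>M\<^esub> a) (s \<otimes> t)" using a sub frac_cancel[of a s t] by auto
    then show "x \<in> loc_sub R S M B" using t a mult_S[of s t] unfolding loc_sub_def by blast
  qed
  from this[of A B] this[of B A] show ?thesis using assms by blast
qed

lemma loc_module_nonzero_iff:
  "carrier (loc_module R S M) \<noteq> {\<zero>\<^bsub>loc_module R S M\<^esub>} \<longleftrightarrow>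
    (\<exists>m\<in>carrier M. \<forall>s\<in>S. s \<odot>\<^bsub>M\<^esub> m \<noteq> \<zero>\<^bsub>M\<^esub>)"
proof -
  have zero: "mod_frac m s = mod_frac \<zero>\<^bsub>M\<^esub> \<one> \<longleftrightarrow> (\<exists>u\<in>S. u \<odot>\<^bsub>M\<^esub> m = \<zero>\<^bsub>M\<^esub>)" if "m \<in> carrier M" "s \<in> S" for m s
    using frac_eq_iff[of m "\<zero>\<^bsub>M\<^esub>" s \<one>] that one_S by auto
  have "mod_frac \<zero>\<^bsub>M\<^esub> \<one> \<in> carrier (loc_module R S M)" using one_S by (auto simp: loc_module_def)
  then have "carrier (loc_module R S M) \<noteq> {\<zero>\<^bsub>loc_module R S M\<^esub>} \<longleftrightarrow>
      (\<exists>m\<in>carrier M. \<exists>s\<in>S. mod_frac m s \<noteq> mod_frac \<zero>\<^bsub>M\<^esub> \<one>)"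
    by (auto simp: loc_module_def)
  also have "\<dots> \<longleftrightarrow> (\<exists>m\<in>carrier M. \<forall>s\<in>S. s \<odot>\<^bsub>M\<^esub> m \<noteq> \<zero>\<^bsub>M\<^esub>)"
    using zero one_S by blast
  finally show ?thesis .
qed

end

lemma (in cring) module_regular: "module R (regular_module R)"
proof (rule moduleI)
  show "abelian_group (regular_module R)"
    by (rule abelian_groupI) (auto simp: regular_module_def a_ac intro: exI[of _ "\<ominus> _"] l_neg)
qed (auto simp: regular_module_def l_distr r_distr m_assoc is_cring)

context module
begin

lemma localization_prime:
  assumes "primeideal P R"
  shows "localization R M (carrier R - P)"
proof (intro localization.intro multiplicative_subset.intro multiplicative_subset_axioms.intro
    module_axioms R.is_cring)
  show "\<one> \<in> carrier R - P"
    using assms ideal.one_imp_carrier[OF primeideal.axioms(1)[OF assms]] primeideal.I_notcarr by blast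
  show "s \<otimes> t \<in> carrier R - P" if "s \<in> carrier R - P" "t \<in> carrier R - P" for s t
    using primeideal.I_prime[OF assms, of s t] that by auto
qed auto

lemma Supp_iff:
  "P \<in> Supp R M \<longleftrightarrow> primeideal P R \<and> (\<exists>m\<in>carrier M. \<forall>s\<in>carrier R - P. s \<odot>\<^bsub>M\<^esub> m \<noteq> \<zero>\<^bsub>M\<^esub>)"
  using localization.loc_module_nonzero_iff[OF localization_prime, of P] by (auto simp: Supp_def)

lemma agree_generically_iff:
  assumes "submodule A R M" "submodule B R M" and Z: "\<And>P. P \<in> Z \<Longrightarrow> primeideal P R"
  shows "agree_generically R M Z A B \<longleftrightarrow>
    (\<forall>P\<in>Z. (\<forall>a\<in>A. \<exists>s\<in>carrier R - P. s \<odot>\<^bsub>M\<^esub> a \<in> B) \<and> (\<forall>b\<in>B. \<exists>s\<in>carrier R - P. s \<odot>\<^bsub>M\<^esub> b \<in> A))"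
  unfolding agree_generically_def
  using localization.loc_sub_eq_iff[OF localization_prime[OF Z], of _ A B] assms(1,2)
  by (simp add: submodule_iff)

end

section \<open>Modules over the localized ring\<close>

sublocale multiplicative_subset \<subseteq> reg: localization R "regular_module R" S
  by (intro localization.intro module_regular multiplicative_subset_axioms)

context multiplicative_subset
begin

text \<open>
  The localized ring is the localization of \<open>R\<close> as a module over itself, so its operations are
  instances of those on fractions of modules.
\<close>

lemma loc_ring_simps:
  "carrier (loc_ring R S) = {ring_frac r s | r s. r \<in> carrier R \<and> s \<in> S}"
  "\<one>\<^bsub>loc_ring R S\<^esub> = ring_frac \<one> \<one>"
  "\<lbrakk>r \<in> carrier R; s \<in> S; r' \<in> carrier R; s' \<in> S\<rbrakk> \<Longrightarrow>
    ring_frac r s \<otimes>\<^bsub>loc_ring R S\<^esub> ring_frac r' s' = ring_frac (r \<otimes> r') (s \<otimes> s')"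
  "\<lbrakk>r \<in> carrier R; s \<in> S; r' \<in> carrier R; s' \<in> S\<rbrakk> \<Longrightarrow>
    ring_frac r s \<oplus>\<^bsub>loc_ring R S\<^esub> ring_frac r' s' = ring_frac (s' \<otimes> r \<oplus> s \<otimes> r') (s \<otimes> s')"
  using reg.smult_frac[of r s r' s'] reg.add_frac[of r s r' s']
  by (simp_all add: loc_ring_def Let_def) (simp_all add: loc_module_def regular_module_def)

lemma ring_frac_closed: "r \<in> carrier R \<Longrightarrow> s \<in> S \<Longrightarrow> ring_frac r s \<in> carrier (loc_ring R S)"
  by (auto simp: loc_ring_simps)

lemma ring_frac_pow: "r \<in> carrier R \<Longrightarrow> ring_frac r \<one> [^]\<^bsub>loc_ring R S\<^esub> (n::nat) = ring_frac (r [^] n) \<one>"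
proof (induction n)
  case 0
  then show ?case by (simp add: nat_pow_def loc_ring_simps)
next
  case (Suc n)
  have "ring_frac r \<one> [^]\<^bsub>loc_ring R S\<^esub> Suc n =
      ring_frac r \<one> [^]\<^bsub>loc_ring R S\<^esub> n \<otimes>\<^bsub>loc_ring R S\<^esub> ring_frac r \<one>"
    by (simp add: nat_pow_def)
  then show ?case using Suc one_S by (simp add: loc_ring_simps)
qed

end

locale loc_pushforward = multiplicative_subset R S + LM: module "loc_ring R S" M
  for R (structure) and S and M (structure)
begin

abbreviation J where "J \<equiv> push_loc R S M"

lemma push_loc_simps [simp]:
  "carrier J = carrier M" "zero J = zero M" "add J = add M"
  by (simp_all add: push_loc_def)

lemma smult_push_loc: "r \<odot>\<^bsub>J\<^esub> x = ring_frac r \<one> \<odot>\<^bsub>M\<^esub> x"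
  by (simp add: push_loc_def)

lemma module_push_loc: "module R J"
proof (rule moduleI)
  show "cring R" by (rule is_cring)
  show "abelian_group J"
  proof (rule abelian_groupI)
    show "\<exists>y\<in>carrier J. y \<oplus>\<^bsub>J\<^esub> x = \<zero>\<^bsub>J\<^esub>" if "x \<in> carrier J" for x
      using that by (intro bexI[of _ "\<ominus>\<^bsub>M\<^esub> x"]) (simp_all add: LM.M.l_neg)
  qed (simp_all add: LM.M.a_ac)
  show "\<one> \<odot>\<^bsub>J\<^esub> x = x" if "x \<in> carrier J" for x
    using that LM.smult_one by (simp add: smult_push_loc loc_ring_simps)
  fix a x assume a: "a \<in> carrier R" and x: "x \<in> carrier J"
  show "a \<odot>\<^bsub>J\<^esub> x \<in> carrier J"
    using a x one_S by (simp add: smult_push_loc ring_frac_closed)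
  show "a \<odot>\<^bsub>J\<^esub> (x \<oplus>\<^bsub>J\<^esub> y) = a \<odot>\<^bsub>J\<^esub> x \<oplus>\<^bsub>J\<^esub> a \<odot>\<^bsub>J\<^esub> y" if "y \<in> carrier J" for y
    using a x that one_S by (simp add: smult_push_loc ring_frac_closed LM.smult_r_distr)
  fix b assume b: "b \<in> carrier R"
  have "ring_frac (a \<oplus> b) \<one> = ring_frac a \<one> \<oplus>\<^bsub>loc_ring R S\<^esub> ring_frac b \<one>"
    using a b one_S by (simp add: loc_ring_simps)
  then show "(a \<oplus> b) \<odot>\<^bsub>J\<^esub> x = a \<odot>\<^bsub>J\<^esub> x \<oplus>\<^bsub>J\<^esub> b \<odot>\<^bsub>J\<^esub> x"
    using a b x one_S by (simp add: smult_push_loc ring_frac_closed LM.smult_l_distr)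
  have "ring_frac (a \<otimes> b) \<one> = ring_frac a \<one> \<otimes>\<^bsub>loc_ring R S\<^esub> ring_frac b \<one>"
    using a b one_S by (simp add: loc_ring_simps)
  then show "(a \<otimes> b) \<odot>\<^bsub>J\<^esub> x = a \<odot>\<^bsub>J\<^esub> (b \<odot>\<^bsub>J\<^esub> x)"
    using a b x one_S by (simp add: smult_push_loc ring_frac_closed LM.smult_assoc1)
qed

text \<open>
  Determines the action of a fraction on \<open>M\<close> in terms of the \<open>R\<close>-module \<open>j\<^sub>*M\<close>, in which
  multiplication by \<open>s\<close> is injective.
\<close>

lemma smult_push_loc_ring_frac:
  assumes "r \<in> carrier R" "s \<in> S" "x \<in> carrier M"
  shows "s \<odot>\<^bsub>J\<^esub> (ring_frac r s \<odot>\<^bsub>M\<^esub> x) = r \<odot>\<^bsub>J\<^esub> x"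
proof -
  have "ring_frac (s \<otimes> r) (\<one> \<otimes> s) = ring_frac r \<one>"
    using assms one_S reg.frac_cancel[of r \<one> s] by (simp add: regular_module_def)
  then have "ring_frac s \<one> \<otimes>\<^bsub>loc_ring R S\<^esub> ring_frac r s = ring_frac r \<one>"
    using assms one_S by (simp add: loc_ring_simps)
  then show ?thesis
    using assms one_S LM.smult_assoc1[of "ring_frac s \<one>" "ring_frac r s" x]
    by (simp add: smult_push_loc ring_frac_closed)
qed

lemma push_loc_divide:
  assumes "s \<in> S" "x \<in> carrier M"
  shows "s \<odot>\<^bsub>J\<^esub> (ring_frac \<one> s \<odot>\<^bsub>M\<^esub> x) = x"
  using smult_push_loc_ring_frac[of \<one> s x] module.smult_one[OF module_push_loc] assms by simp

lemma push_loc_cancel: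
  assumes "s \<in> S" "x \<in> carrier M" "y \<in> carrier M" "s \<odot>\<^bsub>J\<^esub> x = s \<odot>\<^bsub>J\<^esub> y"
  shows "x = y"
proof -
  have "ring_frac \<one> s \<odot>\<^bsub>M\<^esub> (s \<odot>\<^bsub>J\<^esub> z) = z" if "z \<in> carrier M" for z
  proof -
    have "ring_frac \<one> s \<odot>\<^bsub>M\<^esub> (s \<odot>\<^bsub>J\<^esub> z) = s \<odot>\<^bsub>J\<^esub> (ring_frac \<one> s \<odot>\<^bsub>M\<^esub> z)"
      using assms(1) that one_S by (simp add: smult_push_loc LM.smult_comm ring_frac_closed)
    then show ?thesis using push_loc_divide[OF assms(1) that] by simp
  qed
  then show ?thesis using assms by metis
qed

lemma submodule_loc_ring_iff:
  "submodule H (loc_ring R S) M \<longleftrightarrow>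
    submodule H R J \<and> (\<forall>s\<in>S. \<forall>x\<in>carrier M. s \<odot>\<^bsub>J\<^esub> x \<in> H \<longrightarrow> x \<in> H)"
proof -
  interpret J: module R J by (rule module_push_loc)
  have *: "(\<forall>a\<in>carrier (loc_ring R S). \<forall>x\<in>H. a \<odot>\<^bsub>M\<^esub> x \<in> H) \<longleftrightarrow>
    (\<forall>r\<in>carrier R. \<forall>x\<in>H. r \<odot>\<^bsub>J\<^esub> x \<in> H) \<and> (\<forall>s\<in>S. \<forall>x\<in>carrier M. s \<odot>\<^bsub>J\<^esub> x \<in> H \<longrightarrow> x \<in> H)"
    (is "?L \<longleftrightarrow> ?A \<and> ?B") if H: "H \<subseteq> carrier M"
  proof (intro iffI conjI)
    assume L: ?L
    then show ?A using one_S by (simp add: smult_push_loc ring_frac_closed)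
    show ?B
    proof (intro ballI impI)
      fix s x assume *: "s \<in> S" "x \<in> carrier M" "s \<odot>\<^bsub>J\<^esub> x \<in> H"
      have "s \<odot>\<^bsub>J\<^esub> (ring_frac \<one> s \<odot>\<^bsub>M\<^esub> (s \<odot>\<^bsub>J\<^esub> x)) = s \<odot>\<^bsub>J\<^esub> x"
        using *(1) subsetD[OF H *(3)] by (rule push_loc_divide)
      then have "ring_frac \<one> s \<odot>\<^bsub>M\<^esub> (s \<odot>\<^bsub>J\<^esub> x) = x"
        using push_loc_cancel[OF *(1) _ *(2)] subsetD[OF H *(3)] ring_frac_closed[OF one_closed *(1)]
        by simp
      then show "x \<in> H" using L *(3) ring_frac_closed[OF one_closed *(1)] by metis
    qed
  next
    assume AB: "?A \<and> ?B"
    show ?L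
    proof (intro ballI)
      fix a x assume "a \<in> carrier (loc_ring R S)" and x: "x \<in> H"
      then obtain r s where a: "r \<in> carrier R" "s \<in> S" "a = ring_frac r s" by (auto simp: loc_ring_simps)
      then have "s \<odot>\<^bsub>J\<^esub> (a \<odot>\<^bsub>M\<^esub> x) = r \<odot>\<^bsub>J\<^esub> x" using smult_push_loc_ring_frac subsetD[OF H x] by simp
      also have "\<dots> \<in> H" using AB a x by blast
      finally show "a \<odot>\<^bsub>M\<^esub> x \<in> H" 
        using AB a LM.smult_closed[OF ring_frac_closed[OF a(1,2)] subsetD[OF H x]] by blast
    qed
  qed
  show ?thesis unfolding LM.submodule_iff J.submodule_iff push_loc_simps using * by blast
qed

end

section \<open>Localizing a submodule of a divisible module\<close>

text \<open>
  Modules on which \<open>S\<close> acts bijectively, such as \<open>j\<^sub>*M\<close>.  They are \<open>S\<^sup>-\<^sup>1R\<close>-modules in disguise.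
\<close>

locale divisible_module = localization +
  assumes cancel: "\<lbrakk>s \<in> S; x \<in> carrier M; y \<in> carrier M; s \<odot>\<^bsub>M\<^esub> x = s \<odot>\<^bsub>M\<^esub> y\<rbrakk> \<Longrightarrow> x = y"
    and divide: "\<lbrakk>s \<in> S; x \<in> carrier M\<rbrakk> \<Longrightarrow> \<exists>y\<in>carrier M. s \<odot>\<^bsub>M\<^esub> y = x"

lemma (in loc_pushforward) divisible_push_loc: "divisible_module R J S"
proof (intro divisible_module.intro divisible_module_axioms.intro localization.intro
    module_push_loc multiplicative_subset_axioms)
  fix s x assume "s \<in> S" "x \<in> carrier J"
  then show "\<exists>y\<in>carrier J. s \<odot>\<^bsub>J\<^esub> y = x"
    using push_loc_divide[of s x] by (intro bexI[of _ "ring_frac \<one> s \<odot>\<^bsub>M\<^esub> x"]) (auto simp: ring_frac_closed)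
qed (use push_loc_cancel in auto)

text \<open>
  The situation of \<open>U \<subseteq> V\<close> with \<open>S\<^sup>-\<^sup>1U = V\<close>.
\<close>

locale dense_submodule = divisible_module R V S
  for R (structure) and V (structure) and S +
  fixes U :: "'c set"
  assumes submodule_U: "submodule U R V"
    and dense: "x \<in> carrier V \<Longrightarrow> \<exists>s\<in>S. s \<odot>\<^bsub>V\<^esub> x \<in> U"
begin

abbreviation VU where "VU \<equiv> V\<lparr>carrier := U\<rparr>"
abbreviation L where "L \<equiv> loc_module R S VU"

text \<open>
  The inverse of the isomorphism \<open>S\<^sup>-\<^sup>1U \<rightarrow> V\<close>, \<open>n / t \<mapsto> t\<^sup>-\<^sup>1 n\<close>.  A fraction being the set of its
  representatives, the preimage of \<open>x\<close> can be written down directly.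
\<close>

definition \<Phi> :: "'c \<Rightarrow> ('c \<times> 'a) set"
  where "\<Phi> x = {(n, t). n \<in> U \<and> t \<in> S \<and> n = t \<odot>\<^bsub>V\<^esub> x}"

sublocale U: localization R VU S
  using submodule.submodule_is_module[OF submodule_U module_axioms] multiplicative_subset_axioms
  by (intro localization.intro)

lemma U_carrier: "u \<in> U \<Longrightarrow> u \<in> carrier V"
  using submodule_U by (auto simp: submodule_iff)

lemma fraction_eq_\<Phi>:
  assumes "s \<in> S" "x \<in> carrier V" "s \<odot>\<^bsub>V\<^esub> x \<in> U"
  shows "fraction R S VU (s \<odot>\<^bsub>V\<^esub> x) s = \<Phi> x"
proof -
  have "(\<exists>u\<in>S. u \<odot>\<^bsub>V\<^esub> (t \<odot>\<^bsub>V\<^esub> (s \<odot>\<^bsub>V\<^esub> x)) = u \<odot>\<^bsub>V\<^esub> (s \<odot>\<^bsub>V\<^esub> n)) \<longleftrightarrow> n = t \<odot>\<^bsub>V\<^esub> x" (is "?l \<longleftrightarrow> ?r")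
    if "t \<in> S" "n \<in> U" for t n
  proof
    assume ?l
    then have "t \<odot>\<^bsub>V\<^esub> (s \<odot>\<^bsub>V\<^esub> x) = s \<odot>\<^bsub>V\<^esub> n"
      using that assms U_carrier cancel[of _ "t \<odot>\<^bsub>V\<^esub> (s \<odot>\<^bsub>V\<^esub> x)" "s \<odot>\<^bsub>V\<^esub> n"] by auto
    then have "s \<odot>\<^bsub>V\<^esub> (t \<odot>\<^bsub>V\<^esub> x) = s \<odot>\<^bsub>V\<^esub> n"
      using that assms smult_comm[of s t x] by auto
    then show ?r using that assms U_carrier cancel[of s "t \<odot>\<^bsub>V\<^esub> x" n] by auto
  next
    assume ?r
    then show ?l using that assms one_S smult_comm[of s t x] by (intro bexI[of _ \<one>]) auto
  qed
  then show ?thesis unfolding fraction_def \<Phi>_def by auto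
qed

lemma \<Phi>_is_fraction:
  assumes "x \<in> carrier V"
  obtains s where "s \<in> S" "s \<odot>\<^bsub>V\<^esub> x \<in> U" "\<Phi> x = fraction R S VU (s \<odot>\<^bsub>V\<^esub> x) s"
  using dense[OF assms] fraction_eq_\<Phi>[OF _ assms] that by metis

lemma fraction_is_\<Phi>:
  assumes "m \<in> U" "s \<in> S"
  obtains x where "x \<in> carrier V" "s \<odot>\<^bsub>V\<^esub> x = m" "fraction R S VU m s = \<Phi> x"
  using divide[OF assms(2) U_carrier[OF assms(1)]] fraction_eq_\<Phi>[OF assms(2)] assms(1) that by metis

lemma \<Phi>_eqI:
  assumes "s \<in> S" "m \<in> U" "x \<in> carrier V" "s \<odot>\<^bsub>V\<^esub> x = m"
  shows "fraction R S VU m s = \<Phi> x"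
  using fraction_eq_\<Phi>[OF assms(1,3)] assms by simp

lemma inj_\<Phi>: "inj_on \<Phi> (carrier V)"
proof (rule inj_onI)
  fix x y assume x: "x \<in> carrier V" and y: "y \<in> carrier V" and eq: "\<Phi> x = \<Phi> y"
  obtain s where s: "s \<in> S" "s \<odot>\<^bsub>V\<^esub> x \<in> U" using dense[OF x] by blast
  then have "(s \<odot>\<^bsub>V\<^esub> x, s) \<in> \<Phi> y" unfolding eq[symmetric] by (simp add: \<Phi>_def)
  then show "x = y" using cancel[OF s(1) x y] by (simp add: \<Phi>_def)
qed

lemma carrier_L: "carrier L = \<Phi> ` carrier V"
proof
  have L: "carrier L = {fraction R S VU m s | m s. m \<in> U \<and> s \<in> S}"
    by (simp add: loc_module_def)
  show "carrier L \<subseteq> \<Phi> ` carrier V"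
  proof
    fix l assume "l \<in> carrier L"
    then obtain m s where "m \<in> U" "s \<in> S" "l = fraction R S VU m s" unfolding L by blast
    then show "l \<in> \<Phi> ` carrier V" by (metis fraction_is_\<Phi> imageI)
  qed
  show "\<Phi> ` carrier V \<subseteq> carrier L"
  proof
    fix l assume "l \<in> \<Phi> ` carrier V"
    then obtain x where "x \<in> carrier V" "l = \<Phi> x" by blast
    then obtain s where "s \<in> S" "s \<odot>\<^bsub>V\<^esub> x \<in> U" "l = fraction R S VU (s \<odot>\<^bsub>V\<^esub> x) s"
      using \<Phi>_is_fraction by metis
    then show "l \<in> carrier L" unfolding L by blast
  qed
qed

lemma \<Phi>_zero: "\<zero>\<^bsub>L\<^esub> = \<Phi> \<zero>\<^bsub>V\<^esub>"
  using fraction_eq_\<Phi>[of \<one> "\<zero>\<^bsub>V\<^esub>"] one_S submodule_U by (simp add: loc_module_def submodule_iff)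

lemma \<Phi>_add:
  assumes x: "x \<in> carrier V" and y: "y \<in> carrier V"
  shows "\<Phi> x \<oplus>\<^bsub>L\<^esub> \<Phi> y = \<Phi> (x \<oplus>\<^bsub>V\<^esub> y)"
proof -
  obtain s where s: "s \<in> S" "s \<odot>\<^bsub>V\<^esub> x \<in> U" "\<Phi> x = fraction R S VU (s \<odot>\<^bsub>V\<^esub> x) s"
    using \<Phi>_is_fraction[OF x] by blast
  obtain t where t: "t \<in> S" "t \<odot>\<^bsub>V\<^esub> y \<in> U" "\<Phi> y = fraction R S VU (t \<odot>\<^bsub>V\<^esub> y) t"
    using \<Phi>_is_fraction[OF y] by blast
  have "t \<odot>\<^bsub>V\<^esub> (s \<odot>\<^bsub>V\<^esub> x) \<oplus>\<^bsub>V\<^esub> s \<odot>\<^bsub>V\<^esub> (t \<odot>\<^bsub>V\<^esub> y) = (s \<otimes> t) \<odot>\<^bsub>V\<^esub> (x \<oplus>\<^bsub>V\<^esub> y)"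
    using s(1) t(1) x y smult_comm[of t s x] by (simp add: smult_r_distr smult_assoc1)
  moreover have "t \<odot>\<^bsub>V\<^esub> (s \<odot>\<^bsub>V\<^esub> x) \<oplus>\<^bsub>V\<^esub> s \<odot>\<^bsub>V\<^esub> (t \<odot>\<^bsub>V\<^esub> y) \<in> U"
    using s(1,2) t(1,2) submodule_U by (simp add: submodule_iff)
  ultimately show ?thesis
    using U.add_frac[of "s \<odot>\<^bsub>V\<^esub> x" s "t \<odot>\<^bsub>V\<^esub> y" t] s t
      fraction_eq_\<Phi>[OF mult_S[OF s(1) t(1)] M.add.m_closed[OF x y]] by simp
qed

text \<open>
  The hypothesis on \<open>y\<close> says that \<open>y = (r / s) x\<close>.
\<close>

lemma \<Phi>_smult:
  assumes "r \<in> carrier R" "s \<in> S" and x: "x \<in> carrier V" and y: "y \<in> carrier V"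
    and "s \<odot>\<^bsub>V\<^esub> y = r \<odot>\<^bsub>V\<^esub> x"
  shows "ring_frac r s \<odot>\<^bsub>L\<^esub> \<Phi> x = \<Phi> y"
proof -
  obtain t where t: "t \<in> S" "t \<odot>\<^bsub>V\<^esub> x \<in> U" "\<Phi> x = fraction R S VU (t \<odot>\<^bsub>V\<^esub> x) t"
    using \<Phi>_is_fraction[OF x] by blast
  have "(s \<otimes> t) \<odot>\<^bsub>V\<^esub> y = t \<odot>\<^bsub>V\<^esub> (s \<odot>\<^bsub>V\<^esub> y)"
    using assms t(1) smult_comm[of t s y] by (simp add: smult_assoc1)
  also have "\<dots> = r \<odot>\<^bsub>V\<^esub> (t \<odot>\<^bsub>V\<^esub> x)"
    using assms t(1) smult_comm[of t r x] by simp
  finally have "(s \<otimes> t) \<odot>\<^bsub>V\<^esub> y = r \<odot>\<^bsub>V\<^esub> (t \<odot>\<^bsub>V\<^esub> x)" .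
  moreover have "r \<odot>\<^bsub>V\<^esub> (t \<odot>\<^bsub>V\<^esub> x) \<in> U"
    using t(2) assms(1) submodule_U by (simp add: submodule_iff)
  ultimately show ?thesis
    using U.smult_frac[of r s "t \<odot>\<^bsub>V\<^esub> x" t] assms(1,2) t
      \<Phi>_eqI[OF mult_S[OF assms(2) t(1)] _ y, of "r \<odot>\<^bsub>V\<^esub> (t \<odot>\<^bsub>V\<^esub> x)"] by simp
qed

end

section \<open>Cartier algebras\<close>

context module
begin

lemma lin_maps_frob_pushI:
  assumes "\<And>x. x \<in> carrier M \<Longrightarrow> h x \<in> carrier M"
    "\<And>x y. x \<in> carrier M \<Longrightarrow> y \<in> carrier M \<Longrightarrow> h (x \<oplus>\<^bsub>M\<^esub> y) = h x \<oplus>\<^bsub>M\<^esub> h y"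
    "\<And>r x. r \<in> carrier R \<Longrightarrow> x \<in> carrier M \<Longrightarrow> h ((r [^] (p ^ e)) \<odot>\<^bsub>M\<^esub> x) = r \<odot>\<^bsub>M\<^esub> h x"
  shows "h \<in> lin_maps R (frob_push R p e M) M"
  using assms by (auto simp: lin_maps_def frob_push_def)

lemma lin_maps_frob_pushD:
  assumes "h \<in> lin_maps R (frob_push R p e M) M" "x \<in> carrier M"
  shows "h x \<in> carrier M"
    "y \<in> carrier M \<Longrightarrow> h (x \<oplus>\<^bsub>M\<^esub> y) = h x \<oplus>\<^bsub>M\<^esub> h y"
    "r \<in> carrier R \<Longrightarrow> h ((r [^] (p ^ e)) \<odot>\<^bsub>M\<^esub> x) = r \<odot>\<^bsub>M\<^esub> h x"
  using assms by (auto simp: lin_maps_def frob_push_def)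

lemma lin_maps_frob_push_zero:
  assumes "h \<in> lin_maps R (frob_push R p e M) M"
  shows "h \<zero>\<^bsub>M\<^esub> = \<zero>\<^bsub>M\<^esub>"
proof -
  have "h ((\<zero> [^] (p ^ e)) \<odot>\<^bsub>M\<^esub> \<zero>\<^bsub>M\<^esub>) = \<zero> \<odot>\<^bsub>M\<^esub> h \<zero>\<^bsub>M\<^esub>"
    by (rule lin_maps_frob_pushD(3)[OF assms]) auto
  then show ?thesis using lin_maps_frob_pushD(1)[OF assms, of "\<zero>\<^bsub>M\<^esub>"] by simp
qed

lemma frobenius_iterate_lin_maps:
  assumes \<kappa>: "\<kappa> \<in> lin_maps R (frob_push R p 1 M) M"
  shows "\<kappa> ^^ e \<in> lin_maps R (frob_push R p e M) M"
proof (induction e)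
  case 0
  show ?case by (rule lin_maps_frob_pushI) auto
next
  case (Suc e)
  note k = lin_maps_frob_pushD[OF \<kappa>] and ke = lin_maps_frob_pushD[OF Suc]
  show ?case
  proof (rule lin_maps_frob_pushI)
    fix r x assume r: "r \<in> carrier R" and x: "x \<in> carrier M"
    have "r [^] (p ^ Suc e) = (r [^] (p ^ 1)) [^] (p ^ e)" using r by (simp add: nat_pow_pow)
    then show "(\<kappa> ^^ Suc e) ((r [^] (p ^ Suc e)) \<odot>\<^bsub>M\<^esub> x) = r \<odot>\<^bsub>M\<^esub> (\<kappa> ^^ Suc e) x"
      using r x ke(1)[OF x] ke(3)[OF x, of "r [^] (p ^ 1)"] k(3)[of "(\<kappa> ^^ e) x" r] by simp
  qed (simp_all add: k ke)
qed

text \<open>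
  The form \<open>s h(w) = h(s\<^sup>q\<^sup>-\<^sup>1 (s w))\<close> is needed when only \<open>s w\<close>, but not \<open>w\<close>, is known to lie in
  a given submodule.
\<close>

lemma frobenius_linear_multiple:
  assumes "h \<in> lin_maps R (frob_push R p e M) M" "p \<ge> 1" "s \<in> carrier R" "w \<in> carrier M"
  shows "h (s [^] (p ^ e - 1) \<odot>\<^bsub>M\<^esub> (s \<odot>\<^bsub>M\<^esub> w)) = s \<odot>\<^bsub>M\<^esub> h w"
proof -
  have "p ^ e = Suc (p ^ e - 1)" using assms(2) by simp
  then have "s [^] (p ^ e) = s [^] (p ^ e - 1) \<otimes> s" using assms(3) by (metis nat_pow_Suc)
  then have "s [^] (p ^ e - 1) \<odot>\<^bsub>M\<^esub> (s \<odot>\<^bsub>M\<^esub> w) = s [^] (p ^ e) \<odot>\<^bsub>M\<^esub> w"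
    using assms(3,4) by (simp add: smult_assoc1)
  then show ?thesis using lin_maps_frob_pushD(3)[OF assms(1,4,3)] by simp
qed

text \<open>
  The bound on \<open>p\<close> makes \<open>p\<^sup>e \<ge> 2\<close> in positive degrees, on which stabilization rests.
\<close>

definition cartier_algebra_on :: "nat \<Rightarrow> (nat \<Rightarrow> ('c \<Rightarrow> 'c) set) \<Rightarrow> bool"
  where "cartier_algebra_on p C \<longleftrightarrow> p \<ge> 2 \<and> (\<forall>e. C e \<subseteq> lin_maps R (frob_push R p e M) M)"

lemma cartier_algebra_onD:
  assumes "cartier_algebra_on p C" "\<phi> \<in> C e" "x \<in> carrier M"
  shows "\<phi> x \<in> carrier M"
    and "y \<in> carrier M \<Longrightarrow> \<phi> (x \<oplus>\<^bsub>M\<^esub> y) = \<phi> x \<oplus>\<^bsub>M\<^esub> \<phi> y"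
    and "r \<in> carrier R \<Longrightarrow> \<phi> ((r [^] (p ^ e)) \<odot>\<^bsub>M\<^esub> x) = r \<odot>\<^bsub>M\<^esub> \<phi> x"
  using lin_maps_frob_pushD[of \<phi> p e x] assms by (auto simp: cartier_algebra_on_def)

lemma operators_carrier:
  assumes "cartier_algebra_on p C" "Y \<subseteq> carrier M"
  shows "(\<Union>e\<in>{1..}. \<Union>\<phi>\<in>C e. \<phi> ` Y) \<subseteq> carrier M"
  using cartier_algebra_onD(1)[OF assms(1)] assms(2) by blast

lemma submodule_plus_image:
  assumes "cartier_algebra_on p C" "Y \<subseteq> carrier M"
  shows "submodule (plus_image R M C Y) R M"
  unfolding plus_image_def by (rule submodule_mod_span[OF operators_carrier[OF assms]])

lemma plus_image_incl: "e \<ge> 1 \<Longrightarrow> \<phi> \<in> C e \<Longrightarrow> y \<in> Y \<Longrightarrow> \<phi> y \<in> plus_image R M C Y"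
  unfolding plus_image_def using mod_span_incl[of "\<Union>e\<in>{1..}. \<Union>\<phi>\<in>C e. \<phi> ` Y"] by fastforce

lemma plus_image_least:
  assumes "submodule H R M" "\<And>e \<phi> y. e \<ge> 1 \<Longrightarrow> \<phi> \<in> C e \<Longrightarrow> y \<in> Y \<Longrightarrow> \<phi> y \<in> H"
  shows "plus_image R M C Y \<subseteq> H"
  unfolding plus_image_def using assms by (intro mod_span_least) auto

lemma plus_image_mono: "Y \<subseteq> Z \<Longrightarrow> plus_image R M C Y \<subseteq> plus_image R M C Z"
  unfolding plus_image_def by (intro mod_span_mono) blast

text \<open>
  For \<open>e \<ge> 1\<close> the power \<open>x\<^sup>q\<close>, \<open>q = p\<^sup>e\<close>, is a multiple of \<open>x\<^sup>2\<close>, and so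
  \<open>x \<phi>(y) = \<phi>(x\<^sup>q y) \<in> \<phi>(Z)\<close>.
\<close>

lemma smult_plus_image:
  assumes C: "cartier_algebra_on p C" and x: "x \<in> carrier R"
    and Y: "submodule Y R M" and Z: "submodule Z R M"
    and YZ: "\<And>y. y \<in> Y \<Longrightarrow> x \<odot>\<^bsub>M\<^esub> (x \<odot>\<^bsub>M\<^esub> y) \<in> Z" and d: "d \<in> plus_image R M C Y"
  shows "x \<odot>\<^bsub>M\<^esub> d \<in> plus_image R M C Z"
proof -
  have ZM: "Z \<subseteq> carrier M" and YM: "Y \<subseteq> carrier M" using Y Z by (auto simp: submodule_iff)
  have "plus_image R M C Y \<subseteq> {v \<in> carrier M. x \<odot>\<^bsub>M\<^esub> v \<in> plus_image R M C Z}"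
  proof (rule plus_image_least)
    show "submodule {v \<in> carrier M. x \<odot>\<^bsub>M\<^esub> v \<in> plus_image R M C Z} R M"
      by (rule submodule_preimage_smult[OF submodule_plus_image[OF C ZM] x])
    fix e :: nat and \<phi> y assume e: "e \<ge> 1" and \<phi>: "\<phi> \<in> C e" and y: "y \<in> Y"
    have yM: "y \<in> carrier M" using y YM by blast
    have "(2::nat) ^ 1 \<le> 2 ^ e" using e by (intro power_increasing) auto
    moreover have "2 ^ e \<le> p ^ e"
      using C by (intro power_mono) (auto simp: cartier_algebra_on_def)
    ultimately have q: "p ^ e = (p ^ e - 2) + 2" by simp
    have "x [^] (2::nat) = x \<otimes> x" using x by (simp add: numeral_2_eq_2)
    then have "x [^] (p ^ e) = x [^] (p ^ e - 2) \<otimes> (x \<otimes> x)"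
      using x q nat_pow_mult[OF x, of "p ^ e - 2" 2] by simp
    then have "(x [^] (p ^ e)) \<odot>\<^bsub>M\<^esub> y = x [^] (p ^ e - 2) \<odot>\<^bsub>M\<^esub> (x \<odot>\<^bsub>M\<^esub> (x \<odot>\<^bsub>M\<^esub> y))"
      using x yM by (simp add: smult_assoc1)
    also have "\<dots> \<in> Z" using YZ[OF y] Z x by (simp add: submodule_iff)
    finally have "\<phi> ((x [^] (p ^ e)) \<odot>\<^bsub>M\<^esub> y) \<in> plus_image R M C Z"
      using plus_image_incl[of e \<phi> C _ Z] e \<phi> by blast
    then show "\<phi> y \<in> {v \<in> carrier M. x \<odot>\<^bsub>M\<^esub> v \<in> plus_image R M C Z}"
      using cartier_algebra_onD(1,3)[OF C \<phi> yM] x by simp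
  qed
  then show ?thesis using d by blast
qed

lemma stable_image_cartier_algebra:
  assumes "noetherian_ring R" "fin_gen R M" and C: "cartier_algebra_on p C"
  shows "\<exists>U. is_stable_image R M C U"
proof -
  obtain k where "\<And>n. n \<ge> k \<Longrightarrow>
      (plus_image R M C ^^ n) (carrier M) = (plus_image R M C ^^ k) (carrier M)"
    using iterated_image_stabilizes[OF assms(1,2), of "plus_image R M C"]
      submodule_plus_image[OF C] smult_plus_image[OF C] by (metis submoduleE(1))
  then show ?thesis unfolding is_stable_image_def eventually_sequentially by blast
qed

lemma stable_image_eqI: "is_stable_image R M C U \<Longrightarrow> stable_image R M C = U"
  unfolding stable_image_def
proof (rule the_equality)
  fix U' assume "is_stable_image R M C U" "is_stable_image R M C U'"
  then have "\<forall>\<^sub>F h in sequentially. U' = U"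
    unfolding is_stable_image_def by eventually_elim simp
  then show "U' = U" by simp
qed

lemma plus_image_restrict:
  assumes "submodule N R M" "Y \<subseteq> N" "\<And>e \<phi>. \<phi> \<in> C e \<Longrightarrow> \<phi> ` N \<subseteq> N"
  shows "plus_image R (M\<lparr>carrier := N\<rparr>) C Y = plus_image R M C Y"
  unfolding plus_image_def using assms by (intro mod_span_restrict) blast+

lemma plus_image_subset:
  assumes "submodule N R M" "Y \<subseteq> N" "\<And>e \<phi>. \<phi> \<in> C e \<Longrightarrow> \<phi> ` N \<subseteq> N"
  shows "plus_image R M C Y \<subseteq> N"
  using assms by (intro plus_image_least) blast+

lemma plus_image_iterate_restrict:
  assumes "submodule N R M" "\<And>e \<phi>. \<phi> \<in> C e \<Longrightarrow> \<phi> ` N \<subseteq> N"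
  shows "(plus_image R (M\<lparr>carrier := N\<rparr>) C ^^ h) N = (plus_image R M C ^^ h) N \<and>
    (plus_image R M C ^^ h) N \<subseteq> N"
  by (induction h) (use assms plus_image_restrict plus_image_subset in auto)

lemma plus_image_iterate_mono:
  "Y \<subseteq> Z \<Longrightarrow> (plus_image R M C ^^ h) Y \<subseteq> (plus_image R M C ^^ h) Z"
  by (induction h) (auto intro: plus_image_mono[THEN subsetD])

text \<open>
  The right-hand side mentions \<open>U\<close> but not \<open>N\<close>.  If \<open>X\<close> is \<open>C\<close>-stable and agrees with \<open>U\<close> generically,
  then so is and does \<open>X \<inter> U\<close>, which lies in \<open>N\<close>; thus competitors outside \<open>N\<close> do not matter and
  a smallest one is contained in \<open>U\<close>.
\<close>

lemma is_test_module_iff: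
  assumes N: "submodule N R M" and stable: "stable_image R (M\<lparr>carrier := N\<rparr>) C = U"
    and U: "submodule U R M" "U \<subseteq> N" "\<And>e \<phi>. \<phi> \<in> C e \<Longrightarrow> \<phi> ` U \<subseteq> U"
  defines "good \<equiv> \<lambda>X. submodule X R M \<and> (\<forall>e. \<forall>\<phi>\<in>C e. \<phi> ` X \<subseteq> X) \<and>
      (\<forall>P\<in>generic_points R (M\<lparr>carrier := U\<rparr>).
        (\<forall>a\<in>X. \<exists>s\<in>carrier R - P. s \<odot>\<^bsub>M\<^esub> a \<in> U) \<and> (\<forall>b\<in>U. \<exists>s\<in>carrier R - P. s \<odot>\<^bsub>M\<^esub> b \<in> X))"
  shows "is_test_module R (M\<lparr>carrier := N\<rparr>) C T \<longleftrightarrow> good T \<and> T \<subseteq> U \<and> (\<forall>X. good X \<longrightarrow> T \<subseteq> X)"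
proof -
  interpret N: module R "M\<lparr>carrier := N\<rparr>"
    using submodule.submodule_is_module[OF N module_axioms] .
  let ?Z = "generic_points R (M\<lparr>carrier := U\<rparr>)"
  have Z: "primeideal P R" if "P \<in> ?Z" for P using that by (auto simp: generic_points_def Supp_def)
  have UN: "submodule U R (M\<lparr>carrier := N\<rparr>)" using U submodule_restrict_iff[OF N] by blast
  have agrees: "alg_submodule R (M\<lparr>carrier := N\<rparr>) C X \<and>
      agree_generically R (M\<lparr>carrier := N\<rparr>) ?Z X U \<longleftrightarrow> good X \<and> X \<subseteq> N" for X
    using N.agree_generically_iff[OF _ UN Z, of X ?Z]
    by (auto simp: alg_submodule_def submodule_restrict_iff[OF N] good_def)
  have test: "is_test_module R (M\<lparr>carrier := N\<rparr>) C T \<longleftrightarrow>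
      (good T \<and> T \<subseteq> N) \<and> (\<forall>X. good X \<and> X \<subseteq> N \<longrightarrow> T \<subseteq> X)"
    unfolding is_test_module_def Let_def stable using agrees by simp
  have Int: "good (X \<inter> U)" if X: "good X" for X
  proof -
    have "\<exists>s\<in>carrier R - P. s \<odot>\<^bsub>M\<^esub> b \<in> X \<inter> U" if P: "P \<in> ?Z" and b: "b \<in> U" for P b
    proof -
      obtain s where "s \<in> carrier R - P" "s \<odot>\<^bsub>M\<^esub> b \<in> X" using X P b unfolding good_def by blast
      then show ?thesis using b U(1) by (auto simp: submodule_iff)
    qed
    moreover have "submodule (X \<inter> U) R M" using X U(1) submodule_Int unfolding good_def by blast
    moreover have "\<phi> ` (X \<inter> U) \<subseteq> X \<inter> U" if "\<phi> \<in> C e" for \<phi> e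
      using X U(3) that unfolding good_def by blast
    moreover have "\<forall>a\<in>X \<inter> U. \<exists>s\<in>carrier R - P. s \<odot>\<^bsub>M\<^esub> a \<in> U" if "P \<in> ?Z" for P
      using X that unfolding good_def by blast
    ultimately show ?thesis unfolding good_def by blast
  qed
  show ?thesis unfolding test
  proof (intro iffI conjI allI impI)
    assume T: "(good T \<and> T \<subseteq> N) \<and> (\<forall>X. good X \<and> X \<subseteq> N \<longrightarrow> T \<subseteq> X)"
    have *: "T \<subseteq> X \<inter> U" if "good X" for X using T Int[OF that] U(2) by blast
    show "T \<subseteq> U" using * T by blast
    show "T \<subseteq> X" if "good X" for X using *[OF that] by blast
  qed (use U(2) in blast)+
qed

end

section \<open>The algebra of a power and local nil-isomorphisms\<close>

context module
begin

lemma cartier_algebra_power_algebra: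
  assumes p: "p \<ge> 2" and \<kappa>: "\<kappa> \<in> lin_maps R (frob_push R p 1 M) M" and f: "f \<in> carrier R"
  shows "cartier_algebra_on p (power_algebra R p M \<kappa> f t)"
  unfolding cartier_algebra_on_def
proof (intro conjI allI subsetI)
  fix e \<phi> assume \<phi>: "\<phi> \<in> power_algebra R p M \<kappa> f t e"
  show "\<phi> \<in> lin_maps R (frob_push R p e M) M"
  proof (cases "e = 0")
    case True
    then obtain r where "r \<in> carrier R" "\<phi> = (\<lambda>m. r \<odot>\<^bsub>M\<^esub> m)" using \<phi> by (auto simp: power_algebra_def)
    then show ?thesis
      using True by (intro lin_maps_frob_pushI) (auto simp: smult_r_distr smult_comm)
  next
    case False
    then obtain r where r: "r \<in> carrier R"
      and \<phi>: "\<phi> = (\<lambda>m. (\<kappa> ^^ e) ((f [^] nat \<lceil>t * of_nat (p ^ e)\<rceil> \<otimes> r) \<odot>\<^bsub>M\<^esub> m))"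
      using \<phi> by (auto simp: power_algebra_def)
    note ke = lin_maps_frob_pushD[OF frobenius_iterate_lin_maps[OF \<kappa>, of e]]
    show ?thesis
    proof (rule lin_maps_frob_pushI)
      fix s x assume sx: "s \<in> carrier R" "x \<in> carrier M"
      have "(f [^] nat \<lceil>t * of_nat (p ^ e)\<rceil> \<otimes> r) \<odot>\<^bsub>M\<^esub> (s [^] (p ^ e) \<odot>\<^bsub>M\<^esub> x) =
          s [^] (p ^ e) \<odot>\<^bsub>M\<^esub> ((f [^] nat \<lceil>t * of_nat (p ^ e)\<rceil> \<otimes> r) \<odot>\<^bsub>M\<^esub> x)"
        using sx r f by (intro smult_comm) auto
      then show "\<phi> (s [^] (p ^ e) \<odot>\<^bsub>M\<^esub> x) = s \<odot>\<^bsub>M\<^esub> \<phi> x"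
        unfolding \<phi> using sx r f by (simp add: ke(3))
    qed (use r f in \<open>simp_all add: \<phi> ke(1,2) smult_r_distr\<close>)
  qed
qed (rule p)

lemma power_algebra_restrict [simp]:
  "power_algebra R p (M\<lparr>carrier := N\<rparr>) \<kappa> f t = power_algebra R p M \<kappa> f t"
  by (simp add: power_algebra_def fun_eq_iff)

lemma power_algebra_stable:
  assumes N: "submodule N R M" and \<kappa>: "\<kappa> ` N \<subseteq> N" and f: "f \<in> carrier R"
    and \<phi>: "\<phi> \<in> power_algebra R p M \<kappa> f t e"
  shows "\<phi> ` N \<subseteq> N"
proof -
  have ke: "(\<kappa> ^^ e) x \<in> N" if "x \<in> N" for x using that \<kappa> by (induction e) auto
  have "(f [^] (k::nat) \<otimes> r) \<odot>\<^bsub>M\<^esub> x \<in> N" if "r \<in> carrier R" "x \<in> N" for k r x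
    using that N f by (auto simp: submodule_iff)
  then show ?thesis
    using \<phi> ke N by (auto simp: power_algebra_def submodule_iff split: if_splits)
qed

text \<open>
  The elements that \<open>\<kappa>\<^sup>k\<close> sends to \<open>N\<close> along with their multiples; asking this of the
  multiples too makes the set a submodule.
\<close>

definition nil_closure :: "('c \<Rightarrow> 'c) \<Rightarrow> 'c set \<Rightarrow> nat \<Rightarrow> 'c set"
  where "nil_closure \<kappa> N k = {v \<in> carrier M. \<forall>r\<in>carrier R. (\<kappa> ^^ k) (r \<odot>\<^bsub>M\<^esub> v) \<in> N}"

lemma nil_closure_self: "x \<in> nil_closure \<kappa> N k \<Longrightarrow> (\<kappa> ^^ k) x \<in> N"
  unfolding nil_closure_def by (metis (no_types, lifting) mem_Collect_eq R.one_closed smult_one)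

lemma nil_closure_0: "submodule N R M \<Longrightarrow> nil_closure \<kappa> N 0 = N"
proof (intro equalityI subsetI)
  show "x \<in> N" if "x \<in> nil_closure \<kappa> N 0" for x using nil_closure_self[OF that] by simp
  show "x \<in> nil_closure \<kappa> N 0" if "submodule N R M" "x \<in> N" for x
    using that submoduleE(1)[OF that(1)] submoduleE(4)[OF that(1)] by (simp add: nil_closure_def subsetD)
qed

lemma submodule_nil_closure:
  assumes N: "submodule N R M" and \<kappa>: "\<kappa> \<in> lin_maps R (frob_push R p 1 M) M"
  shows "submodule (nil_closure \<kappa> N k) R M"
proof -
  note add = lin_maps_frob_pushD(2)[OF frobenius_iterate_lin_maps[OF \<kappa>, of k]]
  note zero = lin_maps_frob_push_zero[OF frobenius_iterate_lin_maps[OF \<kappa>, of k]]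
  show ?thesis
    unfolding submodule_iff
  proof (intro conjI ballI)
    show "nil_closure \<kappa> N k \<subseteq> carrier M" by (auto simp: nil_closure_def)
    show "\<zero>\<^bsub>M\<^esub> \<in> nil_closure \<kappa> N k"
      using submodule_iff[THEN iffD1, OF N] by (simp add: nil_closure_def zero)
  next
    fix a b assume "a \<in> nil_closure \<kappa> N k" "b \<in> nil_closure \<kappa> N k"
    then show "a \<oplus>\<^bsub>M\<^esub> b \<in> nil_closure \<kappa> N k"
      using submodule_iff[THEN iffD1, OF N] by (simp add: nil_closure_def smult_r_distr add)
  next
    fix r a assume "r \<in> carrier R" "a \<in> nil_closure \<kappa> N k"
    then show "r \<odot>\<^bsub>M\<^esub> a \<in> nil_closure \<kappa> N k"
      by (simp add: nil_closure_def smult_assoc1[symmetric])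
  qed
qed

lemma nil_closure_mono:
  assumes "\<kappa> ` N \<subseteq> N" "k \<le> l"
  shows "nil_closure \<kappa> N k \<subseteq> nil_closure \<kappa> N l"
proof -
  have "(\<kappa> ^^ l) x \<in> N" if "(\<kappa> ^^ k) x \<in> N" for x
    using assms(2) that assms(1) by (induction l rule: dec_induct) auto
  then show ?thesis by (auto simp: nil_closure_def)
qed

text \<open>
  An operator of degree \<open>e \<ge> 1\<close> contains at least one factor \<open>\<kappa>\<close>; the other \<open>e - 1\<close> do no harm
  because \<open>N\<close> is stable under \<open>\<kappa>\<close>.
\<close>

lemma plus_image_nil_closure:
  assumes N: "submodule N R M" and \<kappa>N: "\<kappa> ` N \<subseteq> N"
    and \<kappa>: "\<kappa> \<in> lin_maps R (frob_push R p 1 M) M" and f: "f \<in> carrier R"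
  shows "plus_image R M (power_algebra R p M \<kappa> f t) (nil_closure \<kappa> N (Suc k)) \<subseteq> nil_closure \<kappa> N k"
proof (rule plus_image_least[OF submodule_nil_closure[OF N \<kappa>]])
  fix e \<phi> y
  assume e: "1 \<le> e" and \<phi>: "\<phi> \<in> power_algebra R p M \<kappa> f t e" and y: "y \<in> nil_closure \<kappa> N (Suc k)"
  then obtain b where b: "b \<in> carrier R"
      "\<phi> y = (\<kappa> ^^ e) ((f [^] nat \<lceil>t * of_nat (p ^ e)\<rceil> \<otimes> b) \<odot>\<^bsub>M\<^esub> y)"
    by (auto simp: power_algebra_def)
  define a where "a = f [^] nat \<lceil>t * of_nat (p ^ e)\<rceil> \<otimes> b"
  have a: "a \<in> carrier R" "\<phi> y = (\<kappa> ^^ e) (a \<odot>\<^bsub>M\<^esub> y)"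
    using b f by (simp_all add: a_def)
  note ke = lin_maps_frob_pushD[OF frobenius_iterate_lin_maps[OF \<kappa>, of e]]
  have yM: "y \<in> carrier M" using y by (auto simp: nil_closure_def)
  obtain i where i: "e = Suc i" using e by (cases e) auto
  show "\<phi> y \<in> nil_closure \<kappa> N k"
    unfolding nil_closure_def
  proof (intro CollectI conjI ballI)
    show "\<phi> y \<in> carrier M" using a yM ke(1) by simp
    fix r assume r: "r \<in> carrier R"
    let ?z = "(r [^] (p ^ e) \<otimes> a) \<odot>\<^bsub>M\<^esub> y"
    have "(\<kappa> ^^ k) (r \<odot>\<^bsub>M\<^esub> \<phi> y) = (\<kappa> ^^ k) ((\<kappa> ^^ e) ?z)"
      using a r yM ke(3)[of "a \<odot>\<^bsub>M\<^esub> y" r] by (simp add: smult_assoc1)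
    also have "\<dots> = (\<kappa> ^^ (i + Suc k)) ?z"
      by (simp add: i funpow_add[THEN fun_cong, unfolded o_def, symmetric] add.commute
          del: funpow.simps)
    also have "\<dots> = (\<kappa> ^^ i) ((\<kappa> ^^ Suc k) ?z)"
      by (simp only: funpow_add o_apply)
    also have "\<dots> \<in> N"
    proof -
      have "(\<kappa> ^^ Suc k) ?z \<in> N" using y a r unfolding nil_closure_def by blast
      then show ?thesis using \<kappa>N by (induction i) auto
    qed
    finally show "(\<kappa> ^^ k) (r \<odot>\<^bsub>M\<^esub> \<phi> y) \<in> N" .
  qed
qed

lemma plus_image_iterate_nil_closure:
  assumes N: "submodule N R M" and \<kappa>N: "\<kappa> ` N \<subseteq> N"
    and \<kappa>: "\<kappa> \<in> lin_maps R (frob_push R p 1 M) M" and f: "f \<in> carrier R"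
  shows "(plus_image R M (power_algebra R p M \<kappa> f t) ^^ k) (nil_closure \<kappa> N k) \<subseteq> N"
proof (induction k)
  case 0
  show ?case using nil_closure_0[OF N] by simp
next
  case (Suc k)
  let ?D = "plus_image R M (power_algebra R p M \<kappa> f t)"
  have "(?D ^^ Suc k) (nil_closure \<kappa> N (Suc k)) = (?D ^^ k) (?D (nil_closure \<kappa> N (Suc k)))"
    by (simp add: funpow_swap1)
  also have "\<dots> \<subseteq> (?D ^^ k) (nil_closure \<kappa> N k)"
    by (rule plus_image_iterate_mono[OF plus_image_nil_closure[OF assms]])
  finally show ?case using Suc by blast
qed

lemma finite_subset_nil_closure:
  assumes \<kappa>N: "\<kappa> ` N \<subseteq> N" and A: "finite A" and "\<And>a. a \<in> A \<Longrightarrow> \<exists>k. a \<in> nil_closure \<kappa> N k"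
  shows "\<exists>k. A \<subseteq> nil_closure \<kappa> N k"
  using A assms(3)
proof (induction A rule: finite_induct)
  case (insert a A)
  then obtain k l where "A \<subseteq> nil_closure \<kappa> N k" "a \<in> nil_closure \<kappa> N l" by blast
  then have "insert a A \<subseteq> nil_closure \<kappa> N (max k l)"
    using nil_closure_mono[OF \<kappa>N, of k "max k l"] nil_closure_mono[OF \<kappa>N, of l "max k l"] by auto
  then show ?case by blast
qed simp

text \<open>
  A nilpotent submodule of \<open>V / N\<close> containing the class of \<open>v\<close> contains those of all multiples
  \<open>r v\<close>, and one exponent works for all of them.
\<close>

lemma locally_nilpotent_quotient:
  assumes N: "submodule N R M" and \<kappa>N: "\<kappa> ` N \<subseteq> N"
    and \<kappa>: "\<kappa> \<in> lin_maps R (frob_push R p 1 M) M"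
    and nil: "locally_nilpotent_cartier R (quot_module M N) (quot_map M N \<kappa>)"
    and v: "v \<in> carrier M"
  shows "\<exists>k. v \<in> nil_closure \<kappa> N k"
proof -
  let ?Q = "quot_module M N" and ?q = "quot_map M N \<kappa>"
  note k = lin_maps_frob_pushD[OF \<kappa>]
  have sub: "subgroup N (add_monoid M)" by (rule submodule.axioms(1)[OF N])
  have NM: "n \<in> carrier M" if "n \<in> N" for n using N that by (auto simp: submodule_iff)
  have mem: "y \<in> N +>\<^bsub>M\<^esub> x \<longleftrightarrow> (\<exists>n\<in>N. y = n \<oplus>\<^bsub>M\<^esub> x)" for x y by (auto simp: a_r_coset_def')
  have zeroN: "\<zero>\<^bsub>M\<^esub> \<in> N" using N by (auto simp: submodule_iff)
  have self: "x \<in> N +>\<^bsub>M\<^esub> x" if "x \<in> carrier M" for x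
    using that zeroN unfolding mem by (intro bexI[of _ "\<zero>\<^bsub>M\<^esub>"]) auto
  have absorb: "N +>\<^bsub>M\<^esub> (n \<oplus>\<^bsub>M\<^esub> x) = N +>\<^bsub>M\<^esub> x" if "n \<in> N" "x \<in> carrier M" for n x
    using M.a_repr_independence[OF _ that(2) sub, of "n \<oplus>\<^bsub>M\<^esub> x"] that(1) mem by auto
  have q: "?q (N +>\<^bsub>M\<^esub> x) = N +>\<^bsub>M\<^esub> \<kappa> x" if x: "x \<in> carrier M" for x
    unfolding quot_map_def
  proof (rule SUP_eq_const)
    fix y assume "y \<in> N +>\<^bsub>M\<^esub> x"
    then obtain n where n: "n \<in> N" "y = n \<oplus>\<^bsub>M\<^esub> x" unfolding mem by blast
    have "\<kappa> n \<in> N" using n \<kappa>N by blast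
    then show "N +>\<^bsub>M\<^esub> \<kappa> y = N +>\<^bsub>M\<^esub> \<kappa> x" using n x absorb k NM by simp
  qed (use self x in blast)
  have qe: "(?q ^^ e) (N +>\<^bsub>M\<^esub> x) = N +>\<^bsub>M\<^esub> (\<kappa> ^^ e) x \<and> (\<kappa> ^^ e) x \<in> carrier M" if "x \<in> carrier M" for e x
    by (induction e) (use that q k in auto)
  have s: "r \<odot>\<^bsub>?Q\<^esub> (N +>\<^bsub>M\<^esub> x) = N +>\<^bsub>M\<^esub> (r \<odot>\<^bsub>M\<^esub> x)" if r: "r \<in> carrier R" and x: "x \<in> carrier M" for r x
    unfolding quot_module_def module.simps
  proof (rule SUP_eq_const)
    fix y assume "y \<in> N +>\<^bsub>M\<^esub> x"
    then obtain n where n: "n \<in> N" "y = n \<oplus>\<^bsub>M\<^esub> x" unfolding mem by blast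
    have "r \<odot>\<^bsub>M\<^esub> n \<in> N" using n r N by (simp add: submodule_iff)
    then show "N +>\<^bsub>M\<^esub> (r \<odot>\<^bsub>M\<^esub> y) = N +>\<^bsub>M\<^esub> (r \<odot>\<^bsub>M\<^esub> x)" using n x r absorb NM by (simp add: smult_r_distr)
  qed (use self x in blast)
  have "N +>\<^bsub>M\<^esub> v \<in> carrier ?Q"
    using v unfolding quot_module_def by (auto simp: A_RCOSETS_def')
  then have "N +>\<^bsub>M\<^esub> v \<in> \<Union>{L. cartier_submodule R ?Q ?q L \<and> nilpotent_cartier (?Q\<lparr>carrier := L\<rparr>) ?q}"
    using nil unfolding locally_nilpotent_cartier_def by simp
  then obtain L where L: "N +>\<^bsub>M\<^esub> v \<in> L" "submodule L R ?Q" "nilpotent_cartier (?Q\<lparr>carrier := L\<rparr>) ?q"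
    by (auto simp: cartier_submodule_def)
  then obtain e where e: "\<And>X. X \<in> L \<Longrightarrow> (?q ^^ e) X = N"
    by (auto simp: nilpotent_cartier_def quot_module_def)
  have "(\<kappa> ^^ e) (r \<odot>\<^bsub>M\<^esub> v) \<in> N" if r: "r \<in> carrier R" for r
  proof -
    have "N +>\<^bsub>M\<^esub> (r \<odot>\<^bsub>M\<^esub> v) \<in> L" using submodule.smult_closed[OF L(2) r L(1)] s[OF r v] by simp
    then have "N +>\<^bsub>M\<^esub> (\<kappa> ^^ e) (r \<odot>\<^bsub>M\<^esub> v) = N" using e qe[of "r \<odot>\<^bsub>M\<^esub> v" e] r v by auto
    then show ?thesis using self[of "(\<kappa> ^^ e) (r \<odot>\<^bsub>M\<^esub> v)"] qe[of "r \<odot>\<^bsub>M\<^esub> v" e] r v by auto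
  qed
  then show ?thesis using v unfolding nil_closure_def by blast
qed

lemma local_nil_isomorphismD:
  assumes "submodule N R M" "\<kappa> ` N \<subseteq> N" "\<kappa> \<in> lin_maps R (frob_push R p 1 M) M"
    and "local_nil_isomorphism R (M\<lparr>carrier := N\<rparr>) \<kappa> M \<kappa> (\<lambda>m. m)" and "v \<in> carrier M"
  shows "\<exists>k. v \<in> nil_closure \<kappa> N k"
  using locally_nilpotent_quotient[OF assms(1-3) _ assms(5)] assms(4)
  by (simp add: local_nil_isomorphism_def)

text \<open>
  By finite generation, the exponents that belong to the elements of \<open>N'\<close> can be chosen to be
  equal.
\<close>

lemma fin_gen_subset_nil_closure:
  assumes N: "submodule N R M" "\<kappa> ` N \<subseteq> N" and \<kappa>: "\<kappa> \<in> lin_maps R (frob_push R p 1 M) M"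
    and nil: "\<And>v. v \<in> carrier M \<Longrightarrow> \<exists>k. v \<in> nil_closure \<kappa> N k"
    and N': "submodule N' R M" "fin_gen R (M\<lparr>carrier := N'\<rparr>)"
  shows "\<exists>k. N' \<subseteq> nil_closure \<kappa> N k"
proof -
  obtain A where A: "A \<subseteq> N'" "finite A" "mod_span R (M\<lparr>carrier := N'\<rparr>) A = N'"
    using N'(2) by (auto simp: fin_gen_def)
  have "\<exists>k. A \<subseteq> nil_closure \<kappa> N k"
    using A N'(1) by (intro finite_subset_nil_closure[OF N(2)] nil) (auto simp: submodule_iff)
  moreover have "mod_span R M A = N'" using mod_span_restrict[OF N'(1) A(1)] A(3) by simp
  ultimately show ?thesis using mod_span_least[OF submodule_nil_closure[OF N(1) \<kappa>]] by metis
qed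

lemma is_stable_image_powerD:
  assumes f: "f \<in> carrier R" and N: "submodule N R M" "\<kappa> ` N \<subseteq> N"
    and U: "is_stable_image R (M\<lparr>carrier := N\<rparr>) (power_algebra R p M \<kappa> f t) U"
  shows "U \<subseteq> N \<and> (\<exists>h. \<forall>n\<ge>h. (plus_image R M (power_algebra R p M \<kappa> f t) ^^ n) N = U)"
proof -
  let ?C = "power_algebra R p M \<kappa> f t"
  have r: "(plus_image R (M\<lparr>carrier := N\<rparr>) ?C ^^ h) N = (plus_image R M ?C ^^ h) N \<and>
      (plus_image R M ?C ^^ h) N \<subseteq> N" for h
    by (rule plus_image_iterate_restrict[OF N(1)]) (rule power_algebra_stable[OF N f])
  have "\<exists>h. \<forall>n\<ge>h. (plus_image R M ?C ^^ n) N = U"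
    using U r by (simp add: is_stable_image_def eventually_sequentially)
  then show ?thesis using r by (metis order_refl)
qed

text \<open>
  As \<open>(C\<^sub>+)\<^sup>k N' \<subseteq> N\<close> for some \<open>k\<close>, also \<open>(C\<^sub>+)\<^sup>h\<^sup>+\<^sup>k N' \<subseteq> (C\<^sub>+)\<^sup>h N\<close> for all \<open>h\<close>.
\<close>

lemma stable_image_subset:
  assumes \<kappa>: "\<kappa> \<in> lin_maps R (frob_push R p 1 M) M" and f: "f \<in> carrier R"
    and N: "submodule N R M" "\<kappa> ` N \<subseteq> N" and nil: "\<And>v. v \<in> carrier M \<Longrightarrow> \<exists>k. v \<in> nil_closure \<kappa> N k"
    and N': "submodule N' R M" "\<kappa> ` N' \<subseteq> N'" "fin_gen R (M\<lparr>carrier := N'\<rparr>)"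
    and U: "is_stable_image R (M\<lparr>carrier := N\<rparr>) (power_algebra R p M \<kappa> f t) U"
    and U': "is_stable_image R (M\<lparr>carrier := N'\<rparr>) (power_algebra R p M \<kappa> f t) U'"
  shows "U' \<subseteq> U"
proof -
  let ?C = "power_algebra R p M \<kappa> f t"
  let ?D = "plus_image R M ?C"
  obtain h where h: "\<And>n. n \<ge> h \<Longrightarrow> (?D ^^ n) N = U"
    using is_stable_image_powerD[OF f N U] by blast
  obtain h' where h': "\<And>n. n \<ge> h' \<Longrightarrow> (?D ^^ n) N' = U'"
    using is_stable_image_powerD[OF f N'(1,2) U'] by blast
  obtain k where k: "N' \<subseteq> nil_closure \<kappa> N k"
    using fin_gen_subset_nil_closure[OF N \<kappa> nil N'(1,3)] by blast
  have "(?D ^^ k) N' \<subseteq> N"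
    using plus_image_iterate_nil_closure[OF N \<kappa> f] by (rule order_trans[OF plus_image_iterate_mono[OF k]])
  then have "(?D ^^ (max h h')) ((?D ^^ k) N') \<subseteq> (?D ^^ (max h h')) N"
    by (rule plus_image_iterate_mono)
  also have "(?D ^^ (max h h')) ((?D ^^ k) N') = (?D ^^ (max h h' + k)) N'" by (simp add: funpow_add)
  finally show ?thesis using h[of "max h h'"] h'[of "max h h' + k"] by simp
qed

lemma stable_image_properties:
  assumes p: "p \<ge> 2" and \<kappa>: "\<kappa> \<in> lin_maps R (frob_push R p 1 M) M" and f: "f \<in> carrier R"
    and N: "submodule N R M" "\<kappa> ` N \<subseteq> N"
    and U: "is_stable_image R (M\<lparr>carrier := N\<rparr>) (power_algebra R p M \<kappa> f t) U"
  shows "submodule U R M" "U \<subseteq> N" "plus_image R M (power_algebra R p M \<kappa> f t) U = U"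
    "\<phi> \<in> power_algebra R p M \<kappa> f t e \<Longrightarrow> \<phi> ` U \<subseteq> U"
proof -
  let ?C = "power_algebra R p M \<kappa> f t"
  let ?D = "plus_image R M ?C"
  note C = cartier_algebra_power_algebra[OF p \<kappa> f, of t]
  obtain h where h: "\<And>n. n \<ge> h \<Longrightarrow> (?D ^^ n) N = U" and UN: "U \<subseteq> N"
    using is_stable_image_powerD[OF f N U] by blast
  show "U \<subseteq> N" by (rule UN)
  show DU: "?D U = U" using h[of h] h[of "Suc h"] by simp
  have "U \<subseteq> carrier M" using UN N by (auto simp: submodule_iff)
  then show sU: "submodule U R M" using submodule_plus_image[OF C, of U] DU by simp
  show "\<phi> ` U \<subseteq> U" if \<phi>: "\<phi> \<in> ?C e"
  proof (cases "e = 0")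
    case True
    then show ?thesis using \<phi> sU by (auto simp: power_algebra_def submodule_iff)
  next
    case False
    then show ?thesis using plus_image_incl[of e \<phi> ?C _ U] \<phi> DU by auto
  qed
qed

lemma stable_image_power_algebra:
  assumes p: "p \<ge> 2" and \<kappa>: "\<kappa> \<in> lin_maps R (frob_push R p 1 M) M" and f: "f \<in> carrier R"
    and noeth: "noetherian_ring R"
    and N: "submodule N R M" "\<kappa> ` N \<subseteq> N" "fin_gen R (M\<lparr>carrier := N\<rparr>)"
  obtains U where "is_stable_image R (M\<lparr>carrier := N\<rparr>) (power_algebra R p M \<kappa> f t) U"
proof -
  interpret N: module R "M\<lparr>carrier := N\<rparr>"
    using submodule.submodule_is_module[OF N(1) module_axioms] .
  have NM: "x \<in> carrier M" if "x \<in> N" for x using N(1) that by (auto simp: submodule_iff)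
  have "\<kappa> \<in> lin_maps R (frob_push R p 1 (M\<lparr>carrier := N\<rparr>)) (M\<lparr>carrier := N\<rparr>)"
    using N(2) lin_maps_frob_pushD(2,3)[OF \<kappa> NM] NM by (intro N.lin_maps_frob_pushI) auto
  then have "N.cartier_algebra_on p (power_algebra R p M \<kappa> f t)"
    using N.cartier_algebra_power_algebra[OF p _ f, of \<kappa> t] by simp
  then show ?thesis using N.stable_image_cartier_algebra[OF noeth N(3)] that by blast
qed

text \<open>
  Both submodules have the same stable image, and the test module is determined by it.
\<close>

lemma is_test_module_independent:
  assumes p: "p \<ge> 2" and \<kappa>: "\<kappa> \<in> lin_maps R (frob_push R p 1 M) M" and f: "f \<in> carrier R"
    and noeth: "noetherian_ring R"
    and N: "submodule N R M" "\<kappa> ` N \<subseteq> N" "fin_gen R (M\<lparr>carrier := N\<rparr>)"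
      "\<And>v. v \<in> carrier M \<Longrightarrow> \<exists>k. v \<in> nil_closure \<kappa> N k"
    and N': "submodule N' R M" "\<kappa> ` N' \<subseteq> N'" "fin_gen R (M\<lparr>carrier := N'\<rparr>)"
      "\<And>v. v \<in> carrier M \<Longrightarrow> \<exists>k. v \<in> nil_closure \<kappa> N' k"
  shows "is_test_module R (M\<lparr>carrier := N\<rparr>) (power_algebra R p M \<kappa> f t) T \<longleftrightarrow>
    is_test_module R (M\<lparr>carrier := N'\<rparr>) (power_algebra R p M \<kappa> f t) T"
proof -
  let ?C = "power_algebra R p M \<kappa> f t"
  obtain U where U: "is_stable_image R (M\<lparr>carrier := N\<rparr>) ?C U"
    using stable_image_power_algebra[OF p \<kappa> f noeth N(1-3)] .
  obtain U' where U': "is_stable_image R (M\<lparr>carrier := N'\<rparr>) ?C U'"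
    using stable_image_power_algebra[OF p \<kappa> f noeth N'(1-3)] .
  have "U' \<subseteq> U" by (rule stable_image_subset[OF \<kappa> f N(1,2,4) N'(1-3) U U'])
  moreover have "U \<subseteq> U'" by (rule stable_image_subset[OF \<kappa> f N'(1,2,4) N(1-3) U' U])
  ultimately have eq: "U' = U" by blast
  note props = stable_image_properties[OF p \<kappa> f N(1,2) U]
  have UN': "U \<subseteq> N'" using stable_image_properties(2)[OF p \<kappa> f N'(1,2) U'] eq by simp
  interpret N: module R "M\<lparr>carrier := N\<rparr>"
    using submodule.submodule_is_module[OF N(1) module_axioms] .
  interpret N': module R "M\<lparr>carrier := N'\<rparr>"
    using submodule.submodule_is_module[OF N'(1) module_axioms] .
  have st: "stable_image R (M\<lparr>carrier := N\<rparr>) ?C = U" "stable_image R (M\<lparr>carrier := N'\<rparr>) ?C = U"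
    using N.stable_image_eqI[OF U] N'.stable_image_eqI[OF U'] eq by simp_all
  show ?thesis
    by (rule trans[OF is_test_module_iff[OF N(1) st(1) props(1,2)]
          is_test_module_iff[OF N'(1) st(2) props(1) UN', symmetric]]) (erule props(4))+
qed

end

section \<open>Density in the support\<close>

context module
begin

lemma basic_open_mult:
  "g \<in> carrier R \<Longrightarrow> h \<in> carrier R \<Longrightarrow> basic_open R (g \<otimes> h) = basic_open R g \<inter> basic_open R h"
proof -
  assume gh: "g \<in> carrier R" "h \<in> carrier R"
  have "g \<otimes> h \<in> P \<longleftrightarrow> g \<in> P \<or> h \<in> P" if P: "primeideal P R" for P
    using primeideal.I_prime[OF P gh] ideal.I_l_closed[OF primeideal.axioms(1)[OF P], of h g]
      ideal.I_r_closed[OF primeideal.axioms(1)[OF P], of g h] gh by auto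
  then show ?thesis unfolding basic_open_def by auto
qed

lemma zariski_nbhd:
  assumes "openin (zariski R) T" "P \<in> T"
  obtains g where "g \<in> carrier R" "P \<in> basic_open R g" "basic_open R g \<subseteq> T"
proof -
  have "generate_topology_on (basic_open R ` carrier R) T"
    using assms(1) by (simp add: zariski_def openin_topology_generated_by_iff)
  then have "\<exists>g\<in>carrier R. P \<in> basic_open R g \<and> basic_open R g \<subseteq> T"
    using assms(2)
  proof (induction T)
    case (Int A B)
    then obtain g h where "g \<in> carrier R" "P \<in> basic_open R g" "basic_open R g \<subseteq> A"
      "h \<in> carrier R" "P \<in> basic_open R h" "basic_open R h \<subseteq> B" by blast
    then show ?case using basic_open_mult[of g h] by (intro bexI[of _ "g \<otimes> h"]) auto
  next
    case (UN K)
    then show ?case by blast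
  qed auto
  then show ?thesis using that by blast
qed

text \<open>
  The kernel of \<open>M \<rightarrow> M\<^sub>g\<close>.
\<close>

lemma submodule_torsion:
  assumes g: "g \<in> carrier R"
  shows "submodule {m \<in> carrier M. \<exists>n::nat. g [^] n \<odot>\<^bsub>M\<^esub> m = \<zero>\<^bsub>M\<^esub>} R M" (is "submodule ?Y R M")
  unfolding submodule_iff
proof (intro conjI ballI)
  show "\<zero>\<^bsub>M\<^esub> \<in> ?Y" using g by simp
next
  fix a b assume "a \<in> ?Y" "b \<in> ?Y"
  then obtain m n :: nat where a: "a \<in> carrier M" "g [^] m \<odot>\<^bsub>M\<^esub> a = \<zero>\<^bsub>M\<^esub>"
    and b: "b \<in> carrier M" "g [^] n \<odot>\<^bsub>M\<^esub> b = \<zero>\<^bsub>M\<^esub>" by blast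
  have "g [^] (n + m) \<odot>\<^bsub>M\<^esub> a = \<zero>\<^bsub>M\<^esub>"
    using a g by (simp add: nat_pow_mult[symmetric] smult_assoc1)
  moreover have "g [^] (n + m) \<odot>\<^bsub>M\<^esub> b = \<zero>\<^bsub>M\<^esub>"
    using b g by (subst add.commute) (simp add: nat_pow_mult[symmetric] smult_assoc1)
  ultimately have "g [^] (n + m) \<odot>\<^bsub>M\<^esub> (a \<oplus>\<^bsub>M\<^esub> b) = \<zero>\<^bsub>M\<^esub>"
    using a b g by (simp add: smult_r_distr)
  then show "a \<oplus>\<^bsub>M\<^esub> b \<in> ?Y" using a b by blast
next
  fix r a assume r: "r \<in> carrier R" and "a \<in> ?Y"
  then obtain n :: nat where a: "a \<in> carrier M" "g [^] n \<odot>\<^bsub>M\<^esub> a = \<zero>\<^bsub>M\<^esub>" by blast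
  have "g [^] n \<odot>\<^bsub>M\<^esub> (r \<odot>\<^bsub>M\<^esub> a) = \<zero>\<^bsub>M\<^esub>"
    using smult_comm[of "g [^] n" r a] a r g by simp
  then show "r \<odot>\<^bsub>M\<^esub> a \<in> ?Y" using a r by blast
qed blast

text \<open>
  Let \<open>D(g)\<close> be a basic neighbourhood of a point of the support.  Then \<open>M\<close> is not \<open>g\<close>-torsion, and an
  associated prime of \<open>M\<close> modulo its \<open>g\<close>-torsion avoids both \<open>g\<close> and \<open>f\<close>: for \<open>f\<close> this uses that
  \<open>f\<close> is injective on \<open>M\<close>.
\<close>

lemma Supp_dense:
  assumes noeth: "noetherian_ring R" and f: "f \<in> carrier R"
    and inj: "\<And>m. m \<in> carrier M \<Longrightarrow> f \<odot>\<^bsub>M\<^esub> m = \<zero>\<^bsub>M\<^esub> \<Longrightarrow> m = \<zero>\<^bsub>M\<^esub>"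
  shows "Supp R M \<subseteq> zariski R closure_of (basic_open R f \<inter> Supp R M)"
proof
  fix P assume P: "P \<in> Supp R M"
  then obtain m where prime: "primeideal P R" and m: "m \<in> carrier M" "\<And>s. s \<in> carrier R - P \<Longrightarrow> s \<odot>\<^bsub>M\<^esub> m \<noteq> \<zero>\<^bsub>M\<^esub>"
    by (auto simp: Supp_iff)
  have "P \<in> basic_open R \<one>"
    using localization_prime[OF prime] prime
    by (auto simp: basic_open_def localization_def multiplicative_subset_def multiplicative_subset_axioms_def)
  then have top: "P \<in> topspace (zariski R)" by (auto simp: zariski_def)
  have "\<exists>Q. Q \<in> basic_open R f \<inter> Supp R M \<and> Q \<in> T" if T: "P \<in> T" "openin (zariski R) T" for T
  proof -
    obtain g where g: "g \<in> carrier R" "P \<in> basic_open R g" "basic_open R g \<subseteq> T"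
      using zariski_nbhd[OF T(2,1)] by blast
    let ?Y = "{m \<in> carrier M. \<exists>n::nat. g [^] n \<odot>\<^bsub>M\<^esub> m = \<zero>\<^bsub>M\<^esub>}"
    have Y: "submodule ?Y R M" by (rule submodule_torsion[OF g(1)])
    have gP: "g [^] (n::nat) \<in> carrier R - P" for n
    proof (induction n)
      case 0
      then show ?case using \<open>P \<in> basic_open R \<one>\<close> by (simp add: basic_open_def)
    next
      case (Suc n)
      then show ?case using primeideal.I_prime[OF prime, of "g [^] n" g] g by (auto simp: basic_open_def)
    qed
    then have "\<not> carrier M \<subseteq> ?Y" using m by blast
    then obtain x where x: "x \<in> carrier M" "x \<notin> ?Y"
      and Q: "primeideal {r \<in> carrier R. r \<odot>\<^bsub>M\<^esub> x \<in> ?Y} R" (is "primeideal ?Q R")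
      using associated_prime[OF noeth Y carrier_is_submodule] by blast
    have "g \<notin> ?Q"
    proof
      assume "g \<in> ?Q"
      then obtain n :: nat where "g [^] n \<odot>\<^bsub>M\<^esub> (g \<odot>\<^bsub>M\<^esub> x) = \<zero>\<^bsub>M\<^esub>" by blast
      then have "g [^] Suc n \<odot>\<^bsub>M\<^esub> x = \<zero>\<^bsub>M\<^esub>" using g x by (simp add: smult_assoc1)
      then show False using x by blast
    qed
    moreover have "f \<notin> ?Q"
    proof
      assume "f \<in> ?Q"
      then obtain n :: nat where "g [^] n \<odot>\<^bsub>M\<^esub> (f \<odot>\<^bsub>M\<^esub> x) = \<zero>\<^bsub>M\<^esub>" by blast
      then have "f \<odot>\<^bsub>M\<^esub> (g [^] n \<odot>\<^bsub>M\<^esub> x) = \<zero>\<^bsub>M\<^esub>" using g f x smult_comm[of f "g [^] n" x] by simp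
      then have "g [^] n \<odot>\<^bsub>M\<^esub> x = \<zero>\<^bsub>M\<^esub>" using inj[of "g [^] n \<odot>\<^bsub>M\<^esub> x"] g x by simp
      then show False using x by blast
    qed
    moreover have "?Q \<in> Supp R M"
      unfolding Supp_iff
    proof (intro conjI bexI[of _ x] ballI)
      fix s assume s: "s \<in> carrier R - ?Q"
      then show "s \<odot>\<^bsub>M\<^esub> x \<noteq> \<zero>\<^bsub>M\<^esub>" using Y by (auto simp: submodule_iff)
    qed (use Q x in auto)
    ultimately have "?Q \<in> basic_open R f \<inter> Supp R M" "?Q \<in> basic_open R g"
      using Q unfolding basic_open_def by blast+
    then show ?thesis using g(3) by blast
  qed
  then show "P \<in> zariski R closure_of (basic_open R f \<inter> Supp R M)"
    using top unfolding in_closure_of by blast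
qed

end

section \<open>The algebra generated by a single operator\<close>

context module
begin

lemma generated_operator_stable:
  assumes "generated_operator R M \<kappa> e \<phi>" "submodule H R M" "\<And>x. x \<in> H \<Longrightarrow> \<kappa> x \<in> H" "x \<in> H"
  shows "\<phi> x \<in> H"
  using assms(1,4)
  by (induction arbitrary: x rule: generated_operator.induct)
    (use submoduleE(4,5)[OF assms(2)] assms(3) in simp_all)

text \<open>
  Operators of positive degree are sums of products with a factor \<open>\<kappa>\<close>, and what stands to the left of
  that factor preserves every submodule that contains the image of \<open>\<kappa>\<close>.
\<close>

lemma generated_operator_image:
  assumes "generated_operator R M \<kappa> e \<phi>" "e \<ge> 1" "x \<in> carrier M"
    and H: "submodule H R M" and \<kappa>: "\<And>x. x \<in> carrier M \<Longrightarrow> \<kappa> x \<in> H"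
  shows "\<phi> x \<in> H"
proof -
  have HM: "x \<in> carrier M" if "x \<in> H" for x using H that by (auto simp: submodule_iff)
  show ?thesis
    using assms(1-3)
  proof (induction arbitrary: x rule: generated_operator.induct)
    case (sum e \<phi> \<psi>)
    then show ?case using submoduleE(5)[OF H] by simp
  next
    case (product d \<phi> e \<psi>)
    show ?case
    proof (cases "d = 0")
      case True
      then have "\<psi> x \<in> H" using product by simp
      then show ?thesis using generated_operator_stable[OF product(1) H] \<kappa> HM by simp
    next
      case False
      have "\<psi> x \<in> carrier M"
        using generated_operator_stable[OF product(2) carrier_is_submodule] \<kappa> HM product(6) by blast
      then show ?thesis using product False by simp
    qed
  qed (use \<kappa> in auto)
qed

lemma submodule_image_frobenius_linear:
  assumes "h \<in> lin_maps R (frob_push R p e M) M"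
  shows "submodule (h ` carrier M) R M"
  unfolding submodule_iff
proof (intro conjI ballI)
  note h = lin_maps_frob_pushD[OF assms] lin_maps_frob_push_zero[OF assms]
  show "h ` carrier M \<subseteq> carrier M" using h(1) by blast
  show "\<zero>\<^bsub>M\<^esub> \<in> h ` carrier M" using h(4) by (metis M.zero_closed imageI)
  show "a \<oplus>\<^bsub>M\<^esub> b \<in> h ` carrier M" if ab: "a \<in> h ` carrier M" "b \<in> h ` carrier M" for a b
  proof -
    obtain x y where "x \<in> carrier M" "y \<in> carrier M" "a = h x" "b = h y" using ab by blast
    then show ?thesis using h(2)[of x y] by (metis M.add.m_closed imageI)
  qed
  show "r \<odot>\<^bsub>M\<^esub> a \<in> h ` carrier M" if ra: "r \<in> carrier R" "a \<in> h ` carrier M" for r a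
  proof -
    obtain x where "x \<in> carrier M" "a = h x" using ra by blast
    then show ?thesis using h(3)[of x r] ra(1) by (metis imageI nat_pow_closed smult_closed)
  qed
qed

text \<open>
  The image of \<open>\<kappa>\<close> is a submodule and contains the images of all operators of positive degree.
\<close>

lemma F_pure_generated_surj:
  assumes \<kappa>: "\<kappa> \<in> lin_maps R (frob_push R p 1 M) M" and pure: "F_pure R M (generated_algebra R M \<kappa>)"
  shows "\<kappa> ` carrier M = carrier M"
proof
  let ?D = "plus_image R M (generated_algebra R M \<kappa>)"
  show \<kappa>M: "\<kappa> ` carrier M \<subseteq> carrier M" using lin_maps_frob_pushD(1)[OF \<kappa>] by blast
  obtain h where h: "\<And>n. n \<ge> h \<Longrightarrow> (?D ^^ n) (carrier M) = carrier M"
    using pure by (auto simp: F_pure_def is_stable_image_def eventually_sequentially)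
  have "?D (carrier M) = carrier M" using h[of h] h[of "Suc h"] by simp
  moreover have "?D (carrier M) \<subseteq> \<kappa> ` carrier M"
    using generated_operator_image[OF _ _ _ submodule_image_frobenius_linear[OF \<kappa>], of \<kappa>]
    by (intro plus_image_least[OF submodule_image_frobenius_linear[OF \<kappa>]])
      (simp add: generated_algebra_def)
  ultimately show "carrier M \<subseteq> \<kappa> ` carrier M" by simp
qed

end

section \<open>Transport along isomorphisms\<close>

context module
begin

lemma module_image:
  fixes L :: "('a, 'x) module"
  assumes L: "carrier L = h ` carrier M" "\<zero>\<^bsub>L\<^esub> = h \<zero>\<^bsub>M\<^esub>"
    and add: "\<And>x y. x \<in> carrier M \<Longrightarrow> y \<in> carrier M \<Longrightarrow> h x \<oplus>\<^bsub>L\<^esub> h y = h (x \<oplus>\<^bsub>M\<^esub> y)"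
    and smult: "\<And>r x. r \<in> carrier R \<Longrightarrow> x \<in> carrier M \<Longrightarrow> r \<odot>\<^bsub>L\<^esub> h x = h (r \<odot>\<^bsub>M\<^esub> x)"
  shows "module R L"
proof (rule moduleI)
  show "cring R" by (rule R.is_cring)
  show "abelian_group L"
  proof (rule abelian_groupI)
    fix x assume "x \<in> carrier L"
    then obtain m where m: "m \<in> carrier M" "x = h m" unfolding L by blast
    then have "h (\<ominus>\<^bsub>M\<^esub> m) \<oplus>\<^bsub>L\<^esub> x = \<zero>\<^bsub>L\<^esub>" by (simp add: add L M.l_neg)
    then show "\<exists>y\<in>carrier L. y \<oplus>\<^bsub>L\<^esub> x = \<zero>\<^bsub>L\<^esub>" using m by (intro bexI[of _ "h (\<ominus>\<^bsub>M\<^esub> m)"]) (auto simp: L)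
  qed (auto simp: L add M.a_ac)
qed (auto simp: L add smult smult_l_distr smult_r_distr smult_assoc1)

lemma Supp_isomorphic:
  assumes L: "module R L" "carrier L = h ` carrier M" "\<zero>\<^bsub>L\<^esub> = h \<zero>\<^bsub>M\<^esub>" and inj: "inj_on h (carrier M)"
    and smult: "\<And>r x. r \<in> carrier R \<Longrightarrow> x \<in> carrier M \<Longrightarrow> r \<odot>\<^bsub>L\<^esub> h x = h (r \<odot>\<^bsub>M\<^esub> x)"
  shows "Supp R L = Supp R M"
proof -
  have "s \<odot>\<^bsub>L\<^esub> h m = \<zero>\<^bsub>L\<^esub> \<longleftrightarrow> s \<odot>\<^bsub>M\<^esub> m = \<zero>\<^bsub>M\<^esub>" if "s \<in> carrier R" "m \<in> carrier M" for s m
    unfolding smult[OF that] L(3)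
    by (rule inj_on_eq_iff[OF inj smult_closed[OF that] M.zero_closed])
  then have "(\<forall>s\<in>carrier R - P. s \<odot>\<^bsub>L\<^esub> h m \<noteq> \<zero>\<^bsub>L\<^esub>) \<longleftrightarrow>
      (\<forall>s\<in>carrier R - P. s \<odot>\<^bsub>M\<^esub> m \<noteq> \<zero>\<^bsub>M\<^esub>)" if "m \<in> carrier M" for m P
    using that by blast
  then have "(\<exists>l\<in>carrier L. \<forall>s\<in>carrier R - P. s \<odot>\<^bsub>L\<^esub> l \<noteq> \<zero>\<^bsub>L\<^esub>) \<longleftrightarrow>
      (\<exists>m\<in>carrier M. \<forall>s\<in>carrier R - P. s \<odot>\<^bsub>M\<^esub> m \<noteq> \<zero>\<^bsub>M\<^esub>)" for P
    unfolding L(2) bex_simps(7) by (rule bex_cong[OF refl])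
  then show ?thesis
    by (simp only: set_eq_iff module.Supp_iff[OF L(1)] Supp_iff simp_thms)
qed

end

section \<open>Saturation\<close>

context localization
begin

text \<open>
  The kernel of \<open>M \<rightarrow> S\<^sup>-\<^sup>1(M / Y)\<close>.  In a divisible module this is \<open>S\<^sup>-\<^sup>1Y\<close>.
\<close>

definition saturation :: "'c set \<Rightarrow> 'c set"
  where "saturation Y = {v \<in> carrier M. \<exists>s\<in>S. s \<odot>\<^bsub>M\<^esub> v \<in> Y}"

lemma saturationI: "s \<in> S \<Longrightarrow> v \<in> carrier M \<Longrightarrow> s \<odot>\<^bsub>M\<^esub> v \<in> Y \<Longrightarrow> v \<in> saturation Y"
  unfolding saturation_def by blast

lemma subset_saturation: "Y \<subseteq> carrier M \<Longrightarrow> Y \<subseteq> saturation Y"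
proof
  fix y assume "Y \<subseteq> carrier M" "y \<in> Y"
  then show "y \<in> saturation Y" using one_S by (intro saturationI[of \<one>]) auto
qed

lemma submodule_saturation:
  assumes Y: "submodule Y R M"
  shows "submodule (saturation Y) R M"
  unfolding submodule_iff
proof (intro conjI ballI)
  show "saturation Y \<subseteq> carrier M" by (auto simp: saturation_def)
  show "\<zero>\<^bsub>M\<^esub> \<in> saturation Y"
    using Y one_S by (intro saturationI[of \<one>]) (auto simp: submodule_iff)
next
  fix a b assume "a \<in> saturation Y" "b \<in> saturation Y"
  then obtain s t where s: "s \<in> S" "a \<in> carrier M" "s \<odot>\<^bsub>M\<^esub> a \<in> Y"
    and t: "t \<in> S" "b \<in> carrier M" "t \<odot>\<^bsub>M\<^esub> b \<in> Y" by (auto simp: saturation_def)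
  have "(s \<otimes> t) \<odot>\<^bsub>M\<^esub> (a \<oplus>\<^bsub>M\<^esub> b) = t \<odot>\<^bsub>M\<^esub> (s \<odot>\<^bsub>M\<^esub> a) \<oplus>\<^bsub>M\<^esub> s \<odot>\<^bsub>M\<^esub> (t \<odot>\<^bsub>M\<^esub> b)"
    using s(1,2) t(1,2) smult_comm[of t s a] by (simp add: smult_r_distr smult_assoc1)
  also have "\<dots> \<in> Y" using submoduleE(4,5)[OF Y] s t by simp
  finally show "a \<oplus>\<^bsub>M\<^esub> b \<in> saturation Y"
    using s t by (intro saturationI[OF mult_S[OF s(1) t(1)]]) auto
next
  fix r a assume r: "r \<in> carrier R" and "a \<in> saturation Y"
  then obtain s where s: "s \<in> S" "a \<in> carrier M" "s \<odot>\<^bsub>M\<^esub> a \<in> Y" by (auto simp: saturation_def)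
  have "s \<odot>\<^bsub>M\<^esub> (r \<odot>\<^bsub>M\<^esub> a) = r \<odot>\<^bsub>M\<^esub> (s \<odot>\<^bsub>M\<^esub> a)" using s r smult_comm[of s r a] by simp
  also have "\<dots> \<in> Y" using submoduleE(4)[OF Y] s r by simp
  finally show "r \<odot>\<^bsub>M\<^esub> a \<in> saturation Y" using s r by (intro saturationI[OF s(1)]) auto
qed

lemma saturation_saturated:
  assumes "s \<in> S" "x \<in> carrier M" "s \<odot>\<^bsub>M\<^esub> x \<in> saturation Y"
  shows "x \<in> saturation Y"
proof -
  obtain t where "t \<in> S" "t \<odot>\<^bsub>M\<^esub> (s \<odot>\<^bsub>M\<^esub> x) \<in> Y" using assms(3) by (auto simp: saturation_def)
  then show ?thesis
    using assms(1,2) by (intro saturationI[OF mult_S[of t s]]) (auto simp: smult_assoc1)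
qed

text \<open>
  If \<open>s w\<close> is in the nil closure then \<open>s \<kappa>\<^sup>k(w) = \<kappa>\<^sup>k(s\<^sup>q\<^sup>-\<^sup>1 (s w)) \<in> N\<close> with \<open>q = p\<^sup>k\<close>, and
  \<open>\<kappa>\<^sup>k\<close> is surjective.
\<close>

lemma saturation_nil_closure:
  assumes p: "p \<ge> 1" and \<kappa>: "\<kappa> \<in> lin_maps R (frob_push R p 1 M) M" and surj: "\<kappa> ` carrier M = carrier M"
    and full: "saturation (nil_closure \<kappa> N k) = carrier M"
  shows "saturation N = carrier M"
proof
  show "carrier M \<subseteq> saturation N"
  proof
    fix v assume v: "v \<in> carrier M"
    note ke = frobenius_iterate_lin_maps[OF \<kappa>, of k]
    have "(\<kappa> ^^ k) ` carrier M = carrier M"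
    proof (induction k)
      case (Suc k)
      have "(\<kappa> ^^ Suc k) ` carrier M = \<kappa> ` (\<kappa> ^^ k) ` carrier M" by (simp add: image_comp)
      then show ?case unfolding Suc surj .
    qed simp
    then obtain w where w: "w \<in> carrier M" "v = (\<kappa> ^^ k) w" using v by blast
    then obtain s where s: "s \<in> S" "s \<odot>\<^bsub>M\<^esub> w \<in> nil_closure \<kappa> N k"
      using full by (auto simp: saturation_def)
    then have "(\<kappa> ^^ k) (s [^] (p ^ k - 1) \<odot>\<^bsub>M\<^esub> (s \<odot>\<^bsub>M\<^esub> w)) \<in> N"
      by (simp add: nil_closure_def)
    then have "s \<odot>\<^bsub>M\<^esub> v \<in> N"
      using frobenius_linear_multiple[OF ke p _ w(1), of s] s(1) w(2) by simp
    then show "v \<in> saturation N" using s v by (intro saturationI) auto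
  qed
qed (auto simp: saturation_def)

text \<open>
  One operator of degree 1 suffices.  If \<open>b\<close> is the power of \<open>f\<close> that occurs in it and \<open>s w \<in> Y\<close>, then
  \<open>\<kappa>((b s)\<^sup>p w) = b s \<kappa>(w)\<close> is the value of such an operator at \<open>s w\<close>.
\<close>

lemma saturation_plus_image:
  assumes p: "p \<ge> 1" and \<kappa>: "\<kappa> \<in> lin_maps R (frob_push R p 1 M) M" and surj: "\<kappa> ` carrier M = carrier M"
    and f: "f \<in> S" "\<And>n::nat. f [^] n \<in> S" and full: "saturation Y = carrier M"
  shows "saturation (plus_image R M (power_algebra R p M \<kappa> f t) Y) = carrier M"
proof
  show "carrier M \<subseteq> saturation (plus_image R M (power_algebra R p M \<kappa> f t) Y)"
  proof
    fix v assume v: "v \<in> carrier M"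
    then obtain w where w: "w \<in> carrier M" "v = \<kappa> w" using surj by blast
    then obtain s where s: "s \<in> S" "s \<odot>\<^bsub>M\<^esub> w \<in> Y" using full by (auto simp: saturation_def)
    define b where "b = f [^] nat \<lceil>t * of_nat (p ^ 1)\<rceil>"
    have b: "b \<in> S" using f by (simp add: b_def)
    \<comment> \<open>With this \<open>r\<close>, the element \<open>b r s w\<close> is \<open>(b s)\<^sup>p w\<close>.\<close>
    define r where "r = b [^] (p - 1) \<otimes> s [^] (p - 1)"
    have r: "r \<in> carrier R" using b s by (simp add: r_def)
    have "(\<lambda>m. (\<kappa> ^^ 1) ((b \<otimes> r) \<odot>\<^bsub>M\<^esub> m)) \<in> power_algebra R p M \<kappa> f t 1"
      using r unfolding b_def power_algebra_def by auto
    then have "\<kappa> ((b \<otimes> r) \<odot>\<^bsub>M\<^esub> (s \<odot>\<^bsub>M\<^esub> w)) \<in> plus_image R M (power_algebra R p M \<kappa> f t) Y"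
      using plus_image_incl[of 1 _ "power_algebra R p M \<kappa> f t" "s \<odot>\<^bsub>M\<^esub> w" Y] s(2) by fastforce
    also have "(b \<otimes> r) \<odot>\<^bsub>M\<^esub> (s \<odot>\<^bsub>M\<^esub> w) = (b \<otimes> s) [^] (p ^ 1 - 1) \<odot>\<^bsub>M\<^esub> ((b \<otimes> s) \<odot>\<^bsub>M\<^esub> w)"
      using b s w r by (simp add: r_def smult_assoc1[symmetric] nat_pow_distrib R.m_ac)
    also have "\<kappa> \<dots> = (b \<otimes> s) \<odot>\<^bsub>M\<^esub> v"
      using frobenius_linear_multiple[OF \<kappa> p _ w(1), of "b \<otimes> s"] b s w(2) by simp
    finally show "v \<in> saturation (plus_image R M (power_algebra R p M \<kappa> f t) Y)"
      using v by (intro saturationI[OF mult_S[OF b s(1)]])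
  qed
qed (auto simp: saturation_def)

end

lemma (in cring) multiplicative_subset_powers:
  assumes f: "f \<in> carrier R"
  shows "multiplicative_subset R (powers R f)"
proof (intro multiplicative_subset.intro multiplicative_subset_axioms.intro is_cring)
  show "powers R f \<subseteq> carrier R" using f by (auto simp: powers_def)
  show "\<one> \<in> powers R f" unfolding powers_def by (intro CollectI exI[of _ 0]) simp
  show "s \<otimes> t \<in> powers R f" if "s \<in> powers R f" "t \<in> powers R f" for s t
    using that f by (auto simp: powers_def nat_pow_mult)
qed

context loc_pushforward
begin

lemma frobenius_linear_push_loc:
  assumes \<kappa>: "\<kappa> \<in> lin_maps (loc_ring R S) (frob_push (loc_ring R S) p 1 M) M"
  shows "\<kappa> \<in> lin_maps R (frob_push R p 1 J) J"
proof (rule module.lin_maps_frob_pushI[OF module_push_loc])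
  note k = LM.lin_maps_frob_pushD[OF \<kappa>]
  fix x assume x: "x \<in> carrier J"
  show "\<kappa> x \<in> carrier J" using k(1) x by simp
  show "\<kappa> (x \<oplus>\<^bsub>J\<^esub> y) = \<kappa> x \<oplus>\<^bsub>J\<^esub> \<kappa> y" if "y \<in> carrier J" for y using k(2) x that by simp
  show "\<kappa> (r [^] (p ^ 1) \<odot>\<^bsub>J\<^esub> x) = r \<odot>\<^bsub>J\<^esub> \<kappa> x" if r: "r \<in> carrier R" for r
    using k(3)[of x "ring_frac r \<one>"] x r one_S
    by (simp add: smult_push_loc ring_frac_pow ring_frac_closed)
qed

sublocale J: divisible_module R J S
  by (rule divisible_push_loc)

lemma smult_J_closed [simp]: "r \<in> carrier R \<Longrightarrow> x \<in> carrier M \<Longrightarrow> r \<odot>\<^bsub>J\<^esub> x \<in> carrier M"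
  using J.smult_closed by simp

text \<open>
  The saturation is a submodule over \<open>S\<^sup>-\<^sup>1R\<close>, hence contains the span of \<open>A\<close> over that ring.
\<close>

lemma saturation_full:
  assumes Y: "submodule Y R J" and A: "mod_span (loc_ring R S) M A = carrier M" "A \<subseteq> Y"
  shows "J.saturation Y = carrier M"
proof
  have "submodule (J.saturation Y) (loc_ring R S) M"
    unfolding submodule_loc_ring_iff
    using J.submodule_saturation[OF Y] J.saturation_saturated by auto
  moreover have "A \<subseteq> J.saturation Y"
    using A(2) J.subset_saturation[OF J.submoduleE(1)[OF Y]] by blast
  ultimately show "carrier M \<subseteq> J.saturation Y"
    using LM.mod_span_least A(1) by blast
qed (auto simp: J.saturation_def)

lemma saturation_local_nil:
  assumes p: "p \<ge> 1" and \<kappa>: "\<kappa> \<in> lin_maps R (frob_push R p 1 J) J" and surj: "\<kappa> ` carrier M = carrier M"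
    and fg: "fin_gen (loc_ring R S) M"
    and N: "submodule N R J" "\<kappa> ` N \<subseteq> N" and nil: "\<And>v. v \<in> carrier J \<Longrightarrow> \<exists>k. v \<in> J.nil_closure \<kappa> N k"
  shows "J.saturation N = carrier M"
proof -
  obtain A where A: "A \<subseteq> carrier M" "finite A" "mod_span (loc_ring R S) M A = carrier M"
    using fg by (auto simp: fin_gen_def)
  then obtain k where "A \<subseteq> J.nil_closure \<kappa> N k"
    using J.finite_subset_nil_closure[OF N(2) A(2)] nil subsetD[OF A(1)] push_loc_simps(1) by metis
  then have "J.saturation (J.nil_closure \<kappa> N k) = carrier J"
    using saturation_full[OF J.submodule_nil_closure[OF N(1) \<kappa>] A(3)] by simp
  then show ?thesis using J.saturation_nil_closure[OF p \<kappa>] surj by simp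
qed

end

section \<open>Regularity of the localized stable image\<close>

text \<open>
  A submodule \<open>U\<close> of \<open>j\<^sub>*M\<close> with \<open>S\<^sup>-\<^sup>1U = M\<close>; here \<open>\<Phi>\<close> is an isomorphism \<open>M \<rightarrow> S\<^sup>-\<^sup>1U\<close> of
  \<open>S\<^sup>-\<^sup>1R\<close>-modules.
\<close>

locale dense_in_pushforward = loc_pushforward R S M + dense_submodule R "push_loc R S M" S U
  for R (structure) and S and M (structure) and U
begin

lemma smult_\<Phi>:
  assumes "a \<in> carrier (loc_ring R S)" "x \<in> carrier M"
  shows "a \<odot>\<^bsub>L\<^esub> \<Phi> x = \<Phi> (a \<odot>\<^bsub>M\<^esub> x)"
proof -
  obtain r s where a: "r \<in> carrier R" "s \<in> S" "a = ring_frac r s"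
    using assms(1) by (auto simp: loc_ring_simps)
  then show ?thesis
    using \<Phi>_smult[of r s x "a \<odot>\<^bsub>M\<^esub> x"] smult_push_loc_ring_frac[of r s x] assms by simp
qed

lemma carrier_L': "carrier L = \<Phi> ` carrier M"
  using carrier_L by simp

lemma inj_\<Phi>': "inj_on \<Phi> (carrier M)"
  using inj_\<Phi> by simp

lemma module_L: "module (loc_ring R S) L"
  by (rule LM.module_image[OF carrier_L']) (use \<Phi>_zero \<Phi>_add smult_\<Phi> in simp_all)

sublocale L: module "loc_ring R S" L
  by (rule module_L)

lemma submodule_preimage:
  assumes K: "submodule K (loc_ring R S) L"
  shows "submodule {x \<in> carrier M. \<Phi> x \<in> K} (loc_ring R S) M"
  unfolding LM.submodule_iff
proof (intro conjI ballI)
  show "\<zero>\<^bsub>M\<^esub> \<in> {x \<in> carrier M. \<Phi> x \<in> K}"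
    using K \<Phi>_zero by (simp add: L.submodule_iff)
  show "a \<oplus>\<^bsub>M\<^esub> b \<in> {x \<in> carrier M. \<Phi> x \<in> K}"
    if "a \<in> {x \<in> carrier M. \<Phi> x \<in> K}" "b \<in> {x \<in> carrier M. \<Phi> x \<in> K}" for a b
    using that \<Phi>_add[of a b] L.submoduleE(5)[OF K, of "\<Phi> a" "\<Phi> b"] by simp
  show "r \<odot>\<^bsub>M\<^esub> a \<in> {x \<in> carrier M. \<Phi> x \<in> K}"
    if "r \<in> carrier (loc_ring R S)" "a \<in> {x \<in> carrier M. \<Phi> x \<in> K}" for r a
    using that smult_\<Phi>[of r a] L.submoduleE(4)[OF K, of r "\<Phi> a"] by simp
qed auto

text \<open>
  Under \<open>\<Phi>\<close> the operator \<open>\<phi> (1 / t)\<close> of the induced algebra is \<open>x \<mapsto> \<phi>(t\<^sup>-\<^sup>1 x)\<close>: for the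
  representative \<open>s x / s\<close> of \<open>x = t y\<close>, its definition gives \<open>\<phi>((s t)\<^sup>q y) / (s t) = \<phi>(y)\<close>, where
  \<open>q = p\<^sup>e\<close>.
\<close>

lemma loc_operator_\<Phi>:
  assumes C: "J.cartier_algebra_on p C" and \<phi>: "\<phi> \<in> C e" "\<phi> ` U \<subseteq> U"
    and t: "t \<in> S" and y: "y \<in> carrier M"
  shows "loc_operator R p S VU e \<phi> t (\<Phi> (t \<odot>\<^bsub>J\<^esub> y)) = \<Phi> (\<phi> y)"
proof -
  let ?F = "\<lambda>(m, s). fraction R S VU (\<phi> ((s \<otimes> t) [^] (p ^ e - 1) \<odot>\<^bsub>J\<^esub> m)) (s \<otimes> t)"
  have yJ: "y \<in> carrier J" and ty: "t \<odot>\<^bsub>J\<^esub> y \<in> carrier J" using y t by auto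
  have \<phi>l: "\<phi> \<in> lin_maps R (frob_push R p e J) J" "p \<ge> 1"
    using C \<phi>(1) by (auto simp: J.cartier_algebra_on_def)
  have F: "?F z = \<Phi> (\<phi> y)" if z: "z \<in> \<Phi> (t \<odot>\<^bsub>J\<^esub> y)" for z
  proof -
    obtain s where s: "s \<in> S" "s \<odot>\<^bsub>J\<^esub> (t \<odot>\<^bsub>J\<^esub> y) \<in> U" "z = (s \<odot>\<^bsub>J\<^esub> (t \<odot>\<^bsub>J\<^esub> y), s)"
      using z by (auto simp: \<Phi>_def)
    have st: "s \<otimes> t \<in> S" using mult_S s(1) t by blast
    let ?m = "(s \<otimes> t) [^] (p ^ e - 1) \<odot>\<^bsub>J\<^esub> (s \<odot>\<^bsub>J\<^esub> (t \<odot>\<^bsub>J\<^esub> y))"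
    have "?m = (s \<otimes> t) [^] (p ^ e - 1) \<odot>\<^bsub>J\<^esub> ((s \<otimes> t) \<odot>\<^bsub>J\<^esub> y)"
      using J.smult_assoc1[of s t y] s(1) t yJ by simp
    then have \<phi>m: "\<phi> ?m = (s \<otimes> t) \<odot>\<^bsub>J\<^esub> \<phi> y"
      using J.frobenius_linear_multiple[OF \<phi>l S_carrier[OF st] yJ] by simp
    have "?m \<in> U" using s t submodule_U J.submoduleE(4)[OF submodule_U] by simp
    then have "\<phi> ?m \<in> U" using \<phi>(2) by blast
    then show ?thesis
      using fraction_eq_\<Phi>[OF st, of "\<phi> y"] J.lin_maps_frob_pushD(1)[OF \<phi>l(1) yJ] \<phi>m s(3) by simp
  qed
  obtain s where "s \<in> S" "s \<odot>\<^bsub>J\<^esub> (t \<odot>\<^bsub>J\<^esub> y) \<in> U" using dense[OF ty] by blast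
  then have ne: "\<Phi> (t \<odot>\<^bsub>J\<^esub> y) \<noteq> {}" by (auto simp: \<Phi>_def)
  have "loc_operator R p S VU e \<phi> t (\<Phi> (t \<odot>\<^bsub>J\<^esub> y)) = (\<Union>z\<in>\<Phi> (t \<odot>\<^bsub>J\<^esub> y). ?F z)"
    by (simp add: loc_operator_def)
  also have "\<dots> = \<Phi> (\<phi> y)" by (rule SUP_eq_const[OF ne F])
  finally show ?thesis .
qed

text \<open>
  Localizing \<open>C\<^sub>+ U = U\<close>.
\<close>

lemma F_pure_L:
  assumes C: "J.cartier_algebra_on p C" and stable: "\<And>e \<phi>. \<phi> \<in> C e \<Longrightarrow> \<phi> ` U \<subseteq> U"
    and U: "plus_image R J C U = U"
  shows "F_pure (loc_ring R S) L (loc_algebra R p S VU C)"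
proof -
  let ?D = "plus_image (loc_ring R S) L (loc_algebra R p S VU C)"
  have "?D (carrier L) = carrier L"
  proof
    show "?D (carrier L) \<subseteq> carrier L"
    proof (rule L.plus_image_least[OF L.carrier_is_submodule])
      fix e \<psi> l assume "\<psi> \<in> loc_algebra R p S VU C e" and l: "l \<in> carrier L"
      then obtain \<phi> t where \<phi>: "\<psi> = loc_operator R p S VU e \<phi> t" "\<phi> \<in> C e" "t \<in> S"
        unfolding loc_algebra_def by blast
      obtain x where x: "x \<in> carrier M" "l = \<Phi> x" using l carrier_L' by auto
      then obtain y where y: "y \<in> carrier M" "t \<odot>\<^bsub>J\<^esub> y = x" using J.divide[OF \<phi>(3), of x] by auto
      have "\<psi> l = \<Phi> (\<phi> y)"
        using loc_operator_\<Phi>[OF C \<phi>(2) stable[OF \<phi>(2)] \<phi>(3) y(1)] x y \<phi> by simp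
      then show "\<psi> l \<in> carrier L"
        using J.cartier_algebra_onD(1)[OF C \<phi>(2)] y carrier_L' by simp
    qed
    \<comment> \<open>Pulled back to \<open>M\<close>, the image contains \<open>C\<^sub>+ U = U\<close> and is closed under division by \<open>S\<close>.\<close>
    let ?H = "{x \<in> carrier M. \<Phi> x \<in> ?D (carrier L)}"
    have "submodule (?D (carrier L)) (loc_ring R S) L"
      unfolding plus_image_def
    proof (rule L.submodule_mod_span)
      show "(\<Union>e\<in>{1..}. \<Union>\<psi>\<in>loc_algebra R p S VU C e. \<psi> ` carrier L) \<subseteq> carrier L"
        using \<open>?D (carrier L) \<subseteq> carrier L\<close> unfolding plus_image_def
        by (rule order_trans[OF L.mod_span_incl])
    qed
    then have H: "submodule ?H (loc_ring R S) M" by (rule submodule_preimage)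
    then have H': "submodule ?H R J" "\<And>s x. s \<in> S \<Longrightarrow> x \<in> carrier M \<Longrightarrow> s \<odot>\<^bsub>J\<^esub> x \<in> ?H \<Longrightarrow> x \<in> ?H"
      unfolding submodule_loc_ring_iff by blast+
    have "plus_image R J C U \<subseteq> ?H"
    proof (rule J.plus_image_least[OF H'(1)])
      fix e :: nat and \<phi> u assume e: "e \<ge> 1" and \<phi>: "\<phi> \<in> C e" and u: "u \<in> U"
      have uM: "u \<in> carrier M" using U_carrier[OF u] by simp
      have "loc_operator R p S VU e \<phi> \<one> \<in> loc_algebra R p S VU C e"
        using \<phi> one_S unfolding loc_algebra_def by blast
      moreover have "\<Phi> u \<in> carrier L" using uM carrier_L' by simp
      ultimately have "loc_operator R p S VU e \<phi> \<one> (\<Phi> u) \<in> ?D (carrier L)"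
        using L.plus_image_incl[OF e] by blast
      then show "\<phi> u \<in> ?H"
        using loc_operator_\<Phi>[OF C \<phi> stable[OF \<phi>] one_S uM] J.cartier_algebra_onD(1)[OF C \<phi>, of u]
          uM J.smult_one[of u] by simp
    qed
    then have UH: "U \<subseteq> ?H" using U by simp
    show "carrier L \<subseteq> ?D (carrier L)"
    proof
      fix l assume "l \<in> carrier L"
      then obtain x where x: "x \<in> carrier M" "l = \<Phi> x" using carrier_L' by auto
      then obtain s where "s \<in> S" "s \<odot>\<^bsub>J\<^esub> x \<in> U" using dense[of x] by auto
      then have "x \<in> ?H" using UH H'(2) x(1) by blast
      then show "l \<in> ?D (carrier L)" using x by simp
    qed
  qed
  then have "(?D ^^ h) (carrier L) = carrier L" for h by (induction h) simp_all
  then show ?thesis unfolding F_pure_def is_stable_image_def by simp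
qed

lemma Supp_L: "Supp (loc_ring R S) L = Supp (loc_ring R S) M"
  by (rule LM.Supp_isomorphic[OF module_L carrier_L' _ inj_\<Phi>']) (use \<Phi>_zero smult_\<Phi> in simp_all)

text \<open>
  A stable submodule \<open>K\<close> of \<open>S\<^sup>-\<^sup>1U\<close> corresponds to a submodule of \<open>M\<close> that is stable under \<open>\<kappa>\<close>:
  with \<open>b\<close> the power of \<open>f\<close> that occurs in degree 1, the operator \<open>\<kappa> b\<close> of \<open>C\<close> and the
  denominator \<open>b\<close> together give \<open>\<kappa>\<close>.  The support and the generic points are preserved by \<open>\<Phi>\<close>.
\<close>

lemma F_regular_L:
  fixes t :: rat
  assumes p: "p \<ge> 2" and \<kappa>: "\<kappa> \<in> lin_maps (loc_ring R S) (frob_push (loc_ring R S) p 1 M) M"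
    and f: "f \<in> carrier R" "\<And>n::nat. f [^] n \<in> S"
    and reg: "F_regular (loc_ring R S) M (generated_algebra (loc_ring R S) M \<kappa>)"
  defines "C \<equiv> power_algebra R p J \<kappa> f t"
  assumes U: "plus_image R J C U = U" "\<And>e \<phi>. \<phi> \<in> C e \<Longrightarrow> \<phi> ` U \<subseteq> U"
  shows "F_regular (loc_ring R S) L (loc_algebra R p S VU C)"
  unfolding F_regular_def
proof (intro conjI allI impI)
  note \<kappa>J = frobenius_linear_push_loc[OF \<kappa>]
  have C: "J.cartier_algebra_on p C"
    unfolding C_def by (rule J.cartier_algebra_power_algebra[OF p \<kappa>J f(1)])
  show "F_pure (loc_ring R S) L (loc_algebra R p S VU C)"
    by (rule F_pure_L[OF C U(2,1)])
  fix K assume "alg_submodule (loc_ring R S) L (loc_algebra R p S VU C) K \<and>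
    agree_generically (loc_ring R S) L (generic_points (loc_ring R S) L) K (carrier L)"
  then have K: "submodule K (loc_ring R S) L" "\<And>e \<psi>. \<psi> \<in> loc_algebra R p S VU C e \<Longrightarrow> \<psi> ` K \<subseteq> K"
    and agree: "agree_generically (loc_ring R S) L (generic_points (loc_ring R S) L) K (carrier L)"
    by (auto simp: alg_submodule_def)
  let ?K = "{x \<in> carrier M. \<Phi> x \<in> K}"
  have K': "submodule ?K (loc_ring R S) M" by (rule submodule_preimage[OF K(1)])
  have \<kappa>K: "\<kappa> x \<in> ?K" if x: "x \<in> ?K" for x
  proof -
    define b where "b = f [^] nat \<lceil>t * of_nat (p ^ 1)\<rceil>"
    have b: "b \<in> S" using f by (simp add: b_def)
    obtain y where y: "y \<in> carrier M" "b \<odot>\<^bsub>J\<^esub> y = x" using J.divide[OF b, of x] x by auto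
    let ?\<phi> = "\<lambda>m. (\<kappa> ^^ 1) ((b \<otimes> \<one>) \<odot>\<^bsub>J\<^esub> m)"
    have \<phi>: "?\<phi> \<in> C 1" unfolding b_def C_def power_algebra_def by auto
    have "loc_operator R p S VU 1 ?\<phi> b (\<Phi> x) = \<Phi> (?\<phi> y)"
      using loc_operator_\<Phi>[OF C \<phi> U(2)[OF \<phi>] b y(1)] y(2) by simp
    moreover have "loc_operator R p S VU 1 ?\<phi> b (\<Phi> x) \<in> K"
      using K(2)[of "loc_operator R p S VU 1 ?\<phi> b" 1] \<phi> b x unfolding loc_algebra_def by blast
    moreover have "?\<phi> y = \<kappa> x" using b y by simp
    ultimately show ?thesis using LM.lin_maps_frob_pushD(1)[OF \<kappa>, of x] x by simp
  qed
  have "alg_submodule (loc_ring R S) M (generated_algebra (loc_ring R S) M \<kappa>) ?K"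
    unfolding alg_submodule_def
    using K' LM.generated_operator_stable[OF _ K' \<kappa>K] by (auto simp: generated_algebra_def)
  moreover have "agree_generically (loc_ring R S) M (generic_points (loc_ring R S) M) ?K (carrier M)"
  proof -
    have Z: "generic_points (loc_ring R S) L = generic_points (loc_ring R S) M"
      by (simp add: generic_points_def Supp_L)
    have prime: "primeideal P (loc_ring R S)" if "P \<in> generic_points (loc_ring R S) M" for P
      using that by (auto simp: generic_points_def Supp_def)
    have "\<exists>s\<in>carrier (loc_ring R S) - P. s \<odot>\<^bsub>M\<^esub> x \<in> ?K"
      if P: "P \<in> generic_points (loc_ring R S) M" and x: "x \<in> carrier M" for P x
    proof -
      have "\<Phi> x \<in> carrier L" using x carrier_L' by simp
      then obtain s where s: "s \<in> carrier (loc_ring R S) - P" "s \<odot>\<^bsub>L\<^esub> \<Phi> x \<in> K"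
        using agree[unfolded Z] P
          L.agree_generically_iff[OF K(1) L.carrier_is_submodule prime, of "generic_points (loc_ring R S) M"]
        by blast
      then have "s \<odot>\<^bsub>M\<^esub> x \<in> ?K" using smult_\<Phi>[of s x] x by simp
      then show ?thesis using s by blast
    qed
    moreover have "\<exists>s\<in>carrier (loc_ring R S) - P. s \<odot>\<^bsub>M\<^esub> x \<in> carrier M"
      if P: "P \<in> generic_points (loc_ring R S) M" and x: "x \<in> ?K" for P x
    proof -
      have "\<one>\<^bsub>loc_ring R S\<^esub> \<in> carrier (loc_ring R S) - P"
        using LM.localization_prime[OF prime[OF P]]
        by (simp add: localization_def multiplicative_subset_def multiplicative_subset_axioms_def)
      then show ?thesis using x by (intro bexI[of _ "\<one>\<^bsub>loc_ring R S\<^esub>"]) auto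
    qed
    ultimately show ?thesis
      using LM.agree_generically_iff[OF K' LM.carrier_is_submodule prime, of "generic_points (loc_ring R S) M"]
      by blast
  qed
  ultimately have KM: "?K = carrier M" using reg unfolding F_regular_def by blast
  have "carrier L \<subseteq> K"
  proof
    fix l assume "l \<in> carrier L"
    then obtain x where "x \<in> carrier M" "l = \<Phi> x" unfolding carrier_L' by (rule imageE)
    then show "l \<in> K" using KM by (metis (mono_tags, lifting) mem_Collect_eq)
  qed
  then show "K = carrier L" using L.submoduleE(1)[OF K(1)] by blast
qed

end

section \<open>Test elements and test modules\<close>

text \<open>
  \<open>F\<close>-regularity makes \<open>\<kappa>\<close> surjective, hence \<open>S\<^sup>-\<^sup>1N = M\<close>, and then inductively
  \<open>S\<^sup>-\<^sup>1(C\<^sub>+)\<^sup>h N = M\<close> for all \<open>h\<close>.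
\<close>

lemma test_element_generator:
  assumes noeth: "noetherian_ring R" and f: "f \<in> carrier R"
    and push: "loc_pushforward R (powers R f) M" and p: "p \<ge> 2"
    and \<kappa>: "\<kappa> \<in> lin_maps (loc_ring R (powers R f)) (frob_push (loc_ring R (powers R f)) p 1 M) M"
    and fg: "fin_gen (loc_ring R (powers R f)) M"
    and reg: "F_regular (loc_ring R (powers R f)) M (generated_algebra (loc_ring R (powers R f)) M \<kappa>)"
  defines "J \<equiv> push_loc R (powers R f) M"
  assumes N: "submodule N R J" "\<kappa> ` N \<subseteq> N" "fin_gen R (J\<lparr>carrier := N\<rparr>)"
      "\<And>v. v \<in> carrier J \<Longrightarrow> \<exists>k. v \<in> module.nil_closure R J \<kappa> N k"
  shows "test_element R p (J\<lparr>carrier := N\<rparr>) (power_algebra R p J \<kappa> f t) f"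
proof -
  let ?S = "powers R f"
  let ?C = "power_algebra R p J \<kappa> f t"
  interpret P: loc_pushforward R ?S M by (rule push)
  have p1: "p \<ge> 1" using p by simp
  have fpow: "f [^]\<^bsub>R\<^esub> n \<in> ?S" for n :: nat by (auto simp: powers_def)
  have fS: "f \<in> ?S" using fpow[of 1] f by simp
  note \<kappa>J = P.frobenius_linear_push_loc[OF \<kappa>, folded J_def]
  have surj: "\<kappa> ` carrier M = carrier M"
    using P.LM.F_pure_generated_surj[OF \<kappa>] reg by (simp add: F_regular_def)
  obtain U where U: "is_stable_image R (J\<lparr>carrier := N\<rparr>) ?C U"
    using P.J.stable_image_power_algebra[OF p _ f noeth, folded J_def, OF \<kappa>J N(1-3)] .
  note props = P.J.stable_image_properties[OF p _ f, folded J_def, OF \<kappa>J N(1,2) U]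
  have "P.J.saturation N = carrier M"
    using P.saturation_local_nil[OF p1 _ surj fg, folded J_def, OF \<kappa>J N(1,2,4)]
    unfolding J_def by simp
  then have sat: "P.J.saturation ((plus_image R J ?C ^^ h) N) = carrier M" for h
  proof (induction h)
    case (Suc h)
    then show ?case
      using P.J.saturation_plus_image[OF p1 _ _ fS fpow, folded J_def, OF \<kappa>J] surj by (simp add: J_def)
  qed simp
  obtain h where "(plus_image R J ?C ^^ h) N = U"
    using P.J.is_stable_image_powerD[OF f, folded J_def, OF N(1,2) U] by blast
  then have satU: "P.J.saturation U = carrier M" using sat[of h] by simp
  have dense: "\<exists>s\<in>?S. s \<odot>\<^bsub>J\<^esub> x \<in> U" if "x \<in> carrier J" for x
    using satU that unfolding P.J.saturation_def J_def by auto
  interpret D: dense_in_pushforward R ?S M U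
    by (intro dense_in_pushforward.intro dense_submodule.intro dense_submodule_axioms.intro
        push P.divisible_push_loc props(1)[unfolded J_def] dense[unfolded J_def])
  have reg': "F_regular (loc_ring R ?S) (loc_module R ?S (J\<lparr>carrier := U\<rparr>)) (loc_algebra R p ?S (J\<lparr>carrier := U\<rparr>) ?C)"
    using D.F_regular_L[OF p \<kappa> f fpow reg, folded J_def, OF props(3,4)] .
  have stable: "stable_image R (J\<lparr>carrier := N\<rparr>) ?C = U"
    using module.stable_image_eqI[OF submodule.submodule_is_module[OF N(1)[unfolded J_def] P.module_push_loc]]
      U unfolding J_def by blast
  have "Supp R (J\<lparr>carrier := U\<rparr>) \<subseteq> zariski R closure_of (basic_open R f \<inter> Supp R (J\<lparr>carrier := U\<rparr>))"
    unfolding J_def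
  proof (rule D.U.Supp_dense[OF noeth f])
    fix m assume m: "m \<in> carrier D.VU" "f \<odot>\<^bsub>D.VU\<^esub> m = \<zero>\<^bsub>D.VU\<^esub>"
    then show "m = \<zero>\<^bsub>D.VU\<^esub>"
      using P.J.cancel[OF fS, of m "\<zero>\<^bsub>P.J\<^esub>"] D.U_carrier[of m] P.J.smult_r_null[OF f] by simp
  qed
  then show ?thesis using f reg' unfolding test_element_def Let_def stable by simp
qed

theorem proposition3p5:
  fixes R :: "('a, 'r) ring_scheme" and p :: nat and f :: 'a
    and M :: "(('a \<times> 'a) set, 'm, 'c) module_scheme" and \<kappa> :: "'m \<Rightarrow> 'm" and N N' :: "'m set"
  defines "Rf \<equiv> loc_ring R (powers R f)"
    and "jM \<equiv> push_loc R (powers R f) M"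
  defines "A \<equiv> (\<lambda>N t. power_algebra R p (jM\<lparr>carrier := N\<rparr>) \<kappa> f t)"
  assumes R: "cring R" "noetherian_ring R"
    and char: "Factorial_Ring.prime p" "[p] \<cdot>\<^bsub>R\<^esub> \<one>\<^bsub>R\<^esub> = \<zero>\<^bsub>R\<^esub>"
    and F_fin: "F_finite R p"
    and f: "f \<in> carrier R" "\<forall>r\<in>carrier R. f \<otimes>\<^bsub>R\<^esub> r = \<zero>\<^bsub>R\<^esub> \<longrightarrow> r = \<zero>\<^bsub>R\<^esub>"
    and M: "cartier_module Rf p M \<kappa>" "fin_gen Rf M"
    and N: "cartier_submodule R jM \<kappa> N" "fin_gen R (jM\<lparr>carrier := N\<rparr>)"
      "local_nil_isomorphism R (jM\<lparr>carrier := N\<rparr>) \<kappa> jM \<kappa> (\<lambda>m. m)"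
    and N': "cartier_submodule R jM \<kappa> N'" "fin_gen R (jM\<lparr>carrier := N'\<rparr>)"
      "local_nil_isomorphism R (jM\<lparr>carrier := N'\<rparr>) \<kappa> jM \<kappa> (\<lambda>m. m)"
  shows "(\<forall>t\<ge>0. \<forall>T. is_test_module R (jM\<lparr>carrier := N\<rparr>) (A N t) T \<longleftrightarrow>
                    is_test_module R (jM\<lparr>carrier := N'\<rparr>) (A N' t) T) \<and>
    (F_regular Rf M (generated_algebra Rf M \<kappa>) \<longrightarrow>
      (\<forall>t\<ge>0. test_element R p (jM\<lparr>carrier := N\<rparr>) (A N t) f \<and>
             test_element R p (jM\<lparr>carrier := N'\<rparr>) (A N' t) f))"
proof -
  have p: "p \<ge> 2" by (rule prime_ge_2_nat[OF char(1)])
  have "module Rf M" and \<kappa>: "\<kappa> \<in> lin_maps Rf (frob_push Rf p 1 M) M"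
    using M(1) by (simp_all add: cartier_module_def)
  then have push: "loc_pushforward R (powers R f) M"
    using cring.multiplicative_subset_powers[OF R(1) f(1)]
    unfolding Rf_def by (intro loc_pushforward.intro)
  have jM: "module R jM"
    unfolding jM_def by (rule loc_pushforward.module_push_loc[OF push])
  interpret jM: module R jM by (rule jM)
  have \<kappa>j: "\<kappa> \<in> lin_maps R (frob_push R p 1 jM) jM"
    using loc_pushforward.frobenius_linear_push_loc[OF push] \<kappa> unfolding Rf_def jM_def by blast
  have A: "A X t = power_algebra R p jM \<kappa> f t" for X t
    unfolding A_def by (rule jM.power_algebra_restrict)
  have sub: "submodule X R jM" "\<kappa> ` X \<subseteq> X" if "cartier_submodule R jM \<kappa> X" for X
    using that by (simp_all add: cartier_submodule_def)
  have nil: "\<exists>k. v \<in> jM.nil_closure \<kappa> X k"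
    if "cartier_submodule R jM \<kappa> X" "local_nil_isomorphism R (jM\<lparr>carrier := X\<rparr>) \<kappa> jM \<kappa> (\<lambda>m. m)"
      "v \<in> carrier jM" for X v
    by (rule jM.local_nil_isomorphismD[OF sub[OF that(1)] \<kappa>j that(2,3)])
  have test: "test_element R p (jM\<lparr>carrier := X\<rparr>) (power_algebra R p jM \<kappa> f t) f"
    if "cartier_submodule R jM \<kappa> X" "fin_gen R (jM\<lparr>carrier := X\<rparr>)"
      "local_nil_isomorphism R (jM\<lparr>carrier := X\<rparr>) \<kappa> jM \<kappa> (\<lambda>m. m)"
      "F_regular Rf M (generated_algebra Rf M \<kappa>)" for X t
    using test_element_generator[OF R(2) f(1) push p, folded Rf_def jM_def,
        OF \<kappa> M(2) that(4) sub[OF that(1)] that(2) nil[OF that(1,3)]] .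
  show ?thesis
    unfolding A
    using jM.is_test_module_independent[OF p \<kappa>j f(1) R(2) sub[OF N(1)] N(2) nil[OF N(1,3)]
        sub[OF N'(1)] N'(2) nil[OF N'(1,3)]] test[OF N] test[OF N'] by blast
qed

end
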